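(* For primes $p\equiv 1\pmod 4$ and any integer $n$ with $\gcd(n,p)=1$, $$\sum_{\chi\neq\chi_0}|G(n,\chi;p)|^6\cdot|L(1,\chi)|=10\cdot C\cdot p^4+O(p^{7/2}\ln p),$$ where the sum runs over all non-principal Dirichlet characters $\chi$ modulo $p$, and the implied constant is absolute (independent of $p$ and $n$).
   Context: For a prime $p$, an integer $n$ and a Dirichlet character $\chi$ modulo $p$, the generalized quadratic Gauss sum is $G(n,\chi;p)=\sum_{a=1}^{p}\chi(a)e\!\left(\frac{na^2}{p}\right)$ with $e(y)=e^{2\pi i y}$. $\chi_0$ is the principal character modulo $p$, and $L(s,\chi)$ is the Dirichlet $L$-function of $\chi$. The constant $C$ is $$C=\prod_{q}\left[\sum_{m=0}^{\infty}\frac{\binom{2m}{m}^2}{4^{2m}q^{2m}}\right]=\prod_q\left[1+\frac{\binom{2}{1}^2}{4^2q^2}+\frac{\binom{4}{2}^2}{4^4q^4}+\cdots\right],$$ the product over all primes $q$. *)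

theory Defs
  imports "HOL-Analysis.Analysis" "HOL-Number_Theory.Number_Theory"
begin

definition dirichlet_char :: "nat \<Rightarrow> (nat \<Rightarrow> complex) \<Rightarrow> bool" where
  "dirichlet_char m chi \<longleftrightarrow>
     (\<forall>a b. chi (a * b) = chi a * chi b) \<and>
     (\<forall>a. chi (a + m) = chi a) \<and>
     (\<forall>a. chi a \<noteq> 0 \<longleftrightarrow> coprime a m)"

definition principal_char :: "nat \<Rightarrow> nat \<Rightarrow> complex" where
  "principal_char m a = (if coprime a m then 1 else 0)"

definition e :: "real \<Rightarrow> complex" where
  "e y = exp (2 * of_real pi * \<i> * of_real y)"

definition gauss_sum2 :: "int \<Rightarrow> (nat \<Rightarrow> complex) \<Rightarrow> nat \<Rightarrow> complex" where
  "gauss_sum2 n chi p = (\<Sum>a=1..p. chi a * e (of_int n * (of_nat a)^2 / of_nat p))"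

definition L1 :: "(nat \<Rightarrow> complex) \<Rightarrow> complex" where
  "L1 chi = lim (\<lambda>N. \<Sum>k=1..N. chi k / of_nat k)"

definition C_const :: real where
  "C_const = lim (\<lambda>N. \<Prod>q\<in>{q::nat. prime q \<and> q \<le> N}.
      (\<Sum>m. (real ((2*m) choose m))^2 / (4^(2*m) * (real q)^(2*m))))"

end

theory Submission
  imports Defs
begin

text \<open>
  For an even non-principal character, $|G(n,\chi;p)|^2 = 2p + gS(\chi)$, where $g^2 = p$ and
  $S(\chi) = \sum_c \chi(c) f(c)$ with $f(c) = ((c^2-1)/p)$; for odd characters both sides of the
  analogous formula vanish. Hence $|G|^6$ is the character sum of
  $V = 4p^3\delta + 12p^2 g f + 6p^2 f*f + pg f*f*f$, where $\delta$ is the indicator of $c^2 = 1$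
  and $*$ is multiplicative convolution. Now $f*f$ is $p + O(1)$ at $\pm 1$ and a cubic Legendre sum
  elsewhere, hence $O(\sqrt p)$ by the Hasse bound (proved by Stepanov's method), and $f*f*f = O(p)$ because
  a finite field analogue of Clausen's formula expresses it through the square of a cubic Legendre sum.
  So $V = 10p^3\delta + O(p^{5/2})$.

  Let $r$ be the multiplicative function with $r * r = 1$ (Dirichlet convolution) and
  $A(\chi) = \sum_{n<p} r(n)\chi(n)/n$. The coefficients of $L(1,\chi) - A(\chi)^2$ vanish below $p$
  and lie in $[0,1]$, so even the trivial bound for the off-diagonal terms gives a mean square
  $O(\ln^2 p)$ over $\chi$. By Cauchy-Schwarz $|L(1,\chi)|$ may be replaced by $|A(\chi)|^2$, and
  orthogonality turns the resulting sum into $10p^4 \sum_n r(n)^2/n^2$, whose Euler product is $C$.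
\<close>

hide_const (open) UnivPoly.coeff UnivPoly.monom Module.smult

section \<open>Polynomials modulo a prime\<close>

text \<open>The trivial estimates fail in one place. The values of f*f alone give only f*f*f =
  O(p^(3/2)), and the factor p g, itself of size p^(3/2), would turn this into an error p^3 in V, as
  large as the main coefficient. Another sqrt(p) has to be saved, and bounding one variable at a
  time cannot do it; the Clausen identity does, because it lets the Hasse bound be used twice.
  |L(1,chi)| is out of reach of orthogonality, whereas |A(chi)|^2 is a finite bilinear expression in
  chi and its conjugate. The error p^(7/2) ln p arises twice: from Cauchy-Schwarz with mean squares
  O(p^7) for the sixth powers and O(ln^2 p) for L - A^2, and from p characters times the error
  p^(5/2) of V times (sum r(n)/n)^2 = O(ln p).\<close>

locale prime_modulus =
  fixes p :: nat
  assumes prime_p: "prime p"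
begin

abbreviation pc :: "int poly" where "pc \<equiv> [:int p:]"

lemma prime_elem_pc: "prime_elem pc" using prime_p by (simp add: prime_elem_const_poly_iff)

lemma pc_dvd_poly: "pc dvd h \<Longrightarrow> int p dvd poly h x"
  by (auto simp: dvd_def)

text \<open>The representative with coefficients in [0,p) makes the degree modulo \<open>p\<close>
  visible: unless it is zero, its leading coefficient is prime to \<open>p\<close>.\<close>

definition red :: "int poly \<Rightarrow> int poly" where
  "red h = map_poly (\<lambda>c. c mod int p) h"

lemma coeff_red: "coeff (red h) i = coeff h i mod int p"
  by (simp add: red_def coeff_map_poly)

lemma pc_dvd_red: "pc dvd h - red h"
  by (auto simp: const_poly_dvd_iff coeff_red mod_eq_dvd_iff[symmetric])

lemma red_eq_0_iff: "red h = 0 \<longleftrightarrow> pc dvd h"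
  by (auto simp: poly_eq_iff coeff_red const_poly_dvd_iff dvd_eq_mod_eq_0)

lemma lead_coeff_red: "\<not> pc dvd h \<Longrightarrow> \<not> int p dvd lead_coeff (red h)"
  by (metis coeff_red dvd_eq_mod_eq_0 leading_coeff_0_iff mod_mod_trivial red_eq_0_iff)

text \<open>Divisibility by (X - x)^l in the polynomial ring over the field with \<open>p\<close>
  elements, kept inside integer polynomials.\<close>

definition vanishes_to :: "int \<Rightarrow> nat \<Rightarrow> int poly \<Rightarrow> bool" where
  "vanishes_to x l h \<longleftrightarrow> (\<exists>q. pc dvd h - [:-x,1:]^l * q)"

lemma vanishes_to_0 [simp]: "vanishes_to x 0 h" unfolding vanishes_to_def by (rule exI[of _ h]) simp

lemma vanishes_to_1: "int p dvd poly h x \<Longrightarrow> vanishes_to x 1 h"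
proof -
  assume a: "int p dvd poly h x"
  have "poly (h - [:poly h x:]) x = 0" by simp
  then obtain q where q: "h - [:poly h x:] = [:-x,1:] * q" by (metis dvd_def poly_eq_0_iff_dvd)
  have "h - [:-x,1:] * q = [:poly h x:]" using q by (simp add: algebra_simps)
  then show ?thesis unfolding vanishes_to_def using a by (intro exI[of _ q]) simp
qed

lemma vanishes_to_mult: "vanishes_to x l h \<Longrightarrow> vanishes_to x l (g * h)"
proof -
  assume "vanishes_to x l h"
  then obtain q where "pc dvd h - [:-x,1:]^l * q" unfolding vanishes_to_def by blast
  then have "pc dvd g * (h - [:-x,1:]^l * q)" by simp
  then have "pc dvd g * h - [:-x,1:]^l * (g * q)" by (simp add: algebra_simps)
  then show ?thesis unfolding vanishes_to_def by blast
qed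

lemma vanishes_to_cong: "vanishes_to x l h \<Longrightarrow> pc dvd h - h' \<Longrightarrow> vanishes_to x l h'"
proof -
  assume "vanishes_to x l h" and a: "pc dvd h - h'"
  then obtain q where "pc dvd h - [:-x,1:]^l * q" unfolding vanishes_to_def by blast
  then have "pc dvd (h - [:-x,1:]^l * q) - (h - h')" using a by (rule dvd_diff)
  then show ?thesis unfolding vanishes_to_def by (intro exI[of _ q]) simp
qed

lemma pc_dvd_mult_iff: "pc dvd a * b \<longleftrightarrow> pc dvd a \<or> pc dvd b" using prime_elem_pc by (rule prime_elem_dvd_mult_iff)

lemma not_pc_dvd_linear_power: "\<not> pc dvd [:-x,1:]^l"
proof
  assume "pc dvd [:-x,1:]^l"
  then have "pc dvd [:-x,1:]" using prime_elem_pc by (meson prime_elem_dvd_power)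
  then have "int p dvd 1" unfolding const_poly_dvd_iff by (metis coeff_pCons_Suc coeff_pCons_0 one_pCons pCons_one)
  then show False using prime_p by (metis not_prime_unit prime_nat_int_transfer)
qed

lemma pc_dvd_cancel:
  "pc dvd [:-x,1:]^l * a - [:-x,1:]^l * b \<longleftrightarrow> pc dvd a - b"
  by (metis right_diff_distrib pc_dvd_mult_iff not_pc_dvd_linear_power)

lemma dvd_mult_p: "int p dvd a * b \<longleftrightarrow> int p dvd a \<or> int p dvd b" using prime_p by (simp add: prime_dvd_mult_iff)

text \<open>One factor is gained at a time: once Q = (X - x)^l Q1 modulo \<open>p\<close>,
  cancelling (X - x)^l leaves B Q1 divisible by X - x, so B(x) Q1(x) = 0 and \<open>x\<close> is a
  root of \<open>Q1\<close>.\<close>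

lemma vanishes_to_cancel:
  assumes "\<not> int p dvd poly B x" "vanishes_to x l (B * Q)"
  shows "vanishes_to x l Q" using assms(2)
proof (induction l)
  case (Suc l)
  obtain G where G: "pc dvd B * Q - [:-x,1:]^Suc l * G" using Suc.prems unfolding vanishes_to_def by blast
  have "pc dvd B * Q - [:-x,1:]^l * ([:-x,1:] * G)" using G by (simp only: power_Suc2 mult.assoc)
  then have "vanishes_to x l (B * Q)" unfolding vanishes_to_def by blast
  then have "vanishes_to x l Q" by (rule Suc.IH)
  then obtain Q1 where Q1: "pc dvd Q - [:-x,1:]^l * Q1" unfolding vanishes_to_def by blast
  have "pc dvd (B * Q - [:-x,1:]^Suc l * G) - B * (Q - [:-x,1:]^l * Q1)" using G Q1 by (meson dvd_diff dvd_mult)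
  also have "(B * Q - [:-x,1:]^Suc l * G) - B * (Q - [:-x,1:]^l * Q1) = [:-x,1:]^l * (B * Q1) - [:-x,1:]^l * ([:-x,1:] * G)"
    unfolding power_Suc2 by (simp add: algebra_simps del: mult_pCons_left mult_pCons_right)
  finally have "pc dvd B * Q1 - [:-x,1:] * G" by (simp only: pc_dvd_cancel)
  then have "int p dvd poly (B * Q1 - [:-x,1:] * G) x" by (rule pc_dvd_poly)
  then have "int p dvd poly B x * poly Q1 x" by simp
  then have "int p dvd poly Q1 x" using assms(1) by (simp add: dvd_mult_p)
  then obtain Q2 where Q2: "pc dvd Q1 - [:-x,1:] * Q2"
    using vanishes_to_1[unfolded vanishes_to_def] by (metis power_one_right)
  have "pc dvd (Q - [:-x,1:]^l * Q1) + [:-x,1:]^l * (Q1 - [:-x,1:] * Q2)" using Q1 Q2 by (meson dvd_add dvd_mult)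
  also have "(Q - [:-x,1:]^l * Q1) + [:-x,1:]^l * (Q1 - [:-x,1:] * Q2) = Q - [:-x,1:]^Suc l * Q2"
    unfolding power_Suc2 by (simp add: algebra_simps del: mult_pCons_left mult_pCons_right)
  finally show ?case unfolding vanishes_to_def by blast
qed simp

lemma pc_dvd_pderiv: "pc dvd h \<Longrightarrow> pc dvd pderiv h"
  by (auto simp: const_poly_dvd_iff coeff_pderiv)

lemma vanishes_to_antimono: "vanishes_to x l h \<Longrightarrow> j \<le> l \<Longrightarrow> vanishes_to x j h"
proof -
  assume "vanishes_to x l h" and j: "j \<le> l"
  then obtain q where "pc dvd h - [:-x,1:]^l * q" unfolding vanishes_to_def by blast
  moreover have "[:-x,1:]^l = [:-x,1:]^j * [:-x,1:]^(l-j)" using j by (metis le_add_diff_inverse power_add)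
  ultimately have "pc dvd h - [:-x,1:]^j * ([:-x,1:]^(l-j) * q)" by (simp only: mult.assoc)
  then show ?thesis unfolding vanishes_to_def by blast
qed

text \<open>The derivative of (X - x)^(j+1) Q is (X - x)^j ((j+1) Q + (X - x) Q'). If it vanishes to
  order j + 1, then (j+1) Q(x) = 0 modulo \<open>p\<close>, and j + 1 <= l < p is invertible. This
  limits the order of vanishing in Stepanov's method to \<open>p\<close>.\<close>

lemma vanishes_to_pderiv:
  assumes "int p dvd poly h x" "vanishes_to x l (pderiv h)" "l < p"
  shows "vanishes_to x (Suc l) h"
proof -
  have "j \<le> l \<Longrightarrow> vanishes_to x (Suc j) h" for j
  proof (induction j)
    case 0
    then show ?case using vanishes_to_1[OF assms(1)] by simp
  next
    case (Suc j)
    let ?y = "[:-x,1:]"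
    have dy: "pderiv ?y = 1" by (simp add: pderiv_pCons)
    obtain Q where Q: "pc dvd h - ?y^Suc j * Q" using Suc unfolding vanishes_to_def by auto
    have "pc dvd pderiv (h - ?y^Suc j * Q)" using Q by (rule pc_dvd_pderiv)
    also have "pderiv (h - ?y^Suc j * Q) = pderiv h - ?y^j * (smult (of_nat (Suc j)) Q + ?y * pderiv Q)"
      by (simp only: pderiv_diff pderiv_mult pderiv_power_Suc dy)
         (simp add: algebra_simps del: mult_pCons_left mult_pCons_right)
    finally have 1: "pc dvd pderiv h - ?y^j * (smult (of_nat (Suc j)) Q + ?y * pderiv Q)" .
    obtain G where G: "pc dvd pderiv h - ?y^Suc j * G"
      using vanishes_to_antimono[OF assms(2) Suc.prems] unfolding vanishes_to_def by blast
    have "pc dvd (pderiv h - ?y^Suc j * G) - (pderiv h - ?y^j * (smult (of_nat (Suc j)) Q + ?y * pderiv Q))"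
      using G 1 by (rule dvd_diff)
    also have "\<dots> = ?y^j * (smult (of_nat (Suc j)) Q + ?y * pderiv Q) - ?y^j * (?y * G)" by (simp only: power_Suc2 mult.assoc)
    finally have "pc dvd smult (of_nat (Suc j)) Q + ?y * pderiv Q - ?y * G" by (simp only: pc_dvd_cancel)
    from pc_dvd_poly[OF this, of x] have "int p dvd int (Suc j) * poly Q x" by simp
    moreover have "\<not> int p dvd int (Suc j)" using Suc.prems assms(3)
      by (metis int_dvd_int_iff le_less_trans nat_dvd_not_less zero_less_Suc)
    ultimately have "int p dvd poly Q x" by (simp add: dvd_mult_p)
    then obtain Q2 where Q2: "pc dvd Q - ?y * Q2" using vanishes_to_1[unfolded vanishes_to_def] by (metis power_one_right)
    have "pc dvd (h - ?y^Suc j * Q) + ?y^Suc j * (Q - ?y * Q2)" using Q Q2 by (meson dvd_add dvd_mult)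
    also have "\<dots> = h - ?y^Suc (Suc j) * Q2"
      unfolding power_Suc2[of _ "Suc j"] by (simp add: algebra_simps del: mult_pCons_left mult_pCons_right power_Suc)
    finally show ?case unfolding vanishes_to_def by blast
  qed
  then show ?thesis by simp
qed

text \<open>As \<open>B\<close> is monic, the leading coefficient of \<open>B * red Q\<close> is
  that of \<open>red Q\<close>, hence prime to \<open>p\<close>; it survives in \<open>h\<close>,
  whatever multiples of \<open>p\<close> separate the two.\<close>

lemma degree_ge_of_factor:
  assumes "pc dvd h - B * Q" "lead_coeff B = 1" "\<not> pc dvd h"
  shows "degree B \<le> degree h"
proof -
  have nQ: "\<not> pc dvd Q" using assms by (metis diff_add_cancel dvd_add_right_iff dvd_mult)
  have "pc dvd (h - B * Q) + B * (Q - red Q)" using assms(1) pc_dvd_red by (meson dvd_add dvd_mult)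
  then have *: "pc dvd h - B * red Q" by (simp add: algebra_simps)
  let ?i = "degree B + degree (red Q)"
  have "coeff (B * red Q) ?i = lead_coeff (red Q)" by (simp add: coeff_mult_degree_sum assms(2))
  then have "\<not> int p dvd coeff (B * red Q) ?i" using lead_coeff_red[OF nQ] by simp
  moreover have "int p dvd coeff h ?i - coeff (B * red Q) ?i" using * by (auto simp: const_poly_dvd_iff)
  ultimately have "coeff h ?i \<noteq> 0" by auto
  then show ?thesis using le_degree by fastforce
qed

text \<open>The powers (X - x)^l are split off one after another; the product of those already found
  is nonzero modulo \<open>p\<close> at the next point, so \<open>vanishes_to_cancel\<close> passes
  the zero on to the cofactor.\<close>

lemma root_count:
  assumes "finite S" "S \<subseteq> {0..<int p}" "\<And>x. x \<in> S \<Longrightarrow> vanishes_to x l h" "\<not> pc dvd h"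
  shows "l * card S \<le> degree h"
proof -
  let ?B = "\<lambda>S. \<Prod>x\<in>S. [:-x,1:]^l"
  have mon: "lead_coeff (?B S) = 1" for S :: "int set"
    by (induction S rule: infinite_finite_induct) (auto simp: lead_coeff_mult lead_coeff_power)
  have deg: "degree (?B S) = l * card S" if "finite S" for S :: "int set" using that
  proof (induction S rule: finite_induct)
    case (insert x F)
    have "?B F \<noteq> 0" using mon[of F] by auto
    then show ?case using insert by (simp add: degree_mult_eq degree_linear_power)
  qed auto
  have "\<exists>Q. pc dvd h - ?B S * Q" using assms(1,2,3)
  proof (induction S rule: finite_induct)
    case empty
    then show ?case by (intro exI[of _ h]) simp
  next
    case (insert x F)
    have "\<exists>Q. pc dvd h - ?B F * Q" using insert.prems by (intro insert.IH) blast+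
    then obtain Q where Q: "pc dvd h - ?B F * Q" ..
    have "vanishes_to x l (?B F * Q)"  by (rule vanishes_to_cong[OF insert.prems(2)[OF insertI1] Q])
    moreover have "\<not> int p dvd poly (?B F) x"
    proof
      assume "int p dvd poly (?B F) x"
      then have "int p dvd (\<Prod>y\<in>F. (x - y)^l)" by (simp add: poly_prod poly_power)
      then obtain y where y: "y \<in> F" "int p dvd (x-y)^l"
        using prime_dvd_prod_iff[OF insert.hyps(1), of "int p" "\<lambda>y. (x - y)^l"] prime_p by auto
      then have "int p dvd x - y" using prime_dvd_power[of "int p" "x-y" l] prime_p by simp
      then have "x mod int p = y mod int p" by (simp add: mod_eq_dvd_iff)
      moreover have "x \<in> {0..<int p}" "y \<in> {0..<int p}" using insert.prems y by auto
      ultimately have "x = y" by simp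
      then show False using y insert.hyps by simp
    qed
    ultimately have "vanishes_to x l Q" by (rule vanishes_to_cancel[rotated])
    then obtain G where "pc dvd Q - [:-x,1:]^l * G" unfolding vanishes_to_def by blast
    then have "pc dvd (h - ?B F * Q) + ?B F * (Q - [:-x,1:]^l * G)" using Q by (meson dvd_add dvd_mult)
    also have "\<dots> = h - ([:-x,1:]^l * ?B F) * G"
      by (simp only: right_diff_distrib mult.assoc mult.left_commute[of "[:-x,1:]^l"])
    also have "[:-x,1:]^l * ?B F = ?B (insert x F)" using insert.hyps by (simp only: prod.insert not_False_eq_True)
    finally show ?case by blast
  qed
  then obtain Q where "pc dvd h - ?B S * Q" ..
  then have "degree (?B S) \<le> degree h" using mon assms(4) by (rule degree_ge_of_factor)
  then show ?thesis using deg[OF assms(1)] by simp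
qed

lemma fermat_int:
  assumes "2 < p"
  shows "[x ^ p = x] (mod int p)"
proof (cases "int p dvd x")
  case True
  then have "int p dvd x ^ p" using prime_gt_0_nat[OF prime_p] by (meson dvd_power dvd_trans)
  then show ?thesis using True by (simp add: cong_def dvd_eq_mod_eq_0)
next
  case False
  obtain h where h: "p = 2 * h + 1" using prime_odd_nat[OF prime_p assms] by (rule oddE)
  have "[Legendre x (int p) = x ^ h] (mod int p)" using euler_criterion[OF prime_p assms] h by simp
  then have "[Legendre x (int p) ^ 2 = (x ^ h) ^ 2] (mod int p)" by (rule cong_pow)
  moreover have "Legendre x (int p) ^ 2 = 1" using False by (auto simp: Legendre_def cong_def dvd_eq_mod_eq_0)
  ultimately have "[1 * x = x ^ (h * 2) * x] (mod int p)" by (intro cong_mult) (simp_all flip: power_mult)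
  moreover have "x ^ (h * 2) * x = x ^ p" unfolding h by (simp add: mult.commute)
  ultimately show ?thesis by (simp add: cong_sym)
qed

end

section \<open>Auxiliary polynomials and vanishing order\<close>

locale stepanov = prime_modulus +
  fixes F :: "int poly"
  assumes degree_F: "degree F = 3" and monic_F: "lead_coeff F = 1"
    and F_at_0: "\<not> int p dvd coeff F 0" and p_gt_2: "2 < p"
begin

definition h :: nat where "h = (p - 1) div 2"
text \<open>
  \<open>D m\<close> is the derivation $F \cdot d/dX$ carried over to the factor \<open>u\<close> of $u F^m$. Modulo \<open>p\<close>
  it does not see the powers $X^{jp}$, so it acts on \<open>Phi\<close> coefficientwise.
\<close>
definition D :: "nat \<Rightarrow> int poly \<Rightarrow> int poly" where
  "D m u = F * pderiv u + smult (int m) (pderiv F * u)"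
definition Phi :: "nat \<Rightarrow> (nat \<Rightarrow> int poly) \<Rightarrow> (nat \<Rightarrow> int poly) \<Rightarrow> int poly" where
  "Phi n R S = (\<Sum>j<n. (R j + S j * F ^ h) * monom 1 (j * p))"

lemma pderiv_sum: "pderiv (sum f A) = (\<Sum>x\<in>A. pderiv (f x))" using higher_pderiv_sum[of 1] by simp

lemma odd_p: "odd p" using prime_p p_gt_2 prime_odd_nat by blast

lemma h_double: "2 * h + 1 = p" using odd_p p_gt_2 by (auto simp: h_def elim!: oddE)

lemma h_pos: "0 < h" using h_double p_gt_2 by simp

lemma F_pderiv_power: "F * pderiv (F ^ h) = smult (int h) (pderiv F) * F ^ h"
proof -
  have "F * F ^ (h - 1) = F ^ h" using h_pos by (simp add: power_eq_if)
  moreover have "F * pderiv (F ^ h) = smult (int h) (pderiv F) * (F * F ^ (h - 1))"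
    by (simp add: pderiv_power mult.left_commute mult.commute)
  ultimately show ?thesis by simp
qed

text \<open>The derivative of X^(jp) carries the factor jp, and F (F^h)' = h F' F^h supplies the
  second term of \<open>D h\<close>. So polynomials of the form \<open>Phi\<close> are stable under
  F d/dX modulo \<open>p\<close>.\<close>

lemma Phi_step: "pc dvd F * pderiv (Phi n R S) - Phi n (D 0 \<circ> R) (D h \<circ> S)"
proof -
  have "F * pderiv (Phi n R S) - Phi n (D 0 \<circ> R) (D h \<circ> S) =
     (\<Sum>j<n. F * (R j + S j * F ^ h) * pderiv (monom 1 (j * p)))"
    unfolding Phi_def pderiv_sum sum_distrib_left sum_subtractf[symmetric]
  proof (rule sum.cong[OF refl])
    fix j
    let ?m = "monom 1 (j * p) :: int poly"
    have "F * pderiv ((R j + S j * F ^ h) * ?m)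
        = F * (R j + S j * F^h) * pderiv ?m + (F * pderiv (R j)) * ?m + F * pderiv (S j) * F^h * ?m
            + S j * (F * pderiv (F^h)) * ?m" by (simp only: pderiv_mult pderiv_add) (simp only: algebra_simps)
    also have "S j * (F * pderiv (F^h)) * ?m = smult (int h) (pderiv F * S j) * F^h * ?m"
      unfolding F_pderiv_power by (simp add: mult_ac)
    finally show "F * pderiv ((R j + S j * F ^ h) * ?m) - ((D 0 \<circ> R) j + (D h \<circ> S) j * F ^ h) * ?m
      = F * (R j + S j * F ^ h) * pderiv ?m" by (simp only: D_def o_def) (simp add: algebra_simps)
  qed
  moreover have "pc dvd \<dots>" by (intro dvd_sum dvd_mult) (auto simp: const_poly_dvd_iff pderiv_monom)
  ultimately show ?thesis by simp
qed

text \<open>At such an \<open>x\<close>, Fermat turns X^(jp) into x^j and F^h into \<open>a\<close>,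
  so the value of \<open>Phi\<close> is that of the low degree polynomial in the last hypothesis for
  k = 0. \<open>Phi_step\<close> carries this over to the next derivative, and F(x) being invertible
  permits dividing by \<open>F\<close>.\<close>

lemma Phi_vanishes:
  assumes "\<not> int p dvd poly F x" "[poly F x ^ h = a] (mod int p)" "l \<le> p"
    and "\<And>k. k < l \<Longrightarrow> pc dvd (\<Sum>j<n. ((D 0 ^^ k) (R j) + smult a ((D h ^^ k) (S j))) * monom 1 j)"
  shows "vanishes_to x l (Phi n R S)" using assms(3,4)
proof (induction l arbitrary: R S)
  case (Suc l)
  have "int p dvd poly (\<Sum>j<n. (R j + smult a (S j)) * monom 1 j) x" using Suc.prems(2)[of 0] by (intro pc_dvd_poly) simp
  then have "[(\<Sum>j<n. (poly (R j) x + a * poly (S j) x) * x ^ j) = 0] (mod int p)"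
    by (simp add: poly_sum poly_monom cong_0_iff)
  moreover have "[poly (Phi n R S) x = (\<Sum>j<n. (poly (R j) x + a * poly (S j) x) * x ^ j)] (mod int p)"
  proof -
    have "[(\<Sum>j<n. (poly (R j) x + poly (S j) x * poly F x ^ h) * (x ^ p) ^ j) =
       (\<Sum>j<n. (poly (R j) x + poly (S j) x * a) * x ^ j)] (mod int p)"
      by (intro cong_sum cong_mult cong_add cong_refl cong_pow fermat_int[OF p_gt_2] assms(2))
    then show ?thesis by (simp add: Phi_def poly_sum poly_monom mult_ac flip: power_mult)
  qed
  ultimately have 1: "int p dvd poly (Phi n R S) x" by (metis cong_0_iff cong_trans)
  have "vanishes_to x l (Phi n (D 0 \<circ> R) (D h \<circ> S))"
  proof (rule Suc.IH)
    show "l \<le> p" using Suc.prems by simp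
    fix k assume "k < l"
    then show "pc dvd (\<Sum>j<n. ((D 0 ^^ k) ((D 0 \<circ> R) j) + smult a ((D h ^^ k) ((D h \<circ> S) j))) * monom 1 j)"
      using Suc.prems(2)[of "Suc k"] by (simp add: funpow_Suc_right del: funpow.simps)
  qed
  then have "vanishes_to x l (F * pderiv (Phi n R S))"
    by (rule vanishes_to_cong) (metis Phi_step dvd_minus_iff minus_diff_eq)
  then have "vanishes_to x l (pderiv (Phi n R S))" using assms(1) vanishes_to_cancel by blast
  then show ?case using 1 Suc.prems(1) by (intro vanishes_to_pderiv) auto
qed simp

text \<open>Write F = F(0) + X G: the middle binomial coefficients are divisible by
  \<open>p\<close>, and Fermat fixes F(0). So F^p is a constant modulo \<open>p\<close> and X^p,
  which is what eliminates F^h in \<open>two_term_nonvanishing\<close>.\<close>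

lemma F_power_p: "\<exists>W. pc dvd F ^ p - [:coeff F 0:] - monom 1 p * W"
proof -
  obtain G where G: "F = pCons (coeff F 0) G" by (metis coeff_pCons_0 pCons_cases)
  let ?c = "[:coeff F 0:]" and ?X = "monom 1 1 :: int poly"
  have F: "F = ?c + ?X * G" by (subst G) (simp add: monom_altdef)
  have "(?c + ?X * G) ^ p = (\<Sum>k\<le>p. of_nat (p choose k) * ?c ^ k * (?X * G) ^ (p - k))" by (rule binomial_ring)
  also have "{..p} = insert 0 (insert p {0<..<p})" by auto
  also have "(\<Sum>k\<in>insert 0 (insert p {0<..<p}). of_nat (p choose k) * ?c ^ k * (?X * G) ^ (p - k))
     = (?X * G) ^ p + ?c ^ p + (\<Sum>k\<in>{0<..<p}. of_nat (p choose k) * ?c ^ k * (?X * G) ^ (p - k))"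
    using p_gt_2 by (subst sum.insert; simp)+
  finally have *: "F ^ p - [:coeff F 0:] - monom 1 p * G ^ p =
     (?c ^ p - ?c) + (\<Sum>k\<in>{0<..<p}. of_nat (p choose k) * ?c ^ k * (?X * G) ^ (p - k))"
    unfolding F[symmetric] by (simp add: power_mult_distrib monom_power)
  have 1: "pc dvd ?c ^ p - ?c" using fermat_int[OF p_gt_2, of "coeff F 0"] by (simp add: poly_const_pow cong_iff_dvd_diff)
  have 2: "pc dvd (\<Sum>k\<in>{0<..<p}. of_nat (p choose k) * ?c ^ k * (?X * G) ^ (p - k))"
  proof (rule dvd_sum)
    fix k assume k: "k \<in> {0<..<p}"
    have "p dvd (p choose k)" using k prime_p by (intro dvd_choose_prime) auto
    then have "pc dvd of_nat (p choose k)" by (simp add: of_nat_poly)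
    then show "pc dvd of_nat (p choose k) * ?c ^ k * (?X * G) ^ (p - k)" by (metis dvd_mult2)
  qed
  show ?thesis by (rule exI[of _ "G ^ p"], subst *) (rule dvd_add[OF 1 2])
qed

text \<open>The degrees of the two sides have different parity because \<open>F\<close> is cubic.\<close>
lemma square_relation:
  assumes "pc dvd F * r^2 - [:coeff F 0:] * s^2"
  shows "pc dvd r \<and> pc dvd s"
proof -
  let ?c = "coeff F 0"
  let ?r = "red r" and ?s = "red s"
  have "pc dvd (F * r^2 - [:?c:] * s^2) - F * (r + ?r) * (r - ?r) + [:?c:] * (s + ?s) * (s - ?s)"
    using assms pc_dvd_red by (meson dvd_add dvd_diff dvd_mult)
  also have "(F * r^2 - [:?c:] * s^2) - F * (r + ?r) * (r - ?r) + [:?c:] * (s + ?s) * (s - ?s) = F * ?r^2 - [:?c:] * ?s^2"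
    by (simp only: power2_eq_square algebra_simps)
  finally have *: "pc dvd F * ?r^2 - [:?c:] * ?s^2" .
  then have co: "int p dvd coeff (F * ?r^2) i - ?c * coeff (?s^2) i" for i by (auto simp: const_poly_dvd_iff)
  have dr: "degree (F * ?r^2) = 3 + 2 * degree ?r" "lead_coeff (F * ?r^2) = (lead_coeff ?r)^2" if "?r \<noteq> 0"
  proof -
    have "F \<noteq> 0" using monic_F by auto
    then show "degree (F * ?r^2) = 3 + 2 * degree ?r" using that degree_F by (simp add: degree_mult_eq degree_power_eq)
    show "lead_coeff (F * ?r^2) = (lead_coeff ?r)^2" by (simp only: lead_coeff_mult lead_coeff_power monic_F mult_1)
  qed
  have ds: "degree (?s^2) = 2 * degree ?s" "lead_coeff (?s^2) = (lead_coeff ?s)^2"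
    by (cases "?s = 0"; simp add: degree_power_eq) (simp only: lead_coeff_power)
  have nr: "\<not> int p dvd (lead_coeff ?r)^2" if "\<not> pc dvd r"
    using lead_coeff_red[OF that] prime_p by (simp add: power2_eq_square dvd_mult_p)
  have ns: "\<not> int p dvd ?c * (lead_coeff ?s)^2" if "\<not> pc dvd s"
    using lead_coeff_red[OF that] prime_p F_at_0 by (simp add: power2_eq_square dvd_mult_p)
  show ?thesis
  proof (rule ccontr)
    assume "\<not> (pc dvd r \<and> pc dvd s)"
    then consider "\<not> pc dvd r" "?s = 0 \<or> degree (?s^2) < degree (F * ?r^2)"
      | "\<not> pc dvd s" "?r = 0 \<or> degree (F * ?r^2) < degree (?s^2)" using dr(1) ds(1) red_eq_0_iff[of r] red_eq_0_iff[of s]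
      by (metis One_nat_def add_2_eq_Suc' dvd_triv_left even_Suc linorder_neqE_nat numeral_3_eq_3 plus_1_eq_Suc even_add)
    then show False
    proof cases
      case 1
      then have "?r \<noteq> 0" by (simp add: red_eq_0_iff)
      have "coeff (?s^2) (degree (F * ?r^2)) = 0" using 1(2) by (auto simp: coeff_eq_0)
      then show ?thesis using co[of "degree (F * ?r^2)"] dr(2)[OF \<open>?r \<noteq> 0\<close>] nr[OF 1(1)] by simp
    next
      case 2
      have "coeff (F * ?r^2) (degree (?s^2)) = 0" using 2(2) by (auto simp: coeff_eq_0)
      then show ?thesis using co[of "degree (?s^2)"] ds(2) ns[OF 2(1)] by simp
    qed
  qed
qed

end

text \<open>Pigeonhole in place of linear algebra: there are p^|I| coefficient vectors with entries
  in [0,p) but only p^|K| vectors of residues, so two vectors collide and their difference is a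
  nonzero solution.\<close>

lemma (in prime_modulus) linear_system_solution:
  fixes L :: "('i \<Rightarrow> int) \<Rightarrow> 'k \<Rightarrow> int"
  assumes "finite I" "finite K" "card K < card I"
    and lin: "\<And>c c' k. k \<in> K \<Longrightarrow> L (\<lambda>i. c i - c' i) k = L c k - L c' k"
  shows "\<exists>c. (\<exists>i\<in>I. \<not> int p dvd c i) \<and> (\<forall>k\<in>K. int p dvd L c k)"
proof -
  let ?A = "I \<rightarrow>\<^sub>E {0..<int p}" and ?B = "K \<rightarrow>\<^sub>E {0..<int p}"
  let ?f = "\<lambda>c. \<lambda>k\<in>K. L c k mod int p"
  have p1: "1 < p" using prime_p by (rule prime_gt_1_nat)
  have "card ?B = p ^ card K" "card ?A = p ^ card I" using assms(1,2) by (simp_all add: card_PiE)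
  then have "card ?B < card ?A" using assms(3) p1 by simp
  moreover have "?f ` ?A \<subseteq> ?B" using p1 by auto
  moreover have "finite ?B" using assms(2) by (intro finite_PiE) auto
  ultimately have "\<not> inj_on ?f ?A" by (meson card_inj_on_le leD)
  then obtain c c' where c: "c \<in> ?A" "c' \<in> ?A" "c \<noteq> c'" "?f c = ?f c'" by (auto simp: inj_on_def)
  show ?thesis
  proof (intro exI[of _ "\<lambda>i. c i - c' i"] conjI ballI)
    obtain i where i: "i \<in> I" "c i \<noteq> c' i" using c by (meson PiE_ext)
    then have "c i mod int p \<noteq> c' i mod int p" using c(1,2) by (auto simp: PiE_iff)
    then show "\<exists>i\<in>I. \<not> int p dvd c i - c' i" using i by (auto simp: mod_eq_dvd_iff)
    fix k assume k: "k \<in> K"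
    then have "L c k mod int p = L c' k mod int p" using c(4) by (metis restrict_apply')
    then show "int p dvd L (\<lambda>i. c i - c' i) k" using lin[OF k] by (simp add: mod_eq_dvd_iff)
  qed
qed

context stepanov begin

text \<open>Multiplying r + s F^h = 0 (mod X^p) by F (r - s F^h) removes the large power, since F
  F^(2h) = F^p is the constant F(0) modulo X^p. What remains, F r^2 - F(0) s^2, has degree below
  \<open>p\<close>, so it is 0 modulo \<open>p\<close> outright.\<close>

lemma two_term_nonvanishing:
  assumes "2 * degree r + 3 < p" "2 * degree s < p"
    and "pc dvd r + s * F ^ h - monom 1 p * W"
  shows "pc dvd r \<and> pc dvd s"
proof -
  obtain V where V: "pc dvd F ^ p - [:coeff F 0:] - monom 1 p * V" using F_power_p by blast
  let ?Z = "F * (r - s * F ^ h) * W + s^2 * V"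
  have Fp: "F ^ p = F * F ^ h * F ^ h" using h_double by (metis Suc_eq_plus1 mult.assoc mult_2 power_Suc power_add)
  have "pc dvd F * (r - s * F ^ h) * (r + s * F ^ h - monom 1 p * W) +
      s^2 * (F ^ p - [:coeff F 0:] - monom 1 p * V)" using assms(3) V by (meson dvd_add dvd_mult)
  also have "F * (r - s * F ^ h) * (r + s * F ^ h - monom 1 p * W) +
      s^2 * (F ^ p - [:coeff F 0:] - monom 1 p * V) = (F * r^2 - [:coeff F 0:] * s^2) - monom 1 p * ?Z"
    unfolding Fp by (simp only: power2_eq_square algebra_simps)
  finally have *: "pc dvd (F * r^2 - [:coeff F 0:] * s^2) - monom 1 p * ?Z" .
  have "degree (F * r^2) < p"
  proof -
    have "degree (F * r^2) \<le> degree F + degree (r^2)" by (rule degree_mult_le)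
    also have "degree (r^2) \<le> 2 * degree r" by (metis degree_power_le mult.commute)
    finally show ?thesis using assms(1) degree_F by simp
  qed
  moreover have "degree ([:coeff F 0:] * s^2) < p"
  proof -
    have "degree ([:coeff F 0:] * s^2) \<le> degree (s^2)" by (simp add: degree_smult_le)
    also have "degree (s^2) \<le> 2 * degree s" by (metis degree_power_le mult.commute)
    finally show ?thesis using assms(2) by simp
  qed
  ultimately have deg: "degree (F * r^2 - [:coeff F 0:] * s^2) < p" by (meson degree_diff_less)
  have "pc dvd F * r^2 - [:coeff F 0:] * s^2" unfolding const_poly_dvd_iff
  proof
    fix i
    show "int p dvd coeff (F * r^2 - [:coeff F 0:] * s^2) i"
    proof (cases "i < p")
      case True
      have "int p dvd coeff ((F * r^2 - [:coeff F 0:] * s^2) - monom 1 p * ?Z) i"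
        using * unfolding const_poly_dvd_iff by blast
      moreover have "coeff (monom 1 p * ?Z) i = 0" using True by (subst coeff_monom_mult) simp
      ultimately show ?thesis by (metis coeff_diff diff_zero)
    next
      case False
      then show ?thesis using deg by (simp only: coeff_eq_0) simp
    qed
  qed
  then show ?thesis by (rule square_relation)
qed

text \<open>Modulo X^p only the block j = 0 is visible; once it is known to vanish, X^p can be
  cancelled and the next block becomes the lowest.\<close>

lemma Phi_nonvanishing:
  assumes "pc dvd Phi n R S" "\<And>j. j < n \<Longrightarrow> 2 * degree (R j) + 3 < p"
    "\<And>j. j < n \<Longrightarrow> 2 * degree (S j) < p" "j < n"
  shows "pc dvd R j \<and> pc dvd S j" using assms
proof (induction n arbitrary: R S j)
  case (Suc n)
  let ?X = "monom 1 p :: int poly"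
  have "Phi (Suc n) R S = R 0 + S 0 * F ^ h + ?X * Phi n (R \<circ> Suc) (S \<circ> Suc)"
    unfolding Phi_def sum.lessThan_Suc_shift sum_distrib_left by (simp add: mult.left_commute[of "monom 1 p"] mult_monom)
  then have *: "pc dvd R 0 + S 0 * F ^ h + ?X * Phi n (R \<circ> Suc) (S \<circ> Suc)" using Suc.prems(1) by simp
  then have "pc dvd R 0 + S 0 * F ^ h - ?X * (- Phi n (R \<circ> Suc) (S \<circ> Suc))" by simp
  from two_term_nonvanishing[OF _ _ this] have 0: "pc dvd R 0 \<and> pc dvd S 0" using Suc.prems(2,3) by simp
  then have "pc dvd R 0 + S 0 * F ^ h" by (meson dvd_add dvd_mult2)
  then have "pc dvd ?X * Phi n (R \<circ> Suc) (S \<circ> Suc)" using * by (simp only: dvd_add_right_iff)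
  moreover have "\<not> pc dvd ?X" using prime_gt_1_nat[OF prime_p] by (auto simp: const_poly_dvd_iff intro!: exI[of _ p])
  ultimately have 1: "pc dvd Phi n (R \<circ> Suc) (S \<circ> Suc)" using pc_dvd_mult_iff by blast
  then have "pc dvd (R \<circ> Suc) i \<and> pc dvd (S \<circ> Suc) i" if "i < n" for i using Suc.IH[OF 1 _ _ that] Suc.prems(2,3) by simp
  then show ?case using 0 Suc.prems(4) by (cases j) auto
qed simp

lemma D_power_diff: "(D m ^^ k) (u - v) = (D m ^^ k) u - (D m ^^ k) v"
  by (induction k) (simp_all add: D_def pderiv_diff right_diff_distrib smult_diff_right)

lemma degree_D: "degree (D m u) \<le> degree u + 2"
proof -
  have "degree (pderiv F * u) \<le> degree (pderiv F) + degree u" by (rule degree_mult_le)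
  then have "degree (smult (int m) (pderiv F * u)) \<le> degree u + 2" using degree_F by (simp add: degree_pderiv)
  moreover have "degree (F * pderiv u) \<le> degree u + 2"
  proof (cases "degree u = 0")
    case False
    then show ?thesis using degree_mult_le[of F "pderiv u"] degree_F by (simp add: degree_pderiv)
  next
    case True
    then have "pderiv u = 0" by (simp add: pderiv_eq_0_iff)
    then show ?thesis by simp
  qed
  ultimately show ?thesis unfolding D_def by (rule degree_add_le[rotated])
qed

lemma degree_D_power: "degree ((D m ^^ k) u) \<le> degree u + 2 * k"
  by (induction k) (auto intro: order.trans[OF degree_D])

text \<open>
  The coefficients of \<open>Phi\<close> are chosen so that \<open>Phi\<close> vanishes to order \<open>l\<close> wherever $F^h = a$;
  the factor $F^l$ makes the zeros of \<open>F\<close> count as well.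
\<close>
lemma card_power_values:
  assumes "l \<le> p" "1 \<le> b" "2 * b + 1 < p" "l * (b + 2 * l + n) < 2 * n * b"
  shows "l * card {x\<in>{0..<int p}. int p dvd poly F x \<or> [poly F x ^ h = a] (mod int p)} \<le> 3 * l + (n + 1) * p"
proof -
  define U where "U = (\<lambda>c (t::bool) (j::nat). \<Sum>i<b. monom (c (j, i, t) :: int) i)"
  have coeff_U: "coeff (U c t j) i = (if i < b then c (j, i, t) else 0)" for c t j i by (simp add: U_def coeff_sum)
  have deg_U: "degree (U c t j) \<le> b - 1" for c t j using assms(2) by (intro degree_le) (auto simp: coeff_U)
  have U_diff: "U (\<lambda>i. c i - c' i) t j = U c t j - U c' t j" for c c' t j by (auto simp: poly_eq_iff coeff_U)
  define T where "T = (\<lambda>c k. \<Sum>j::nat<n. ((D 0 ^^ k) (U c True j) + smult a ((D h ^^ k) (U c False j))) * monom 1 j)"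
  have T_diff: "T (\<lambda>i. c i - c' i) k = T c k - T c' k" for c c' k
    unfolding T_def U_diff D_power_diff sum_subtractf[symmetric] smult_diff_right
    by (intro sum.cong) (simp_all only: algebra_simps)
  have deg_T: "degree (T c k) \<le> (b - 1) + 2 * k + (n - 1)" for c k unfolding T_def
  proof (intro degree_sum_le)
    fix j assume "j \<in> {..<n}"
    have "degree ((D 0 ^^ k) (U c True j)) \<le> b - 1 + 2 * k" "degree ((D h ^^ k) (U c False j)) \<le> b - 1 + 2 * k"
      using degree_D_power[of k 0 "U c True j"] degree_D_power[of k h "U c False j"] deg_U[of c True j] deg_U[of c False j]
      by linarith+
    then have "degree ((D 0 ^^ k) (U c True j) + smult a ((D h ^^ k) (U c False j))) \<le> b - 1 + 2 * k"
      by (meson degree_add_le degree_smult_le le_trans)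
    moreover have "degree (monom 1 j :: int poly) \<le> n - 1" using \<open>j \<in> {..<n}\<close> by (simp add: degree_monom_eq)
    ultimately show "degree (((D 0 ^^ k) (U c True j) + smult a ((D h ^^ k) (U c False j))) * monom 1 j)
        \<le> (b - 1) + 2 * k + (n - 1)" by (meson add_mono degree_mult_le le_trans)
  qed simp
  \<comment> \<open>The unknowns are the \<open>2 * n * b\<close> coefficients of the R_j and S_j,
    the Boolean selecting which. Each of the \<open>l\<close> polynomials \<open>T c k\<close> has
    at most \<open>b + 2 * l + n\<close> coefficients that must be killed, so the last hypothesis
    says that unknowns outnumber equations.\<close>
  let ?I = "{..<n} \<times> {..<b} \<times> (UNIV :: bool set)" and ?K = "{..<l} \<times> {..<b + 2 * l + n}"
  have "card ?K < card ?I" using assms(4) by (simp add: card_cartesian_product mult_ac)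
  then have "\<exists>c. (\<exists>i\<in>?I. \<not> int p dvd c i) \<and> (\<forall>k\<in>?K. int p dvd coeff (T c (fst k)) (snd k))"
    by (intro linear_system_solution[where L = "\<lambda>c k. coeff (T c (fst k)) (snd k)"])
      (auto simp only: T_diff coeff_diff finite finite_cartesian_product finite_lessThan)
  then obtain c where c: "\<exists>i\<in>?I. \<not> int p dvd c i" "\<And>k. k \<in> ?K \<Longrightarrow> int p dvd coeff (T c (fst k)) (snd k)" by blast
  have T: "pc dvd T c k" if "k < l" for k unfolding const_poly_dvd_iff
  proof
    fix i
    show "int p dvd coeff (T c k) i"
    proof (cases "i < b + 2 * l + n")
      case True
      then show ?thesis using c(2)[of "(k, i)"] that by simp
    next
      case False
      then have "degree (T c k) < i" using deg_T[of c k] that assms(2) by linarith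
      then show ?thesis by (simp add: coeff_eq_0)
    qed
  qed
  let ?Phi = "Phi n (U c True) (U c False)"
  let ?S = "{x\<in>{0..<int p}. int p dvd poly F x \<or> [poly F x ^ h = a] (mod int p)}"
  have "\<not> pc dvd ?Phi"
  proof
    assume "pc dvd ?Phi"
    moreover have "2 * degree (U c t j) + 3 < p" for t j using deg_U[of c t j] assms(2,3) by linarith
    ultimately have "pc dvd U c True j \<and> pc dvd U c False j" if "j < n" for j
      using that add_lessD1 by (intro Phi_nonvanishing) blast+
    then have "int p dvd c (j, i, t)" if "j < n" "i < b" for j i t
      using that coeff_U unfolding const_poly_dvd_iff by (metis (full_types))
    then show False using c(1) by auto
  qed
  moreover have "\<not> pc dvd F ^ l"
  proof
    assume "pc dvd F ^ l"
    then have "pc dvd F" using prime_elem_pc prime_elem_dvd_power by blast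
    then show False using F_at_0 by (auto simp: const_poly_dvd_iff)
  qed
  ultimately have nz: "\<not> pc dvd F ^ l * ?Phi" by (simp only: pc_dvd_mult_iff) simp
  have "vanishes_to x l (F ^ l * ?Phi)" if "x \<in> ?S" for x
  proof (cases "int p dvd poly F x")
    case True
    then obtain q where "pc dvd F - [:-x,1:] * q" using vanishes_to_1[unfolded vanishes_to_def] by (metis power_one_right)
    moreover have "F - [:-x,1:] * q dvd F ^ l - ([:-x,1:] * q) ^ l" by (metis dvd_def power_diff_sumr2)
    ultimately have "pc dvd F ^ l - ([:-x,1:] * q) ^ l" by (rule dvd_trans)
    then have "pc dvd F ^ l - [:-x,1:] ^ l * q ^ l" by (simp only: power_mult_distrib)
    then have "vanishes_to x l (F ^ l)" unfolding vanishes_to_def by blast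
    then show ?thesis using vanishes_to_mult[of x l "F ^ l" ?Phi] by (simp only: mult.commute)
  next
    case False
    then show ?thesis using that assms(1) T unfolding T_def by (intro vanishes_to_mult Phi_vanishes[of x a]) auto
  qed
  moreover have "finite ?S" by (rule finite_subset[of _ "{0..<int p}"]) auto
  ultimately have "l * card ?S \<le> degree (F ^ l * ?Phi)" using nz by (intro root_count) auto
  also have "\<dots> \<le> degree (F ^ l) + degree ?Phi" by (rule degree_mult_le)
  also have "degree (F ^ l) \<le> 3 * l" using degree_power_le[of F l] degree_F by simp
  also have "degree ?Phi \<le> (b - 1 + 3 * h) + (n - 1) * p" unfolding Phi_def
  proof (intro degree_sum_le)
    fix j assume j: "j \<in> {..<n}"
    have "degree (U c False j * F ^ h) \<le> degree (U c False j) + degree (F ^ h)" by (rule degree_mult_le)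
    also have "\<dots> \<le> (b - 1) + 3 * h" using deg_U degree_power_le[of F h] degree_F by (intro add_mono) simp_all
    finally have "degree (U c True j + U c False j * F ^ h) \<le> b - 1 + 3 * h"
      using deg_U[of c True j] by (intro degree_add_le) auto
    moreover have "degree (monom 1 (j * p) :: int poly) \<le> (n - 1) * p" using j by (cases n) (simp_all add: degree_monom_eq)
    ultimately show "degree ((U c True j + U c False j * F ^ h) * monom 1 (j * p)) \<le> (b - 1 + 3 * h) + (n - 1) * p"
      by (meson add_mono degree_mult_le le_trans)
  qed simp
  also have "b - 1 + 3 * h \<le> 2 * p" using assms(3) h_double by linarith
  also have "2 * p + (n - 1) * p = (n + 1) * p" using assms(4) by (cases n) auto
  finally show ?thesis by simp
qed

end

section \<open>The Hasse bound for monic cubics\<close>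

context prime_modulus begin

text \<open>Residue classes are represented by integers, so a function on Z/p is a function on the
  integers with this invariance. Substitutions can then be written without reducing the
  argument.\<close>

definition per :: "(int \<Rightarrow> 'a) \<Rightarrow> bool" where
  "per f \<longleftrightarrow> (\<forall>x y. [x = y] (mod int p) \<longrightarrow> f x = f y)"

definition cong_map :: "(int \<Rightarrow> int) \<Rightarrow> bool" where
  "cong_map f \<longleftrightarrow> (\<forall>x y. [x = y] (mod int p) \<longrightarrow> [f x = f y] (mod int p))"

abbreviation lam :: "int \<Rightarrow> int" where "lam x \<equiv> Legendre x (int p)"

abbreviation Zp :: "int set" where "Zp \<equiv> {0..<int p}"

lemma per_lam: "per lam" unfolding per_def
proof (intro allI impI)
  fix x y assume "[x = y] (mod int p)"
  then have "x mod int p = y mod int p" by (simp add: cong_def)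
  then show "lam x = lam y" unfolding Legendre_def QuadRes_def cong_def by simp
qed

lemma cong_map_intros:
  "cong_map (\<lambda>x. c)" "cong_map (\<lambda>x. x)"
  "cong_map f \<Longrightarrow> cong_map g \<Longrightarrow> cong_map (\<lambda>x. f x + g x)"
  "cong_map f \<Longrightarrow> cong_map g \<Longrightarrow> cong_map (\<lambda>x. f x - g x)"
  "cong_map f \<Longrightarrow> cong_map g \<Longrightarrow> cong_map (\<lambda>x. f x * g x)"
  "cong_map f \<Longrightarrow> cong_map (\<lambda>x. - f x)"
  "cong_map f \<Longrightarrow> cong_map (\<lambda>x. f x ^ n)" unfolding cong_map_def
  by (auto intro: cong_add cong_diff cong_mult cong_pow simp: cong_minus_minus_iff)

lemma cong_map_poly: "cong_map (poly F)"
proof (induction F)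
  case (pCons a F)
  then show ?case by (simp add: cong_map_intros)
qed (simp add: cong_map_intros)

lemma per_comp: "per f \<Longrightarrow> cong_map g \<Longrightarrow> per (\<lambda>x. f (g x))" unfolding cong_map_def per_def by blast

lemma per_intros:
  "per (\<lambda>x. c)"
  "cong_map h \<Longrightarrow> per (\<lambda>x. lam (h x))"
  "per f \<Longrightarrow> per g \<Longrightarrow> per (\<lambda>x. f x + g x)"
  "per f \<Longrightarrow> per g \<Longrightarrow> per (\<lambda>x. f x - g x)"
  "per f \<Longrightarrow> per g \<Longrightarrow> per (\<lambda>x. f x * g x)"
  "(\<And>i. i \<in> A \<Longrightarrow> per (F i)) \<Longrightarrow> per (\<lambda>x. \<Sum>i\<in>A. F i x)"
  using per_comp[OF per_lam] unfolding per_def by (blast, blast, metis, metis, metis) (intro allI impI sum.cong, auto)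

lemma p_pos: "0 < int p" using prime_gt_0_nat[OF prime_p] by simp

lemma Zp_cong_eq: "x \<in> Zp \<Longrightarrow> y \<in> Zp \<Longrightarrow> [x = y] (mod int p) \<longleftrightarrow> x = y"
  by (auto simp: cong_def)

lemma sum_reindex:
  assumes "per f" "\<And>x y. x \<in> Zp \<Longrightarrow> y \<in> Zp \<Longrightarrow> [g x = g y] (mod int p) \<Longrightarrow> x = y"
  shows "(\<Sum>x\<in>Zp. f (g x)) = (\<Sum>x\<in>Zp. f x)"
proof -
  let ?g = "\<lambda>x. g x mod int p"
  have "inj_on ?g Zp" by (intro inj_onI assms(2)) (simp_all add: cong_def)
  moreover have "?g ` Zp \<subseteq> Zp" using p_pos by auto
  ultimately have "bij_betw ?g Zp Zp" by (simp add: bij_betw_def endo_inj_surj)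
  then have "(\<Sum>x\<in>Zp. f (?g x)) = (\<Sum>x\<in>Zp. f x)" by (rule sum.reindex_bij_betw)
  moreover have "f (?g x) = f (g x)" for x using assms(1) unfolding per_def by (meson cong_mod_left cong_refl)
  ultimately show ?thesis by simp
qed

lemma sum_affine:
  assumes "per f" "\<not> int p dvd a"
  shows "(\<Sum>x\<in>Zp. f (a * x + b)) = (\<Sum>x\<in>Zp. f x)"
proof (rule sum_reindex[OF assms(1)])
  fix x y assume xy: "x \<in> Zp" "y \<in> Zp" "[a * x + b = a * y + b] (mod int p)"
  have "coprime a (int p)" using assms(2) prime_p by (metis coprime_commute prime_imp_coprime prime_nat_int_transfer)
  with xy show "x = y" by (simp add: cong_add_rcancel cong_mult_lcancel Zp_cong_eq)
qed

lemma sum_shift: "per f \<Longrightarrow> (\<Sum>x\<in>Zp. f (x + b)) = (\<Sum>x\<in>Zp. f x)"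
  using sum_affine[of f 1 b] prime_gt_1_nat[OF prime_p] by (simp add: zdvd_not_zless)

lemma lam_values: "lam x = 0 \<or> lam x = 1 \<or> lam x = -1"
  by (auto simp: Legendre_def)

lemma abs_lam: "\<bar>lam x\<bar> \<le> 1" using lam_values[of x] by auto

lemma lam_eq_0_iff: "lam x = 0 \<longleftrightarrow> int p dvd x"
  by (auto simp: Legendre_def cong_0_iff)

end

context stepanov begin

lemma hasse_large:
  assumes "64 \<le> p"
  shows "\<bar>real_of_int (\<Sum>x\<in>Zp. lam (poly F x))\<bar> \<le> 14 * sqrt p"
proof -
  define m where "m = nat \<lfloor>sqrt p / 2\<rfloor>"
  have m: "real m \<le> sqrt p / 2" "sqrt p / 2 < real m + 1"
  proof -
    have "real m = of_int \<lfloor>sqrt p / 2\<rfloor>" by (simp add: m_def)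
    then show "real m \<le> sqrt p / 2" "sqrt p / 2 < real m + 1" using floor_correct[of "sqrt p / 2"] by auto
  qed
  have sp: "8 \<le> sqrt p" using real_sqrt_le_mono[of 64 p] assms by simp
  have m4: "4 \<le> m" using m sp by linarith
  have "(real m)^2 \<le> (sqrt p / 2)^2" using m(1) by (rule power_mono) simp
  then have "4 * (real m)^2 \<le> p" by (simp add: power_divide)
  then have "real (4 * m^2) \<le> real p" by simp
  then have m2: "4 * m^2 \<le> p" by (simp only: of_nat_le_iff)
  have mm: "4 * m \<le> m^2" using m4 by (simp add: power2_eq_square)
  have bound: "real (card {x\<in>Zp. int p dvd poly F x \<or> [poly F x ^ h = a] (mod int p)}) \<le> p / 2 + 7 * sqrt p"
    (is "real ?N \<le> _") for a
  proof -
    \<comment> \<open>Order \<open>2 * m\<close> against \<open>m + 4\<close> blocks: the main term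
      is (m+5)p/(2m) = p/2 + O(sqrt p). The 4 surplus blocks yield 8b, about 4p, additional
      unknowns, and these outweigh the 10 m^2 + 8 m conditions due to degree growth, where 4 m^2 <=
      p.\<close>
    have "2 * m * ?N \<le> 3 * (2 * m) + ((m + 4) + 1) * p"
    proof (rule card_power_values[where b = "h - 1"])
      show "2 * m \<le> p" using m2 mm by linarith
      show "1 \<le> h - 1" "2 * (h - 1) + 1 < p" using h_double assms by linarith+
      have "5 * m^2 + 4 * m + 4 < 4 * h" using m2 mm h_double assms by linarith
      moreover obtain b where b: "h = Suc b" using h_pos gr0_implies_Suc by blast
      ultimately show "2 * m * (h - 1 + 2 * (2 * m) + (m + 4)) < 2 * (m + 4) * (h - 1)"
        by (simp add: power2_eq_square algebra_simps)
    qed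
    then have "real (2 * m * ?N) \<le> real (3 * (2 * m) + ((m + 4) + 1) * p)" by (simp only: of_nat_le_iff)
    then have "2 * real m * ?N \<le> 6 * real m + (real m + 5) * p" by (simp add: add.commute)
    then have "real ?N \<le> 3 + p / 2 + 5 * p / (2 * m)" using m4 by (simp add: field_simps)
    also have "5 * p / (2 * m) \<le> (25/4) * sqrt p"
    proof -
      have "sqrt p \<le> 5 / 2 * m" using m(2) m4 by linarith
      then have "sqrt p * sqrt p \<le> 5 / 2 * m * sqrt p" by (intro mult_right_mono) auto
      then show ?thesis using m4 by (simp add: field_simps)
    qed
    also have "3 + p / 2 + 25/4 * sqrt p \<le> p / 2 + 7 * sqrt p" using sp by simp
    finally show ?thesis by simp
  qed
  \<comment> \<open>Bounding from above the number of \<open>x\<close> with symbol 0 or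
    \<open>a\<close> bounds \<open>a\<close> times the sum from above; the two signs of
    \<open>a\<close> together control the absolute value.\<close>
  have half: "real_of_int (\<Sum>x\<in>Zp. a * lam (poly F x)) \<le> 14 * sqrt p" if a: "a = 1 \<or> a = -1" for a
  proof -
    let ?S = "{x\<in>Zp. int p dvd poly F x \<or> [poly F x ^ h = a] (mod int p)}"
    have "(\<Sum>x\<in>Zp. a * lam (poly F x)) \<le> (\<Sum>x\<in>Zp. 2 * (if x \<in> ?S then 1 else 0) - 1)"
    proof (rule sum_mono)
      fix x assume x: "x \<in> Zp"
      have "x \<in> ?S" if "lam (poly F x) = 0 \<or> lam (poly F x) = a"
      proof -
        have "[poly F x ^ h = lam (poly F x)] (mod int p)"
          using euler_criterion[OF prime_p p_gt_2] unfolding h_def by (rule cong_sym)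
        then show ?thesis using that x lam_eq_0_iff by fastforce
      qed
      then show "a * lam (poly F x) \<le> 2 * (if x \<in> ?S then 1 else 0) - 1"
        using lam_values[of "poly F x"] a by (auto split: if_splits)
    qed
    also have "\<dots> = 2 * int (card ?S) - int p"
      by (simp add: sum_subtractf sum_distrib_left[symmetric] sum.If_cases Int_def conj_commute)
    finally have "(\<Sum>x\<in>Zp. a * lam (poly F x)) \<le> 2 * int (card ?S) - int p" .
    then have "real_of_int (\<Sum>x\<in>Zp. a * lam (poly F x)) \<le> real_of_int (2 * int (card ?S) - int p)"
      by (simp only: of_int_le_iff)
    then show ?thesis using bound[of a] by simp
  qed
  show ?thesis using half[of 1] half[of "-1"] by (simp add: sum_negf)
qed

end

context prime_modulus begin

text \<open>For p < 64 the trivial bound p <= 8 sqrt p is enough. Otherwise a translation moves a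
  non-zero of \<open>F\<close> to 0, as \<open>F_at_0\<close> demands; one exists because a monic
  cubic has at most three zeros modulo \<open>p\<close>. Repeated roots are allowed: the argument
  rests on the odd degree.\<close>

lemma hasse_cubic:
  assumes "degree F = 3" "lead_coeff F = 1" "2 < p"
  shows "\<bar>real_of_int (\<Sum>x\<in>Zp. lam (poly F x))\<bar> \<le> 14 * sqrt p"
proof (cases "64 \<le> p")
  case False
  have "sqrt p \<le> sqrt 64" using False by (intro real_sqrt_le_mono) simp
  then have "sqrt p * sqrt p \<le> 14 * sqrt p" by (intro mult_right_mono) auto
  moreover have "\<bar>\<Sum>x\<in>Zp. lam (poly F x)\<bar> \<le> (\<Sum>x\<in>Zp. 1)" by (rule order.trans[OF sum_abs]) (intro sum_mono abs_lam)
  then have "real_of_int \<bar>\<Sum>x\<in>Zp. lam (poly F x)\<bar> \<le> real_of_int (int p)" by (subst of_int_le_iff) simp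
  ultimately show ?thesis by simp
next
  case True
  have nF: "\<not> pc dvd F"
  proof
    assume "pc dvd F"
    then have "int p dvd 1" using assms unfolding const_poly_dvd_iff by metis
    then show False using assms(3) by simp
  qed
  have "\<exists>x0\<in>Zp. \<not> int p dvd poly F x0"
  proof (rule ccontr)
    assume "\<not> ?thesis"
    then have "1 * card Zp \<le> degree F" using nF vanishes_to_1 by (intro root_count) auto
    then show False using assms(1) True by simp
  qed
  then obtain x0 where x0: "\<not> int p dvd poly F x0" by blast
  let ?G = "pcompose F [:x0, 1:]"
  interpret stepanov p ?G
  proof
    show "degree ?G = 3" using assms(1) by (simp add: degree_pcompose)
    show "lead_coeff ?G = 1" using assms(2) by (simp add: lead_coeff_comp)
    have "coeff ?G 0 = poly ?G 0" by (simp add: poly_0_coeff_0)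
    then show "\<not> int p dvd coeff ?G 0" using x0 by (simp add: poly_pcompose)
  qed (use assms in auto)
  have "(\<Sum>x\<in>Zp. lam (poly ?G x)) = (\<Sum>x\<in>Zp. lam (poly F (x + x0)))" by (simp add: poly_pcompose add.commute)
  also have "\<dots> = (\<Sum>x\<in>Zp. lam (poly F x))" by (rule sum_shift) (intro per_intros cong_map_poly)
  finally show ?thesis using hasse_large[OF True] by simp
qed

end

section \<open>Legendre symbol sums\<close>

locale prime_1_mod_4 = prime_modulus +
  assumes p_mod_4: "p mod 4 = 1"
begin

lemma p_gt_2: "2 < p" using prime_gt_1_nat[OF prime_p] p_mod_4 by (cases "p = 2") auto

lemma lam_mult: "lam (a * b) = lam a * lam b"
proof -
  have e: "[lam x = x ^ ((p - 1) div 2)] (mod int p)" for x by (rule euler_criterion[OF prime_p p_gt_2])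
  have "[lam a * lam b = a ^ ((p - 1) div 2) * b ^ ((p - 1) div 2)] (mod int p)" using e e by (rule cong_mult)
  then have "[lam (a * b) = lam a * lam b] (mod int p)" using e[of "a * b"] by (metis cong_sym cong_trans power_mult_distrib)
  then have "int p dvd lam (a * b) - lam a * lam b" by (simp add: cong_iff_dvd_diff)
  moreover have "\<bar>lam (a * b) - lam a * lam b\<bar> < int p"
    using lam_values[of "a * b"] lam_values[of a] lam_values[of b] p_gt_2 by auto
  ultimately show ?thesis using dvd_imp_le_int[of "lam (a * b) - lam a * lam b" "int p"] by linarith
qed

lemma lam_minus_1: "lam (-1) = 1"
proof -
  have "even ((p - 1) div 2)" using p_mod_4 by presburger
  then have "[lam (-1) = 1] (mod int p)" using euler_criterion[OF prime_p p_gt_2, of "-1"] by simp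
  then have "int p dvd lam (-1) - 1" by (simp add: cong_iff_dvd_diff)
  then show ?thesis using lam_values[of "-1"] p_gt_2 dvd_imp_le_int[of "lam (-1) - 1" "int p"] by linarith
qed

lemma lam_minus: "lam (- a) = lam a" using lam_mult[of "-1" a] lam_minus_1 by simp

lemma lam_minus_commute: "lam (a - b) = lam (b - a)" using lam_minus[of "a - b"] by simp

lemma lam_square: "\<not> int p dvd a \<Longrightarrow> lam a * lam a = 1" using lam_values[of a] lam_eq_0_iff[of a] by auto

lemma lam_eq: "lam x = lam y" if "[x = y] (mod int p)" using per_lam that by (simp add: per_def)

lemma lam_square_mult: "\<not> int p dvd a \<Longrightarrow> lam (a^2 * b) = lam b"
  by (simp add: power2_eq_square lam_mult mult.assoc[symmetric] lam_square)

lemma lam_1: "lam 1 = 1" using lam_mult[of 1 1] lam_eq_0_iff[of 1] p_gt_2 by (auto simp: zdvd_not_zless)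

text \<open>Extended by \<open>minv 0 = 0\<close>, inversion permutes all residues.\<close>
definition minv :: "int \<Rightarrow> int" where "minv x = modular_inverse (int p) x"

lemma coprime_iff: "coprime x (int p) \<longleftrightarrow> \<not> int p dvd x"
  using prime_p by (metis coprime_absorb_right coprime_commute not_prime_unit prime_imp_coprime prime_nat_int_transfer)

lemma inv_cong: "\<not> int p dvd x \<Longrightarrow> [x * minv x = 1] (mod int p)"
  unfolding minv_def by (rule cong_modular_inverse1) (simp add: coprime_iff)

lemma inv_0: "int p dvd x \<Longrightarrow> minv x = 0" using coprime_iff[of x] by (simp add: minv_def modular_inverse_def coprime_commute)

lemma inv_dvd_iff: "int p dvd minv x \<longleftrightarrow> int p dvd x"
proof
  assume a: "int p dvd minv x"
  show "int p dvd x"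
  proof (rule ccontr)
    assume "\<not> int p dvd x"
    then have "[x * minv x = 1] (mod int p)" by (rule inv_cong)
    then have "int p dvd 1" using a by (metis cong_dvd_iff cong_sym dvd_mult)
    then show False using p_gt_2 by simp
  qed
qed (simp add: inv_0)

lemma inv_inv: "[minv (minv x) = x] (mod int p)"
proof (cases "int p dvd x")
  case True
  then show ?thesis by (simp add: inv_0 cong_0_iff cong_sym_eq[of 0])
next
  case False
  have "[minv (minv x) * (x * minv x) = minv (minv x) * 1] (mod int p)"
    using inv_cong[OF False] by (intro cong_mult cong_refl)
  moreover have "[x * (minv x * minv (minv x)) = x * 1] (mod int p)"
    using inv_cong[of "minv x"] False by (intro cong_mult cong_refl) (simp_all add: inv_dvd_iff)
  ultimately show ?thesis by (metis cong_sym cong_trans mult.assoc mult.commute mult.right_neutral)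
qed

lemma per_inv: "per minv" unfolding per_def
proof (intro allI impI)
  fix x y assume xy: "[x = y] (mod int p)"
  show "minv x = minv y"
  proof (cases "int p dvd x")
    case True
    then show ?thesis using xy by (metis cong_dvd_iff inv_0)
  next
    case False
    have "[y * minv x = x * minv x] (mod int p)" using xy by (intro cong_mult cong_refl) (rule cong_sym)
    then have "[y * minv x = 1] (mod int p)" using inv_cong[OF False] by (rule cong_trans)
    moreover have "minv x \<in> Zp"
      unfolding minv_def using p_pos by (simp add: modular_inverse_int_nonneg modular_inverse_int_less)
    ultimately show ?thesis unfolding minv_def[of y] by (intro modular_inverse_int_eqI[symmetric])
  qed
qed

lemma sum_inv: "per f \<Longrightarrow> (\<Sum>x\<in>Zp. f (minv x)) = (\<Sum>x\<in>Zp. f x)"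
proof (rule sum_reindex)
  fix x y assume "x \<in> Zp" "y \<in> Zp" "[minv x = minv y] (mod int p)"
  moreover then have "minv (minv x) = minv (minv y)" using per_inv by (simp add: per_def)
  ultimately show "x = y" using inv_inv[of x] inv_inv[of y] Zp_cong_eq by (metis cong_sym cong_trans)
qed

lemma zero_Zp: "0 \<in> Zp" "1 \<in> Zp" using p_gt_2 by auto

lemma Zp_dvd_iff: "x \<in> Zp \<Longrightarrow> int p dvd x \<longleftrightarrow> x = 0"
  by (auto simp: zdvd_not_zless le_less)

section \<open>Sums over squares, and Legendre symbol sums of linear and quadratic
  polynomials\<close>

lemma card_sqrt: "int (card {x\<in>Zp. [x^2 = d] (mod int p)}) = 1 + lam d"
proof (cases "int p dvd d")
  case True
  have "[x^2 = d] (mod int p) \<longleftrightarrow> int p dvd x" for x using dvd_diff_left_iff[OF True, of "x^2"]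
    by (simp only: cong_iff_dvd_diff power2_eq_square dvd_mult_p) simp
  then have "{x\<in>Zp. [x^2 = d] (mod int p)} = {x\<in>Zp. int p dvd x}" by simp
  also have "\<dots> = {0}" using Zp_dvd_iff zero_Zp by auto
  finally show ?thesis using True lam_eq_0_iff by simp
next
  case False
  show ?thesis
  proof (cases "QuadRes (int p) d")
    case True
    then obtain y where y: "[y^2 = d] (mod int p)" by (auto simp: QuadRes_def)
    have ny: "\<not> int p dvd y" using False cong_dvd_iff[OF y] by (auto simp: power2_eq_square)
    let ?a = "y mod int p" and ?b = "(- y) mod int p"
    have "{x\<in>Zp. [x^2 = d] (mod int p)} = {?a, ?b}"
    proof (intro equalityI subsetI)
      fix x assume x: "x \<in> {x\<in>Zp. [x^2 = d] (mod int p)}"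
      then have "[x^2 = y^2] (mod int p)" using y by (auto intro: cong_trans[OF _ cong_sym])
      then have "int p dvd (x - y) * (x + y)" by (simp add: cong_iff_dvd_diff power2_eq_square algebra_simps)
      then have "int p dvd x - y \<or> int p dvd x - (- y)" by (simp add: dvd_mult_p)
      then have "x mod int p = ?a \<or> x mod int p = ?b" by (simp add: mod_eq_dvd_iff)
      then show "x \<in> {?a, ?b}" using x by auto
    next
      fix x assume "x \<in> {?a, ?b}"
      then have "x \<in> Zp" "[x = y] (mod int p) \<or> [x = - y] (mod int p)" using p_pos by auto
      moreover from this(2) have "[x^2 = y^2] (mod int p)"
        using cong_pow[of x y "int p" 2] cong_pow[of x "- y" "int p" 2] by auto
      ultimately show "x \<in> {x\<in>Zp. [x^2 = d] (mod int p)}" using y by (auto intro: cong_trans)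
    qed
    moreover have "?a \<noteq> ?b"
    proof
      assume "?a = ?b"
      then have "int p dvd 2 * y" by (simp add: mod_eq_dvd_iff)
      then show False using ny p_gt_2 by (simp add: dvd_mult_p zdvd_not_zless)
    qed
    ultimately show ?thesis using True False by (simp add: Legendre_def cong_0_iff)
  next
    case nr: False
    then have "{x\<in>Zp. [x^2 = d] (mod int p)} = {}" by (auto simp: QuadRes_def)
    moreover have "lam d = - 1" using nr False by (simp add: Legendre_def cong_0_iff)
    ultimately show ?thesis by (simp only: card.empty)
  qed
qed

lemma sum_square_of_int:
  fixes f :: "int \<Rightarrow> 'a :: comm_ring_1"
  assumes "per f"
  shows "(\<Sum>x\<in>Zp. f (x^2)) = (\<Sum>d\<in>Zp. of_int (1 + lam d) * f d)"
proof -
  have "(\<Sum>d\<in>Zp. of_int (1 + lam d) * f d) = (\<Sum>d\<in>Zp. \<Sum>x\<in>{x\<in>Zp. [x^2 = d] (mod int p)}. f d)"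
    unfolding card_sqrt[symmetric] by simp
  also have "\<dots> = (\<Sum>d\<in>Zp. \<Sum>x\<in>{x\<in>Zp. x^2 mod int p = d}. f (x^2))"
  proof (intro sum.cong refl)
    fix d assume "d \<in> Zp"
    then show "{x\<in>Zp. [x^2 = d] (mod int p)} = {x\<in>Zp. x^2 mod int p = d}" by (auto simp: cong_def)
    fix x assume "x \<in> {x\<in>Zp. x^2 mod int p = d}"
    then show "f d = f (x^2)" using assms by (auto simp: per_def)
  qed
  also have "\<dots> = (\<Sum>x\<in>Zp. f (x^2))" using p_pos by (intro sum.group) auto
  finally show ?thesis by simp
qed

lemma sum_square:
  fixes f :: "int \<Rightarrow> int"
  assumes "per f"
  shows "(\<Sum>x\<in>Zp. f (x^2)) = (\<Sum>d\<in>Zp. (1 + lam d) * f d)" using sum_square_of_int[OF assms] by simp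

lemma sum_lam: "(\<Sum>x\<in>Zp. lam x) = 0" using sum_square[of "\<lambda>_. 1"] by (simp add: per_def sum.distrib)

lemma sum_lam_linear: "\<not> int p dvd a \<Longrightarrow> (\<Sum>x\<in>Zp. lam (a * x + b)) = 0" using sum_affine[OF per_lam] sum_lam by simp

text \<open>For x /= 0 one has x (k + m x) = x^2 (k / x + m), so inversion makes the argument
  linear. By \<open>minv 0 = 0\<close> the linear sum contains the extra term \<open>lam m\<close>
  at x = 0, and since the linear sum is zero this term, subtracted, is the answer.\<close>

lemma sum_lam_quadratic:
  assumes "\<not> int p dvd k"
  shows "(\<Sum>x\<in>Zp. lam (x * (k + m * x))) = - lam m"
proof -
  have "lam (x * (k + m * x)) = lam (k * minv x + m) - (if x = 0 then lam m else 0)" if "x \<in> Zp" for x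
  proof (cases "x = 0")
    case True
    then show ?thesis by (simp add: inv_0 lam_eq_0_iff)
  next
    case False
    then have nx: "\<not> int p dvd x" using that Zp_dvd_iff by blast
    have "[x^2 * (k * minv x + m) = x * (k * (x * minv x) + m * x)] (mod int p)"
      by (simp add: power2_eq_square algebra_simps)
    also have "[x * (k * (x * minv x) + m * x) = x * (k * 1 + m * x)] (mod int p)"
      using inv_cong[OF nx] by (intro cong_mult cong_add cong_refl)
    finally have "lam (x^2 * (k * minv x + m)) = lam (x * (k + m * x))" by (intro lam_eq) simp
    then show ?thesis using False lam_square_mult[OF nx] by simp
  qed
  then have "(\<Sum>x\<in>Zp. lam (x * (k + m * x))) = (\<Sum>x\<in>Zp. lam (k * minv x + m)) - lam m"
    using zero_Zp by (simp add: sum_subtractf)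
  also have "(\<Sum>x\<in>Zp. lam (k * minv x + m)) = (\<Sum>x\<in>Zp. lam (k * x + m))"
    using sum_inv[of "\<lambda>x. lam (k * x + m)"] by (simp add: per_intros cong_map_intros)
  finally show ?thesis using sum_lam_linear[OF assms] by simp
qed

lemma abs_sum_lam_le: "\<bar>\<Sum>x\<in>Zp. lam (f x) * lam (g x)\<bar> \<le> int p"
proof -
  have "\<bar>\<Sum>x\<in>Zp. lam (f x) * lam (g x)\<bar> \<le> (\<Sum>x\<in>Zp. 1)"
  proof (rule order.trans[OF sum_abs], rule sum_mono)
    fix x show "\<bar>lam (f x) * lam (g x)\<bar> \<le> 1" using lam_values[of "f x"] lam_values[of "g x"] by auto
  qed
  then show ?thesis by simp
qed

section \<open>A Clausen identity\<close>


text \<open>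
  \<open>U A B\<close> is the finite field analogue of ${}_3F_2(1/2,1/2,1/2;1,1;B/A)$. In the product of two copies of
  the cubic sum \<open>hs\<close> over \<open>w\<close> and \<open>v\<close>, the parameter $z = (wv+R)/(w+v)$ multiplies
  $w + \sqrt R$ and $v + \sqrt R$, so that $(w^2-R)(v^2-R)$ and $z^2-R$ have the same quadratic character.
  For fixed \<open>z\<close> the sum over \<open>w\<close> is a Legendre cubic in $\tau = (z^2-R)/(z+c)^2$. Only the order
  of magnitude is needed, so degenerate fibres are bounded trivially.
\<close>
definition U :: "int \<Rightarrow> int \<Rightarrow> int" where
  "U A B = (\<Sum>x\<in>Zp. \<Sum>s\<in>Zp. lam (x * (1 - x) * (s * (1 - s)) * (A - B * x * s)))"

lemma abs_lam_mult: "\<bar>lam a * i\<bar> \<le> \<bar>i\<bar>" using lam_values[of a] by auto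

definition hs :: "int \<Rightarrow> int \<Rightarrow> int" where
  "hs c R = (\<Sum>w\<in>Zp. lam ((w + c) * (w^2 - R)))"

text \<open>Solving z = (w v + R) / (w + v) for v gives (v + c) (z - w) = R + c z - w z - c w. So
  the last symbol is that of v + c, and \<open>Ks\<close> is the sum over \<open>v\<close> in the
  new variable, up to the character of w^2 - R.\<close>

definition Ks :: "int \<Rightarrow> int \<Rightarrow> int \<Rightarrow> int" where
  "Ks c R w = (\<Sum>z\<in>Zp. lam (z^2 - R) * lam ((z - w) * (R + c * z - w * z - c * w)))"

text \<open>For fixed \<open>w\<close> the map v -> z is fractional linear, factored as t = w + v, s
  = 1/t, z = w + (R - w^2) s. The point v = -w goes to infinity and costs 1. If w^2 = R the map is
  constant, and the trivial bound \<open>p\<close> is used.\<close>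

lemma clausen_fibre:
  "\<bar>lam ((w + c) * (w^2 - R)) * hs c R - lam (w + c) * Ks c R w\<bar> \<le> 1 + (if int p dvd w^2 - R then int p else 0)"
proof (cases "int p dvd w^2 - R")
  case True
  then have "lam ((w + c) * (w^2 - R)) = 0" by (simp add: lam_eq_0_iff)
  moreover have "\<bar>lam (w + c) * Ks c R w\<bar> \<le> int p" unfolding Ks_def by (rule order.trans[OF abs_lam_mult abs_sum_lam_le])
  ultimately show ?thesis using True by simp
next
  case False
  define f where "f = (\<lambda>t. lam ((t - w + c) * ((t - w)^2 - R)))"
  define g where "g = (\<lambda>s. lam (s * (1 + (c - w) * s) * ((1 - w * s)^2 - R * s^2)))"
  have "per f" unfolding f_def by (intro per_intros cong_map_intros)
  have "hs c R = (\<Sum>t\<in>Zp. f t)" unfolding hs_def f_def using sum_shift[of "\<lambda>w. lam ((w + c) * (w^2 - R))" "- w"]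
    by (simp add: per_intros cong_map_intros)
  also have "\<dots> = (\<Sum>s\<in>Zp. f (minv s))" using \<open>per f\<close> by (rule sum_inv[symmetric])
  also have "\<dots> = (\<Sum>s\<in>Zp. g s + (if s = 0 then f 0 else 0))"
  proof (rule sum.cong[OF refl])
    fix s assume s: "s \<in> Zp"
    show "f (minv s) = g s + (if s = 0 then f 0 else 0)"
    proof (cases "s = 0")
      case True
      then show ?thesis by (simp add: inv_0 g_def lam_eq_0_iff)
    next
      case False
      then have ns: "\<not> int p dvd s" using s Zp_dvd_iff by blast
      let ?q = "minv s"
      have "f ?q = lam (s^2 * (s^2 * ((?q - w + c) * ((?q - w)^2 - R))))" by (simp only: lam_square_mult[OF ns] f_def)
      also have "\<dots> = lam (s * (s * ?q + (c - w) * s) * ((s * ?q - w * s)^2 - R * s^2))"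
        by (simp add: power2_eq_square algebra_simps)
      also have "\<dots> = g s" unfolding g_def using inv_cong[OF ns]
        by (intro lam_eq cong_mult cong_add cong_diff cong_pow cong_refl)
      finally show ?thesis using False by simp
    qed
  qed
  also have "\<dots> = (\<Sum>s\<in>Zp. g s) + f 0" using zero_Zp by (simp add: sum.distrib)
  finally have hs: "hs c R = (\<Sum>s\<in>Zp. g s) + f 0" .
  have nD: "\<not> int p dvd R - w^2" using False by (metis dvd_minus_iff minus_diff_eq)
  let ?k = "\<lambda>z. lam (z^2 - R) * lam ((z - w) * (R + c * z - w * z - c * w))"
  have "Ks c R w = (\<Sum>s\<in>Zp. ?k ((R - w^2) * s + w))" unfolding Ks_def using sum_affine[OF _ nD, of ?k w]
    by (simp add: per_intros cong_map_intros)
  also have "\<dots> = (\<Sum>s\<in>Zp. lam (w^2 - R) * g s)"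
  proof (rule sum.cong[OF refl])
    fix s
    have 1: "((R - w^2) * s + w)^2 - R = (w^2 - R) * ((1 - w * s)^2 - R * s^2)" by (simp add: power2_eq_square algebra_simps)
    have 2: "((R - w^2) * s + w - w) * (R + c * ((R - w^2) * s + w) - w * ((R - w^2) * s + w) - c * w)
      = (R - w^2)^2 * (s * (1 + (c - w) * s))" by (simp add: power2_eq_square algebra_simps)
    show "?k ((R - w^2) * s + w) = lam (w^2 - R) * g s"
      unfolding 1 2 lam_square_mult[OF nD] g_def by (simp only: lam_mult mult_ac)
  qed
  finally have Ks: "Ks c R w = lam (w^2 - R) * (\<Sum>s\<in>Zp. g s)" by (simp add: sum_distrib_left)
  have "lam ((w + c) * (w^2 - R)) * hs c R - lam (w + c) * Ks c R w = lam (w + c) * (lam (w^2 - R) * f 0)"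
    unfolding hs Ks lam_mult by (simp add: algebra_simps)
  also have "\<bar>\<dots>\<bar> \<le> \<bar>f 0\<bar>" using abs_lam_mult order.trans by blast
  also have "\<dots> \<le> 1" unfolding f_def by (rule abs_lam)
  finally show ?thesis using False by simp
qed

lemma clausen_step1: "\<bar>(hs c R)^2 - (\<Sum>w\<in>Zp. lam (w + c) * Ks c R w)\<bar> \<le> 3 * int p" (is "\<bar>?h - ?K\<bar> \<le> _")
proof -
  have eq: "?h - ?K =
     (\<Sum>w\<in>Zp. lam ((w + c) * (w^2 - R)) * hs c R - lam (w + c) * Ks c R w)"
    unfolding sum_subtractf sum_distrib_right[symmetric] by (simp add: hs_def power2_eq_square)
  have "\<bar>?h - ?K\<bar> \<le> (\<Sum>w\<in>Zp. 1 + (if int p dvd w^2 - R then int p else 0))"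
    unfolding eq by (rule order.trans[OF sum_abs], rule sum_mono, rule clausen_fibre)
  also have "\<dots> = (\<Sum>w\<in>Zp. 1) + (\<Sum>w\<in>Zp. if int p dvd w^2 - R then int p else 0)" by (rule sum.distrib)
  also have "(\<Sum>w\<in>Zp. if int p dvd w^2 - R then int p else 0) = (\<Sum>w\<in>{w\<in>Zp. int p dvd w^2 - R}. int p)"
    by (rule sum.inter_filter[symmetric]) (rule finite_atLeastLessThan_int)
  also have "\<dots> = (1 + lam R) * int p" unfolding sum_constant card_sqrt[symmetric] cong_iff_dvd_diff by (rule refl)
  also have "(\<Sum>w\<in>Zp. 1) = int p" by simp
  finally have "\<bar>?h - ?K\<bar> \<le> int p + (1 + lam R) * int p" .
  then show ?thesis using lam_values[of R] by auto
qed

definition Ms :: "int \<Rightarrow> int" where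
  "Ms t = (\<Sum>y\<in>Zp. lam (y * (1 - y)) * lam (1 - y - t))"

definition Ts :: "int \<Rightarrow> int \<Rightarrow> int \<Rightarrow> int" where
  "Ts c R z = lam (z^2 - R) * (\<Sum>w\<in>Zp. lam (w + c) * lam ((z - w) * (R + c * z - w * z - c * w)))"

text \<open>With z + c = 1/s and y = (w + c) / (z + c), \<open>t\<close> equals (z^2 - R) / (z +
  c)^2, and the sum over \<open>w\<close> depends on \<open>t\<close> alone. In terms of
  \<open>s\<close>, \<open>t\<close> is a quadratic polynomial.\<close>

lemma clausen_fibre2:
  fixes c R s :: int
  assumes "\<not> int p dvd s"
  defines "t \<equiv> (c^2 - R) * s^2 - 2 * c * s + 1"
  shows "Ts c R (minv s - c) = lam t * Ms t"
proof -
  define q where "q = minv s"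
  let ?z = "q - c"
  have nq: "\<not> int p dvd q" using assms(1) inv_dvd_iff by (simp add: q_def)
  have sq: "int p dvd s * q - 1" using inv_cong[OF assms(1)] by (simp add: q_def cong_iff_dvd_diff)
  have "s^2 * (?z^2 - R) - t = (s * q - 1) * (s * q + 1 - 2 * c * s)"
    unfolding t_def by (simp add: power2_eq_square algebra_simps)
  then have 1: "[s^2 * (?z^2 - R) = t] (mod int p)" using sq by (simp add: cong_iff_dvd_diff)
  then have lt: "lam (?z^2 - R) = lam t" using lam_eq[OF 1] lam_square_mult[OF assms(1)] by simp
  let ?k = "\<lambda>w. lam (w + c) * lam ((?z - w) * (R + c * ?z - w * ?z - c * w))"
  have "(\<Sum>w\<in>Zp. ?k w) = (\<Sum>y\<in>Zp. ?k (q * y - c))" using sum_affine[OF _ nq, of ?k "- c"]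
    by (simp add: per_intros cong_map_intros)
  also have "\<dots> = Ms t" unfolding Ms_def
  proof (rule sum.cong[OF refl])
    fix y
    let ?u = "q^2 * (1 - y) - (?z^2 - R)"
    have a: "(?z - (q * y - c)) * (R + c * ?z - (q * y - c) * ?z - c * (q * y - c)) = q * ((1 - y) * ?u)"
      by (simp add: power2_eq_square algebra_simps)
    have "s^2 * ?u - (1 - y - t) = (1 - y) * ((s * q - 1) * (s * q + 1)) - (s^2 * (?z^2 - R) - t)"
      by (simp add: power2_eq_square algebra_simps)
    moreover have "int p dvd (1 - y) * ((s * q - 1) * (s * q + 1)) - (s^2 * (?z^2 - R) - t)"
      by (rule dvd_diff[OF dvd_mult[OF dvd_mult2[OF sq]] 1[unfolded cong_iff_dvd_diff]])
    ultimately have "[s^2 * ?u = 1 - y - t] (mod int p)" by (simp only: cong_iff_dvd_diff)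
    then have u: "lam ?u = lam (1 - y - t)" using lam_eq lam_square_mult[OF assms(1)] by metis
    show "?k (q * y - c) = lam (y * (1 - y)) * lam (1 - y - t)"
      unfolding a u[symmetric] using lam_square[OF nq] by (simp add: lam_mult mult_ac)
  qed
  finally show ?thesis unfolding Ts_def q_def[symmetric] lt by simp
qed

lemma clausen_step2:
  "\<bar>(\<Sum>w\<in>Zp. lam (w + c) * Ks c R w) -
    (\<Sum>s\<in>Zp. lam ((c^2 - R) * s^2 - 2 * c * s + 1) * Ms ((c^2 - R) * s^2 - 2 * c * s + 1))\<bar> \<le> 2 * int p"
  (is "\<bar>?L - (\<Sum>s\<in>Zp. ?G s)\<bar> \<le> _")
proof -
  have b: "\<bar>Ts c R z\<bar> \<le> int p" "\<bar>?G s\<bar> \<le> int p" for z s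
    unfolding Ts_def Ms_def by (rule order.trans[OF abs_lam_mult abs_sum_lam_le])+
  have perT: "per (\<lambda>z. Ts c R (z - c))" unfolding Ts_def by (intro per_intros cong_map_intros)
  have "?L = (\<Sum>z\<in>Zp. Ts c R z)" unfolding Ks_def Ts_def sum_distrib_left by (subst sum.swap) (simp only: mult.left_commute)
  also have "\<dots> = (\<Sum>z\<in>Zp. Ts c R (z - c))"
    using sum_shift[of "Ts c R" "- c"] unfolding Ts_def by (simp add: per_intros cong_map_intros)
  also have "\<dots> = (\<Sum>s\<in>Zp. Ts c R (minv s - c))" using sum_inv[OF perT] by simp
  finally have "?L - (\<Sum>s\<in>Zp. ?G s) = (\<Sum>s\<in>Zp. Ts c R (minv s - c) - ?G s)" by (simp add: sum_subtractf)
  \<comment> \<open>At \<open>s = 0\<close> the convention \<open>minv 0 = 0\<close> yields z = -c,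
    the degenerate fibre; there both terms are bounded trivially by \<open>p\<close>.\<close>
  also have "\<dots> = (\<Sum>s\<in>Zp. if s = 0 then Ts c R (minv s - c) - ?G s else 0)"
    using clausen_fibre2 Zp_dvd_iff by (intro sum.cong refl) auto
  also have "\<dots> = Ts c R (minv 0 - c) - ?G 0" using zero_Zp by simp
  also have "\<bar>\<dots>\<bar> \<le> 2 * int p" using b(1)[of "minv 0 - c"] b(2)[of 0] by linarith
  finally show ?thesis .
qed

lemma per_Ms: "per (\<lambda>t. lam t * Ms t)" unfolding Ms_def by (intro per_intros cong_map_intros)

text \<open>Completing the square, a (a s^2 - 2 c s + 1) = (a s - c)^2 - R modulo \<open>p\<close>.
  So the value t is taken by as many \<open>s\<close> as a t + R has square roots.\<close>

lemma clausen_step3: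
  assumes "\<not> int p dvd a" "[a = c^2 - R] (mod int p)"
  shows "(\<Sum>s\<in>Zp. lam (a * s^2 - 2 * c * s + 1) * Ms (a * s^2 - 2 * c * s + 1))
    = (\<Sum>t\<in>Zp. (1 + lam (a * t + R)) * (lam t * Ms t))"
proof -
  define G where "G = (\<lambda>t. lam t * Ms t)"
  have perG: "per G" unfolding G_def by (rule per_Ms)
  define b where "b = minv a"
  have ab: "[a * b = 1] (mod int p)" unfolding b_def by (rule inv_cong[OF assms(1)])
  define H where "H = (\<lambda>d. G (b * (d - R)))"
  have perH: "per H" unfolding H_def by (rule per_comp[OF perG]) (intro cong_map_intros)
  have "(\<Sum>s\<in>Zp. G (a * s^2 - 2 * c * s + 1)) = (\<Sum>s\<in>Zp. H ((a * s + (- c))^2))"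
  proof (rule sum.cong[OF refl])
    fix s
    have "[b * ((a * s + (- c))^2 - R) = b * (a * (a * s^2 - 2 * c * s) + (c^2 - R))] (mod int p)"
      by (intro cong_mult cong_refl) (simp add: power2_eq_square algebra_simps)
    also have "[b * (a * (a * s^2 - 2 * c * s) + (c^2 - R)) = b * (a * (a * s^2 - 2 * c * s) + a)] (mod int p)"
      using assms(2) by (intro cong_mult cong_add cong_refl) (rule cong_sym)
    also have "[b * (a * (a * s^2 - 2 * c * s) + a) = (a * b) * (a * s^2 - 2 * c * s + 1)] (mod int p)"
      by (simp add: algebra_simps)
    also have "[(a * b) * (a * s^2 - 2 * c * s + 1) = 1 * (a * s^2 - 2 * c * s + 1)] (mod int p)"
      using ab by (intro cong_mult cong_refl)
    finally show "G (a * s^2 - 2 * c * s + 1) = H ((a * s + (- c))^2)"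
      unfolding H_def using perG by (simp add: per_def cong_sym_eq)
  qed
  also have "\<dots> = (\<Sum>u\<in>Zp. H (u^2))" by (rule sum_affine[OF _ assms(1)]) (rule per_comp[OF perH], intro cong_map_intros)
  also have "\<dots> = (\<Sum>d\<in>Zp. (1 + lam d) * H d)" by (rule sum_square[OF perH])
  also have "\<dots> = (\<Sum>t\<in>Zp. (1 + lam (a * t + R)) * H (a * t + R))"
    by (rule sum_affine[OF _ assms(1), symmetric]) (intro per_intros cong_map_intros perH)
  also have "\<dots> = (\<Sum>t\<in>Zp. (1 + lam (a * t + R)) * G t)"
  proof (rule sum.cong[OF refl])
    fix t
    have "[(a * b) * t = 1 * t] (mod int p)" using ab by (intro cong_mult cong_refl)
    then have "[b * (a * t + R - R) = t] (mod int p)" by (simp add: mult_ac)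
    then show "(1 + lam (a * t + R)) * H (a * t + R) = (1 + lam (a * t + R)) * G t"
      unfolding H_def using perG by (simp add: per_def)
  qed
  finally show ?thesis by (simp add: G_def)
qed

text \<open>Summed over \<open>t\<close> first, the argument is quadratic in \<open>t\<close>, and
  \<open>sum_lam_quadratic\<close> leaves a term of size at most 1 for each
  \<open>y\<close>.\<close>

lemma clausen_step4: "\<bar>\<Sum>t\<in>Zp. lam t * Ms t\<bar> \<le> int p"
proof -
  have "(\<Sum>t\<in>Zp. lam t * Ms t) = (\<Sum>y\<in>Zp. lam (y * (1 - y)) * (\<Sum>t\<in>Zp. lam (t * ((1 - y) + (-1) * t))))"
    unfolding Ms_def sum_distrib_left by (subst sum.swap) (simp add: lam_mult mult_ac)
  also have "\<bar>\<dots>\<bar> \<le> (\<Sum>y\<in>Zp. 1)"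
  proof (rule order.trans[OF sum_abs], rule sum_mono)
    fix y
    show "\<bar>lam (y * (1 - y)) * (\<Sum>t\<in>Zp. lam (t * ((1 - y) + (-1) * t)))\<bar> \<le> 1"
    proof (cases "int p dvd 1 - y")
      case True
      then have "lam (y * (1 - y)) = 0" by (subst lam_eq_0_iff) simp
      then show ?thesis by simp
    next
      case False
      show ?thesis unfolding sum_lam_quadratic[OF False] lam_minus_1 using abs_lam by simp
    qed
  qed
  finally show ?thesis by simp
qed

text \<open>The substitutions y -> 1 - y and then t = y s turn 1 - y - t into y (1 - s); the surplus
  factor y^2 is a square and drops out.\<close>

lemma clausen_step5: "(\<Sum>t\<in>Zp. lam (a * t + R) * (lam t * Ms t)) = U R (- a)"
proof -
  let ?k = "\<lambda>y t. lam (a * t + R) * lam t * lam (y * (1 - y)) * lam (1 - y - t)"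
    and ?u = "\<lambda>y s. lam (y * (1 - y) * (s * (1 - s)) * (R - (- a) * y * s))"
  have "(\<Sum>t\<in>Zp. lam (a * t + R) * (lam t * Ms t)) = (\<Sum>y\<in>Zp. \<Sum>t\<in>Zp. ?k y t)"
    unfolding Ms_def sum_distrib_left by (subst sum.swap) (simp add: mult_ac)
  also have "\<dots> = (\<Sum>y\<in>Zp. \<Sum>t\<in>Zp. ?k (-1 * y + 1) t)"
    by (rule sum_affine[symmetric]) (intro per_intros cong_map_intros, use p_gt_2 in simp)
  also have "\<dots> = (\<Sum>y\<in>Zp. \<Sum>s\<in>Zp. ?u y s)"
  proof (rule sum.cong[OF refl])
    fix y assume y: "y \<in> Zp"
    show "(\<Sum>t\<in>Zp. ?k (-1 * y + 1) t) = (\<Sum>s\<in>Zp. ?u y s)"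
    proof (cases "y = 0")
      case True
      then show ?thesis using lam_eq_0_iff[of 0] by simp
    next
      case False
      then have ny: "\<not> int p dvd y" using y Zp_dvd_iff by blast
      have "(\<Sum>t\<in>Zp. ?k (-1 * y + 1) t) = (\<Sum>s\<in>Zp. ?k (-1 * y + 1) (y * s + 0))"
        by (rule sum_affine[OF _ ny, symmetric]) (intro per_intros cong_map_intros)
      also have "\<dots> = (\<Sum>s\<in>Zp. lam (y^2 * (y * (1 - y) * (s * (1 - s)) * (R - (- a) * y * s))))"
        by (intro sum.cong refl) (simp only: lam_mult[symmetric], rule arg_cong[of _ _ lam], simp add: power2_eq_square algebra_simps)
      finally show ?thesis by (simp only: lam_square_mult[OF ny])
    qed
  qed
  finally show ?thesis by (simp only: U_def)
qed

lemma clausen: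
  assumes "\<not> int p dvd R - c^2"
  shows "\<bar>(hs c R)^2 - U R (R - c^2)\<bar> \<le> 6 * int p"
proof -
  have n: "\<not> int p dvd c^2 - R" using assms by (metis dvd_minus_iff minus_diff_eq)
  have "(\<Sum>s\<in>Zp. lam ((c^2 - R) * s^2 - 2 * c * s + 1) * Ms ((c^2 - R) * s^2 - 2 * c * s + 1)) =
    (\<Sum>t\<in>Zp. lam t * Ms t) + U R (R - c^2)"
    unfolding clausen_step3[OF n cong_refl] distrib_right sum.distrib clausen_step5 by simp
  then show ?thesis using clausen_step1[of c R] clausen_step2[of c R] clausen_step4 by linarith
qed

section \<open>Multiplicative convolutions of the quadratic character\<close>


text \<open>The factor $a^2$ only makes \<open>f2\<close> vanish at the multiples of \<open>p\<close>.\<close>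
definition f2 :: "int \<Rightarrow> int" where "f2 a = lam (a^2 * (a^2 - 1))"

lemma f2_eq: "\<not> int p dvd a \<Longrightarrow> f2 a = lam (a^2 - 1)"
  by (simp add: f2_def lam_square_mult)

lemma f2_0: "int p dvd a \<Longrightarrow> f2 a = 0"
  by (simp add: f2_def lam_eq_0_iff power2_eq_square)

lemma per_f2: "per f2" unfolding f2_def by (intro per_intros cong_map_intros)

lemma abs_hs: "real_of_int \<bar>hs c R\<bar> \<le> 14 * sqrt p"
proof -
  have "hs c R = (\<Sum>w\<in>Zp. lam (poly [:- c * R, - R, c, 1:] w))"
    unfolding hs_def by (intro sum.cong refl arg_cong[of _ _ lam]) (simp add: power2_eq_square algebra_simps)
  then show ?thesis using hasse_cubic[of "[:- c * R, - R, c, 1:]"] p_gt_2 by simp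
qed

lemma U_scale:
  assumes "\<not> int p dvd k"
  shows "\<bar>U A B\<bar> = \<bar>U (k * A) (k * B)\<bar>"
proof -
  have "U (k * A) (k * B) = lam k * U A B" unfolding U_def sum_distrib_left
    by (intro sum.cong refl) (simp add: lam_mult[symmetric] algebra_simps)
  moreover have "lam k = 1 \<or> lam k = -1" using lam_values[of k] assms lam_eq_0_iff by auto
  ultimately show ?thesis by auto
qed

lemma U_cong: "[A = A'] (mod int p) \<Longrightarrow> [B = B'] (mod int p) \<Longrightarrow> U A B = U A' B'"
  unfolding U_def by (intro sum.cong refl lam_eq cong_mult cong_diff cong_refl)

text \<open>
  Scaling by \<open>k\<close> brings $(r,1)$ to the form $(R, R-c^2)$ as soon as $k(r-1) = c^2$: take $k = c = r-1$, or
  $k = 1$, $c = 0$ if $r = 1$.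
\<close>
lemma abs_U:
  assumes "\<not> int p dvd r"
  shows "\<bar>U r 1\<bar> \<le> 202 * int p"
proof -
  \<comment> \<open>Here 202 = 14^2 + 6: the Hasse bound for \<open>hs\<close>, squared, plus the
    error in \<open>clausen\<close>.\<close>
  have bound: "\<bar>U R (R - c^2)\<bar> \<le> 202 * int p" if "\<not> int p dvd R - c^2" for R c
  proof -
    have "(real_of_int \<bar>hs c R\<bar>)^2 \<le> (14 * sqrt p)^2" using abs_hs by (intro power_mono) auto
    then have "real_of_int ((hs c R)^2) \<le> real_of_int (196 * int p)" by (simp add: power_mult_distrib)
    then have "(hs c R)^2 \<le> 196 * int p" by (simp only: of_int_le_iff)
    moreover have "0 \<le> (hs c R)^2" by simp
    ultimately show ?thesis using clausen[OF that] by linarith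
  qed
  show ?thesis
  proof (cases "int p dvd r - 1")
    case True
    have "U r 1 = U 1 (1 - 0^2)" using True by (intro U_cong) (simp_all add: cong_iff_dvd_diff)
    then show ?thesis using bound[of 1 0] p_gt_2 by simp
  next
    case False
    have "(r - 1) * r - (r - 1)^2 = (r - 1) * 1" by (simp add: power2_eq_square algebra_simps)
    then show ?thesis using bound[of "(r - 1) * r" "r - 1"] U_scale[OF False, of r 1] False by simp
  qed
qed

text \<open>Multiplicative convolution on the units, with d / a written by \<open>minv\<close>. At a
  = 0 the convention \<open>minv 0 = 0\<close> makes the summand \<open>F 0 * G 0\<close>, which is
  harmless when \<open>F\<close> vanishes there, as \<open>f2\<close> does.\<close>

definition zconv :: "(int \<Rightarrow> int) \<Rightarrow> (int \<Rightarrow> int) \<Rightarrow> int \<Rightarrow> int" where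
  "zconv F G d = (\<Sum>a\<in>Zp. F a * G (d * minv a))"

lemma quotient_square:
  assumes "\<not> int p dvd a" "\<not> int p dvd r"
  shows "f2 (r * minv a) = lam (r^2 - a^2)"
proof -
  have n: "\<not> int p dvd r * minv a" using assms by (simp add: dvd_mult_p inv_dvd_iff)
  have "f2 (r * minv a) = lam (a^2 * ((r * minv a)^2 - 1))" by (simp only: f2_eq[OF n] lam_square_mult[OF assms(1)])
  also have "a^2 * ((r * minv a)^2 - 1) = (r * (a * minv a))^2 - a^2" by (simp add: power2_eq_square algebra_simps)
  also have "lam \<dots> = lam ((r * 1)^2 - a^2)"
    using inv_cong[OF assms(1)] by (intro lam_eq cong_diff cong_pow cong_mult cong_refl)
  finally show ?thesis by simp
qed

lemma f2_quotient:
  assumes "\<not> int p dvd r"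
  shows "f2 a * f2 (r * minv a) = lam (a^2) * lam ((a^2 - 1) * (r^2 - a^2))"
proof (cases "int p dvd a")
  case True
  then have "int p dvd a^2" by (simp add: power2_eq_square)
  then have "lam (a^2) = 0" by (simp only: lam_eq_0_iff)
  then show ?thesis using f2_0[OF True] by simp
next
  case False
  have "lam (a^2) = 1" using lam_square_mult[OF False, of 1] lam_1 by simp
  then show ?thesis using quotient_square[OF False assms] f2_eq[OF False] by (simp add: lam_mult)
qed

text \<open>In the variable d = a^2 the weight 1 + \<open>lam d\<close> splits the sum. One part
  carries the cubic d (d - 1) (d - r^2), to which Hasse applies; in the other \<open>lam d\<close>
  is squared away, leaving a quadratic sum equal to -1 and a correction at d = 0. Hence 16 = 14 +
  2.\<close>

lemma zconv_f2_off_diagonal: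
  assumes "\<not> int p dvd r" "\<not> int p dvd r^2 - 1"
  shows "real_of_int \<bar>zconv f2 f2 r\<bar> \<le> 16 * sqrt p"
proof -
  let ?q = "\<lambda>d. lam ((d - 1) * (r^2 - d))" and ?F = "[:0, r^2, - (r^2 + 1), 1:]"
  let ?g = "\<lambda>d. lam d * ?q d" and ?z = "\<lambda>d. if d = 0 then lam (r^2) else 0"
  have "zconv f2 f2 r = (\<Sum>a\<in>Zp. ?g (a^2))" unfolding zconv_def f2_quotient[OF assms(1)] by simp
  also have "\<dots> = (\<Sum>d\<in>Zp. (1 + lam d) * ?g d)" by (rule sum_square) (intro per_intros cong_map_intros)
  also have "\<dots> = (\<Sum>d\<in>Zp. lam (poly ?F d) + (?q d - ?z d))"
  proof (rule sum.cong[OF refl])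
    fix d assume d: "d \<in> Zp"
    have 1: "?g d = lam (poly ?F d)"
    proof -
      have "?g d = lam (- (d * ((d - 1) * (r^2 - d))))" unfolding lam_minus by (simp only: lam_mult)
      also have "- (d * ((d - 1) * (r^2 - d))) = poly ?F d" by (simp add: algebra_simps)
      finally show ?thesis .
    qed
    have "lam d * ?g d = ?q d - ?z d"
    proof (cases "d = 0")
      case True
      then show ?thesis using lam_eq_0_iff[of 0] by (simp add: lam_minus)
    next
      case False
      then have "lam d * lam d = 1" using d Zp_dvd_iff lam_square by blast
      then show ?thesis using False by (simp add: mult.assoc[symmetric])
    qed
    then show "(1 + lam d) * ?g d = lam (poly ?F d) +
        (?q d - ?z d)" unfolding 1[symmetric] by (simp add: algebra_simps)
  qed
  also have "\<dots> = (\<Sum>d\<in>Zp. lam (poly ?F d)) + (\<Sum>d\<in>Zp. ?q d) - lam (r^2)"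
    using zero_Zp by (simp only: sum.distrib sum_subtractf sum.delta finite_atLeastLessThan_int) simp
  finally have eq: "zconv f2 f2 r = (\<Sum>d\<in>Zp. lam (poly ?F d)) + (\<Sum>d\<in>Zp. ?q d) - lam (r^2)" .
  have "(\<Sum>d\<in>Zp. ?q d) = (\<Sum>d\<in>Zp. ?q (d + 1))" by (rule sum_shift[symmetric]) (intro per_intros cong_map_intros)
  also have "\<dots> = (\<Sum>d\<in>Zp. lam (d * ((r^2 - 1) + (-1) * d)))" by (simp add: algebra_simps)
  also have "\<dots> = - 1" by (simp only: sum_lam_quadratic[OF assms(2)] lam_minus_1)
  finally have "\<bar>zconv f2 f2 r\<bar> \<le> \<bar>\<Sum>d\<in>Zp. lam (poly ?F d)\<bar> + 2" unfolding eq using abs_lam[of "r^2"] by linarith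
  moreover have "real_of_int \<bar>\<Sum>d\<in>Zp. lam (poly ?F d)\<bar> \<le> 14 * sqrt p" using hasse_cubic[of ?F] p_gt_2 by simp
  moreover have "1 \<le> sqrt p" using p_gt_2 by simp
  ultimately show ?thesis by linarith
qed

lemma square_eq_1_Zp:
  assumes "a \<in> Zp"
  shows "int p dvd a^2 - 1 \<longleftrightarrow> a = 1 \<or> a = int p - 1"
proof -
  have eq: "a^2 - 1 = (a - 1) * (a - (int p - 1)) + int p * (a - 1)" by (simp add: power2_eq_square algebra_simps)
  have "int p dvd a^2 - 1 \<longleftrightarrow> int p dvd (a - 1) * (a - (int p - 1))" unfolding eq by (rule dvd_add_left_iff) simp
  then show ?thesis
    using assms p_gt_2 Zp_cong_eq[of a 1] Zp_cong_eq[of a "int p - 1"] by (simp add: dvd_mult_p cong_iff_dvd_diff)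
qed

text \<open>When r^2 = 1 the two symbols in a summand agree because -1 is a square, so every summand
  is 1 except at a = 0 and at the two square roots of 1.\<close>

lemma zconv_f2_diagonal:
  assumes "int p dvd r^2 - 1"
  shows "\<bar>zconv f2 f2 r - int p\<bar> \<le> 3"
proof -
  have nr: "\<not> int p dvd r"
  proof
    assume "int p dvd r"
    then have "int p dvd r * r - (r^2 - 1)" by (rule dvd_diff[OF dvd_mult[of "int p" r r] assms])
    also have "r * r - (r^2 - 1) = 1" by (simp add: power2_eq_square)
    finally have "int p dvd 1" .
    then show False using p_gt_2 by simp
  qed
  let ?B = "{0, 1, int p - 1}"
  have *: "f2 a * f2 (r * minv a) = (if a \<in> ?B then 0 else 1)" if a: "a \<in> Zp" for a
  proof -
    have "f2 a * f2 (r * minv a) = lam (a^2) * lam ((a^2 - 1) * (r^2 - a^2))" by (rule f2_quotient[OF nr])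
    also have "lam ((a^2 - 1) * (r^2 - a^2)) = lam ((a^2 - 1) * (1 - a^2))"
      using assms by (intro lam_eq cong_mult cong_diff cong_refl) (simp add: cong_iff_dvd_diff)
    also have "\<dots> = lam (a^2 - 1) * lam (a^2 - 1)" by (simp add: lam_mult lam_minus_commute[of 1])
    finally have eq: "f2 a * f2 (r * minv a) = lam (a^2) * (lam (a^2 - 1) * lam (a^2 - 1))" .
    note d1 = square_eq_1_Zp[OF a]
    have d0: "int p dvd a^2 \<longleftrightarrow> a = 0" using Zp_dvd_iff[OF a] by (simp add: power2_eq_square dvd_mult_p)
    show ?thesis
    proof (cases "a \<in> ?B")
      case True
      then have "lam (a^2) = 0 \<or> lam (a^2 - 1) = 0" using d0 d1 by (auto simp: lam_eq_0_iff)
      then show ?thesis using eq True by auto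
    next
      case False
      then have "lam (a^2) = 1" using lam_square_mult[of a 1] lam_1 Zp_dvd_iff[OF a] by simp
      moreover have "lam (a^2 - 1) * lam (a^2 - 1) = 1" using False d1 by (intro lam_square) auto
      ultimately show ?thesis using eq False by simp
    qed
  qed
  have "zconv f2 f2 r = (\<Sum>a\<in>Zp. 1 - (if a \<in> ?B then 1 else 0))" unfolding zconv_def using * by (intro sum.cong refl) auto
  also have "\<dots> = int p - int (card (Zp \<inter> ?B))"
    by (simp only: sum_subtractf sum.inter_restrict[symmetric] finite_atLeastLessThan_int) simp
  finally have "zconv f2 f2 r = int p - int (card (Zp \<inter> ?B))" .
  moreover have "card (Zp \<inter> ?B) \<le> 3"
    using card_mono[of ?B "Zp \<inter> ?B"] card_insert_le_m1[of 3 "{1, int p - 1}" 0] card_insert_le_m1[of 2 "{int p - 1}" 1] by simp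
  ultimately show ?thesis by simp
qed

text \<open>
  When one of the three factors lacks its quadratic character, one of the two summations is a quadratic
  Legendre sum, which is bounded except for one value of the other variable.
\<close>
lemma degenerate_bound:
  assumes "\<And>d. \<bar>al d\<bar> \<le> 1"
  shows "\<bar>\<Sum>d\<in>Zp. \<Sum>e\<in>Zp. al d * (lam e * lam e) * lam ((d - 1) * ((e - 1) * (\<rho> - d * e)))\<bar> \<le> 3 * int p"
  (is "\<bar>\<Sum>d\<in>Zp. \<Sum>e\<in>Zp. ?t d e\<bar> \<le> _")
proof -
  have inner: "\<bar>\<Sum>e\<in>Zp. ?t d e\<bar> \<le> 2 + (if d = \<rho> mod int p then int p else 0)" if d: "d \<in> Zp" for d
  proof -
    let ?k = "\<lambda>e. lam ((e - 1) * (\<rho> - d * e))" and ?z = "\<lambda>e. if e = 0 then lam \<rho> else 0"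
    let ?S = "\<Sum>e\<in>Zp. ?k e"
    have "(\<Sum>e\<in>Zp. ?t d e) = (\<Sum>e\<in>Zp. (al d * lam (d - 1)) * (?k e - ?z e))"
    proof (rule sum.cong[OF refl])
      fix e assume e: "e \<in> Zp"
      have "lam e * lam e * ?k e = ?k e - ?z e"
      proof (cases "e = 0")
        case True
        then show ?thesis using lam_eq_0_iff[of 0] by (simp add: lam_minus)
      next
        case False
        then have "lam e * lam e = 1" using e Zp_dvd_iff lam_square by blast
        then show ?thesis using False by simp
      qed
      then show "?t d e = (al d * lam (d - 1)) * (?k e - ?z e)"
        unfolding lam_mult[of "d - 1"] by (metis mult.assoc mult.left_commute)
    qed
    also have "\<dots> = (al d * lam (d - 1)) * (?S - lam \<rho>)"
      using zero_Zp unfolding sum_distrib_left[symmetric] sum_subtractf by simp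
    also have "\<bar>\<dots>\<bar> \<le> \<bar>?S - lam \<rho>\<bar>"
    proof -
      have "\<bar>al d * lam (d - 1)\<bar> \<le> 1 * 1" unfolding abs_mult using assms abs_lam by (intro mult_mono) auto
      then show ?thesis unfolding abs_mult[of "al d * lam (d - 1)"] by (intro mult_left_le_one_le) auto
    qed
    also have "\<dots> \<le> \<bar>?S\<bar> + 1" using abs_lam[of \<rho>] by linarith
    also have "\<bar>?S\<bar> \<le> 1 + (if d = \<rho> mod int p then int p else 0)"
    proof (cases "int p dvd \<rho> - d")
      case True
      then have "d = \<rho> mod int p" using d by (metis atLeastLessThan_iff mod_eq_dvd_iff mod_pos_pos_trivial)
      then show ?thesis using abs_sum_lam_le[of "\<lambda>e. e - 1" "\<lambda>e. \<rho> - d * e"] by (simp add: lam_mult)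
    next
      case False
      have "?S = (\<Sum>e\<in>Zp. ?k (e + 1))" by (rule sum_shift[symmetric]) (intro per_intros cong_map_intros)
      also have "\<dots> = (\<Sum>e\<in>Zp. lam (e * ((\<rho> - d) + (- d) * e)))" by (simp add: algebra_simps)
      also have "\<dots> = - lam (- d)" using False by (rule sum_lam_quadratic)
      finally have "\<bar>?S\<bar> \<le> 1" using abs_lam[of "- d"] by simp
      then show ?thesis by (rule order.trans) simp
    qed
    finally show ?thesis by linarith
  qed
  have "\<bar>\<Sum>d\<in>Zp. \<Sum>e\<in>Zp. ?t d e\<bar> \<le> (\<Sum>d\<in>Zp. 2 + (if d = \<rho> mod int p then int p else 0))"
    by (rule order.trans[OF sum_abs], rule sum_mono, rule inner)
  also have "\<dots> \<le> 3 * int p" using p_pos by (simp add: sum.distrib)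
  finally show ?thesis .
qed

lemma zconv_f2_f2_f2:
  assumes "\<not> int p dvd r"
  shows "\<bar>zconv f2 (zconv f2 f2) r\<bar> \<le> 211 * int p"
proof -
  define \<rho> where "\<rho> = r^2"
  let ?L = "\<lambda>d e. lam ((d - 1) * ((e - 1) * (\<rho> - d * e)))"
    and ?S = "\<lambda>t. \<Sum>d\<in>Zp. \<Sum>e\<in>Zp. t d e :: int"
  have 1: "f2 a * zconv f2 f2 (r * minv a) = (\<Sum>b\<in>Zp. lam (a^2) * (lam (b^2) * ?L (a^2) (b^2)))" for a
  proof (cases "int p dvd a")
    case True
    then have "int p dvd a^2" by (simp add: power2_eq_square)
    then have "lam (a^2) = 0" by (simp only: lam_eq_0_iff)
    then show ?thesis using f2_0[OF True] by simp
  next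
    case False
    have n: "\<not> int p dvd r * minv a" using False assms by (simp add: dvd_mult_p inv_dvd_iff)
    have la: "lam (a^2) = 1" using lam_square_mult[OF False, of 1] lam_1 by simp
    show ?thesis unfolding zconv_def sum_distrib_left
    proof (rule sum.cong[OF refl])
      fix b
      have "f2 a * (f2 b * f2 (r * minv a * minv b)) = lam (a^2 - 1) * (lam (b^2) * lam ((b^2 - 1) * ((r * minv a)^2 - b^2)))"
        unfolding f2_quotient[OF n] f2_eq[OF False] ..
      also have "lam ((b^2 - 1) * ((r * minv a)^2 - b^2)) = lam (a^2 * ((b^2 - 1) * ((r * minv a)^2 - b^2)))"
        by (simp only: lam_square_mult[OF False])
      also have "a^2 * ((b^2 - 1) * ((r * minv a)^2 - b^2)) = (b^2 - 1) * ((r * (a * minv a))^2 - a^2 * b^2)"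
        by (simp add: power2_eq_square algebra_simps)
      also have "lam \<dots> = lam ((b^2 - 1) * ((r * 1)^2 - a^2 * b^2))"
        using inv_cong[OF False] by (intro lam_eq cong_diff cong_pow cong_mult cong_refl)
      finally show "f2 a * (f2 b * f2 (r * minv a * minv b)) = lam (a^2) * (lam (b^2) * ?L (a^2) (b^2))"
        unfolding la lam_mult[of "a^2 - 1"] \<rho>_def by (simp add: mult.left_commute)
    qed
  qed
  have 2: "(\<Sum>b\<in>Zp. lam d * (lam (b^2) * ?L d (b^2))) = (\<Sum>e\<in>Zp. (1 + lam e) * (lam d * (lam e * ?L d e)))" for d
    by (rule sum_square) (intro per_intros cong_map_intros)
  have "zconv f2 (zconv f2 f2) r = (\<Sum>a\<in>Zp. \<Sum>b\<in>Zp. lam (a^2) * (lam (b^2) * ?L (a^2) (b^2)))"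
    by (simp only: zconv_def[of f2 "zconv f2 f2"] 1)
  also have "\<dots> = (\<Sum>d\<in>Zp. (1 + lam d) * (\<Sum>b\<in>Zp. lam d * (lam (b^2) * ?L d (b^2))))"
    by (rule sum_square) (intro per_intros cong_map_intros)
  \<comment> \<open>The summand with \<open>lam d\<close> and \<open>lam e\<close> both intact is
    \<open>U\<close>. In the other three at least one of them is squared, so
    \<open>degenerate_bound\<close> applies, after exchanging \<open>d\<close> and \<open>e\<close>
    in one case. This gives 211 = 202 + 3 * 3.\<close>
  also have "\<dots> = (\<Sum>d\<in>Zp. \<Sum>e\<in>Zp. lam d * lam e * ?L d e + (lam d * (lam e * lam e) * ?L d e
      + ((lam d * lam d) * lam e * ?L d e + (lam d * lam d) * (lam e * lam e) * ?L d e)))"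
    unfolding 2 sum_distrib_left by (intro sum.cong refl) (simp add: algebra_simps)
  also have "\<dots> = ?S (\<lambda>d e. lam d * lam e * ?L d e) + (?S (\<lambda>d e. lam d * (lam e * lam e) * ?L d e)
     + (?S (\<lambda>d e. (lam d * lam d) * lam e * ?L d e) + ?S (\<lambda>d e. (lam d * lam d) * (lam e * lam e) * ?L d e)))"
    by (simp only: sum.distrib)
  finally have eq: "zconv f2 (zconv f2 f2) r = \<dots>" .
  have a: "(\<Sum>d\<in>Zp. \<Sum>e\<in>Zp. lam d * lam e * ?L d e) = U \<rho> 1" unfolding U_def
  proof (intro sum.cong refl)
    fix d e
    have "d * (1 - d) * (e * (1 - e)) * (\<rho> - 1 * d * e) = (d * e) * ((d - 1) * ((e - 1) * (\<rho> - d * e)))"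
      by (simp add: algebra_simps)
    then show "lam d * lam e * ?L d e = lam (d * (1 - d) * (e * (1 - e)) * (\<rho> - 1 * d * e))" by (simp only: lam_mult)
  qed
  have b: "\<bar>\<Sum>d\<in>Zp. \<Sum>e\<in>Zp. lam d * (lam e * lam e) * ?L d e\<bar> \<le> 3 * int p" by (rule degenerate_bound[OF abs_lam])
  have c: "\<bar>\<Sum>d\<in>Zp. \<Sum>e\<in>Zp. (lam d * lam d) * (lam e * lam e) * ?L d e\<bar> \<le> 3 * int p"
  proof (rule degenerate_bound)
    show "\<bar>lam d * lam d\<bar> \<le> 1" for d using lam_values[of d] by auto
  qed
  have "(\<Sum>d\<in>Zp. \<Sum>e\<in>Zp. (lam d * lam d) * lam e * ?L d e) = (\<Sum>d\<in>Zp. \<Sum>e\<in>Zp. lam d * (lam e * lam e) * ?L d e)"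
  proof (subst sum.swap, intro sum.cong refl)
    fix d e
    have "?L e d = ?L d e" by (rule arg_cong[of _ _ lam]) (simp add: algebra_simps)
    then show "lam e * lam e * lam d * ?L e d = lam d * (lam e * lam e) * ?L d e" by simp
  qed
  then have d: "\<bar>\<Sum>d\<in>Zp. \<Sum>e\<in>Zp. (lam d * lam d) * lam e * ?L d e\<bar> \<le> 3 * int p" using b by simp
  have "\<not> int p dvd \<rho>" using assms by (simp add: \<rho>_def power2_eq_square dvd_mult_p)
  then have "\<bar>U \<rho> 1\<bar> \<le> 202 * int p" by (rule abs_U)
  then show ?thesis unfolding eq a using b c d by linarith
qed

section \<open>Dirichlet characters modulo a prime\<close>


definition primroot :: nat where "primroot = (SOME g. residue_primroot p g)"

lemma primroot: "residue_primroot p primroot"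
  unfolding primroot_def using prime_primitive_root_exists[of p] prime_p prime_gt_1_nat[OF prime_p] by (metis someI_ex)

lemma coprime_primroot: "coprime p primroot" using primroot by (simp add: residue_primroot_def)

lemma power_primroot_cong: "[primroot ^ i = primroot ^ j] (mod p) \<longleftrightarrow> [i = j] (mod (p - 1))"
  using order_divides_expdiff[OF coprime_primroot] primroot prime_p by (simp add: residue_primroot_def totient_prime)

lemma coprime_p_iff: "coprime a p \<longleftrightarrow> \<not> p dvd a" using coprime_iff[of "int a"] by simp

lemma primroot_generates: assumes "\<not> p dvd a" shows "\<exists>k. [primroot ^ k = a] (mod p)"
proof -
  have n: "\<not> p dvd a mod p" using assms by (simp add: dvd_mod_iff)
  then have "0 < a mod p" by (metis dvd_0_right neq0_conv)
  moreover have "a mod p \<le> p" using prime_gt_0_nat[OF prime_p] by (simp add: less_imp_le)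
  ultimately have "a mod p \<in> totatives p" using n coprime_p_iff by (simp add: totatives_def)
  then have "a mod p \<in> (\<lambda>i. primroot ^ i mod p) ` {..<totient p}"
    using residue_primroot_is_generator[OF prime_gt_1_nat[OF prime_p] primroot] by (simp add: bij_betw_def)
  then show ?thesis by (auto simp: cong_def)
qed

text \<open>A discrete logarithm, determined only modulo p - 1. This suffices because it serves as
  an exponent of (p - 1)-th roots of unity.\<close>

definition ind :: "nat \<Rightarrow> nat" where "ind a = (SOME k. [primroot ^ k = a] (mod p))"

lemma ind: "\<not> p dvd a \<Longrightarrow> [primroot ^ ind a = a] (mod p)" unfolding ind_def using primroot_generates by (rule someI_ex)

lemma root_of_unity_power_cong:
  assumes "z ^ (p - 1) = (1::complex)" "[i = j] (mod (p - 1))"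
  shows "z ^ i = z ^ j"
proof -
  have "z ^ i = z ^ (i mod (p - 1))" for i
    using assms(1) by (metis div_mod_decomp mult.commute power_add power_mult power_one mult_1)
  then show ?thesis using assms(2) by (metis cong_def)
qed

definition chr :: "complex \<Rightarrow> nat \<Rightarrow> complex" where
  "chr z a = (if p dvd a then 0 else z ^ ind a)"

definition chars :: "(nat \<Rightarrow> complex) set" where "chars = {chi. dirichlet_char p chi}"

lemma dirichlet_char_chr:
  assumes "z ^ (p - 1) = 1"
  shows "dirichlet_char p (chr z)" unfolding dirichlet_char_def
proof (intro conjI allI)
  have z0: "z \<noteq> 0" using assms p_gt_2 by (auto simp: power_0_left)
  show "chr z a \<noteq> 0 \<longleftrightarrow> coprime a p" for a using z0 by (simp add: chr_def coprime_p_iff)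
  show "chr z (a * b) = chr z a * chr z b" for a b
  proof (cases "p dvd a \<or> p dvd b")
    case True
    then show ?thesis by (auto simp: chr_def)
  next
    case False
    then have nab: "\<not> p dvd a * b" using prime_p by (simp add: prime_dvd_mult_iff)
    have "[primroot ^ ind a * primroot ^ ind b = a * b] (mod p)" using False ind by (intro cong_mult) auto
    then have "[primroot ^ ind (a * b) = primroot ^ (ind a + ind b)] (mod p)"
      using ind[OF nab] by (metis cong_sym cong_trans power_add)
    then have "z ^ ind (a * b) = z ^ (ind a + ind b)" using power_primroot_cong root_of_unity_power_cong[OF assms] by blast
    then show ?thesis using False nab by (simp add: chr_def power_add)
  qed
  show "chr z (a + p) = chr z a" for a
  proof -
    have "ind (a + p) = ind a" by (simp add: ind_def cong_def)
    then show ?thesis by (simp add: chr_def)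
  qed
qed

lemma chr_primroot: assumes "z ^ (p - 1) = 1" shows "chr z primroot = z"
proof -
  have n: "\<not> p dvd primroot" using coprime_primroot coprime_p_iff coprime_commute by blast
  have "[primroot ^ ind primroot = primroot ^ 1] (mod p)" using ind[OF n] by simp
  then have "z ^ ind primroot = z ^ 1" using power_primroot_cong root_of_unity_power_cong[OF assms] by blast
  then show ?thesis using n by (simp add: chr_def)
qed

text \<open>Characters are functions on the naturals; this extension to the integers admits negative
  arguments and the substitutions of the preceding sections.\<close>

definition chz :: "(nat \<Rightarrow> complex) \<Rightarrow> int \<Rightarrow> complex" where
  "chz chi x = chi (nat (x mod int p))"

lemma char_mod: assumes "chi \<in> chars" shows "chi (a mod p) = chi a"
proof -
  have per: "chi (b + p) = chi b" for b using assms by (simp add: chars_def dirichlet_char_def)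
  have "chi (b + k * p) = chi b" for b k
  proof (induction k)
    case (Suc k)
    then show ?case using per[of "b + k * p"] by (simp add: algebra_simps)
  qed simp
  from this[of "a mod p" "a div p"] show ?thesis by simp
qed

lemma per_chz: "per (chz chi)" unfolding per_def chz_def by (simp add: cong_def)

lemma chz_int: assumes "chi \<in> chars" shows "chz chi (int n) = chi n"
proof -
  have "nat (int n mod int p) = n mod p" by (metis nat_int zmod_int)
  then show ?thesis using char_mod[OF assms] by (simp add: chz_def)
qed

lemma chz_eq_0_iff: assumes "chi \<in> chars" shows "chz chi x = 0 \<longleftrightarrow> int p dvd x"
proof -
  have "chz chi x = 0 \<longleftrightarrow> p dvd nat (x mod int p)"
    using assms unfolding chz_def chars_def dirichlet_char_def coprime_p_iff by blast
  also have "\<dots> \<longleftrightarrow> int p dvd int (nat (x mod int p))" by (rule int_dvd_int_iff[symmetric])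
  also have "\<dots> \<longleftrightarrow> int p dvd x" using p_pos by (simp add: dvd_mod_iff)
  finally show ?thesis .
qed

lemma chz_mult: assumes "chi \<in> chars" shows "chz chi (x * y) = chz chi x * chz chi y"
proof -
  have "chz chi x * chz chi y = chi (nat (x mod int p) * nat (y mod int p))"
    using assms by (simp add: chz_def chars_def dirichlet_char_def)
  also have "\<dots> = chz chi (int (nat (x mod int p) * nat (y mod int p)))" by (rule chz_int[OF assms, symmetric])
  also have "\<dots> = chz chi (x * y)"
  proof -
    have "int (nat (x mod int p) * nat (y mod int p)) = (x mod int p) * (y mod int p)" using p_pos by simp
    moreover have "[(x mod int p) * (y mod int p) = x * y] (mod int p)" by (simp add: cong_def mod_mult_eq)
    ultimately show ?thesis using per_chz by (simp add: per_def)
  qed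
  finally show ?thesis by simp
qed

lemma chz_1: assumes "chi \<in> chars" shows "chz chi 1 = 1"
proof -
  have "chz chi 1 * chz chi 1 = chz chi 1 * 1" using chz_mult[OF assms, of 1 1] by simp
  moreover have "chz chi 1 \<noteq> 0" using chz_eq_0_iff[OF assms, of 1] p_gt_2 by simp
  ultimately show ?thesis using mult_left_cancel by blast
qed

lemma chz_power: assumes "chi \<in> chars" shows "chz chi (x ^ k) = chz chi x ^ k"
  by (induction k) (simp_all add: chz_1[OF assms] chz_mult[OF assms])

lemma chz_root_of_unity:
  assumes "chi \<in> chars" "\<not> int p dvd x"
  shows "chz chi x ^ (p - 1) = 1"
proof -
  have "chz chi (x ^ p) = chz chi x" using fermat_int[OF p_gt_2] per_chz by (simp add: per_def)
  then have "chz chi x ^ (p - 1) * chz chi x = 1 * chz chi x"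
    using power_minus_mult[of p "chz chi x"] p_gt_2 by (simp only: chz_power[OF assms(1)]) simp
  then show ?thesis using chz_eq_0_iff[OF assms(1), of x] assms(2) by simp
qed

lemma norm_chz: assumes "chi \<in> chars" "\<not> int p dvd x" shows "cmod (chz chi x) = 1"
  using power_eq_1_iff[OF chz_root_of_unity[OF assms]] p_gt_2 by simp

lemma norm_chz_le: assumes "chi \<in> chars" shows "cmod (chz chi x) \<le> 1"
  using norm_chz[OF assms, of x] chz_eq_0_iff[OF assms, of x] by fastforce

lemma chz_minv: assumes "chi \<in> chars" shows "chz chi (minv x) = cnj (chz chi x)"
proof (cases "int p dvd x")
  case True
  then show ?thesis using chz_eq_0_iff[OF assms] inv_dvd_iff by (metis complex_cnj_zero)
next
  case False
  have "chz chi x * chz chi (minv x) = 1"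
    using inv_cong[OF False] per_chz chz_mult[OF assms] chz_1[OF assms] by (metis per_def)
  moreover have "chz chi x * cnj (chz chi x) = 1"
    using norm_chz[OF assms False] by (simp add: complex_norm_square[symmetric])
  ultimately have "chz chi x * chz chi (minv x) = chz chi x * cnj (chz chi x)" by simp
  then show ?thesis using chz_eq_0_iff[OF assms] False by simp
qed

lemma char_eqI:
  assumes "chi \<in> chars" "chi' \<in> chars" "chi primroot = chi' primroot"
  shows "chi = chi'"
proof
  fix a
  have pw: "c (primroot ^ k) = c primroot ^ k" if "c \<in> chars" for c k
    using chz_power[OF that, of "int primroot" k] chz_int[OF that] by (metis of_nat_power)
  show "chi a = chi' a"
  proof (cases "p dvd a")
    case True
    then show ?thesis using assms by (metis (mono_tags, lifting) chars_def coprime_p_iff dirichlet_char_def mem_Collect_eq)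
  next
    case False
    then obtain k where "[primroot ^ k = a] (mod p)" using primroot_generates by blast
    then have eq: "c a = c primroot ^ k" if "c \<in> chars" for c using pw[OF that] char_mod[OF that] by (metis cong_def)
    show ?thesis by (simp only: eq[OF assms(1)] eq[OF assms(2)] assms(3))
  qed
qed

text \<open>A character is determined by its value at a primitive root, and \<open>chr\<close>
  realises every (p - 1)-th root of unity as such a value. Finiteness, the number of characters and
  orthogonality are all read off from this.\<close>

lemma bij_betw_chars: "bij_betw (\<lambda>chi. chi primroot) chars {z. z ^ (p - 1) = 1}" unfolding bij_betw_def
proof
  show "inj_on (\<lambda>chi. chi primroot) chars" by (intro inj_onI char_eqI)
  have n: "\<not> int p dvd int primroot" using coprime_primroot coprime_p_iff coprime_commute by auto
  show "(\<lambda>chi. chi primroot) ` chars = {z. z ^ (p - 1) = 1}"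
  proof (intro equalityI subsetI)
    fix z assume "z \<in> (\<lambda>chi. chi primroot) ` chars"
    then show "z \<in> {z. z ^ (p - 1) = 1}" using chz_root_of_unity[OF _ n] chz_int by auto
  next
    fix z :: complex assume z: "z \<in> {z. z ^ (p - 1) = 1}"
    then have "chr z \<in> chars" using dirichlet_char_chr by (simp add: chars_def)
    then show "z \<in> (\<lambda>chi. chi primroot) ` chars" using z by (intro image_eqI[of _ _ "chr z"]) (simp_all add: chr_primroot)
  qed
qed

lemma finite_chars: "finite chars"
proof -
  have "finite {z::complex. z ^ (p - 1) = 1}" using p_gt_2 by (intro finite_roots_unity) simp
  then show ?thesis using bij_betw_finite[OF bij_betw_chars] by simp
qed

lemma card_chars: "card chars = p - 1"
proof -
  have "card {z::complex. z ^ (p - 1) = 1} = p - 1" using p_gt_2 by (intro card_roots_unity_eq) simp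
  then show ?thesis using bij_betw_same_card[OF bij_betw_chars] by simp
qed

lemma sum_roots_of_unity_power:
  assumes "0 < m"
  shows "(\<Sum>z | z ^ m = 1. z ^ k) = (if m dvd k then of_nat m else (0::complex))"
proof (cases "m dvd k")
  case True
  then have "(\<Sum>z::complex | z ^ m = 1. z ^ k) = (\<Sum>z::complex | z ^ m = 1. 1)" by (auto intro!: sum.cong simp: power_mult)
  then show ?thesis using True card_roots_unity_eq[OF assms] by simp
next
  case False
  define w where "w = cis (2 * pi / m)"
  have wm: "w ^ m = 1" using assms by (simp add: w_def Complex.DeMoivre)
  have "w ^ k \<noteq> 1"
  proof
    assume "w ^ k = 1"
    then have "cis (2 * pi * k / m) = 1" by (simp add: w_def Complex.DeMoivre mult.commute)
    then have "cos (2 * pi * k / m) = 1" by (metis cis.simps(1) one_complex.simps(1))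
    then obtain i :: int where "2 * pi * k / m = of_int i * 2 * pi" using cos_one_2pi_int by blast
    then have "real k = of_int i * real m" using assms by (simp add: field_simps)
    then have "int k = i * int m" by (metis of_int_eq_iff of_int_mult of_int_of_nat_eq)
    then have "int m dvd int k" by simp
    then show False using False by simp
  qed
  have "(\<Sum>z::complex | z ^ m = 1. z ^ k) = (\<Sum>z::complex | z ^ m = 1. (w * z) ^ k)"
    by (rule sum.reindex_bij_witness[of _ "\<lambda>z. w * z" "\<lambda>z. z / w"])
       (use wm assms in \<open>auto simp: power_mult_distrib power_divide w_def\<close>)
  also have "\<dots> = w ^ k * (\<Sum>z | z ^ m = 1. z ^ k)" by (simp add: power_mult_distrib sum_distrib_left)
  finally have "(1 - w ^ k) * (\<Sum>z::complex | z ^ m = 1. z ^ k) = 0" by (simp add: algebra_simps)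
  then show ?thesis using False \<open>w ^ k \<noteq> 1\<close> by simp
qed

lemma sum_chars:
  assumes "\<not> int p dvd x"
  shows "(\<Sum>chi\<in>chars. chz chi x) = (if [x = 1] (mod int p) then of_nat (p - 1) else 0)"
proof -
  let ?a = "nat (x mod int p)"
  have a: "int ?a = x mod int p" using p_pos by simp
  then have "\<not> p dvd ?a" using assms by (metis dvd_mod_iff dvd_refl int_dvd_int_iff)
  then obtain k where k: "[primroot ^ k = ?a] (mod p)" using primroot_generates by blast
  then have "[int primroot ^ k = int ?a] (mod int p)" by (metis cong_int_iff of_nat_power)
  then have kx: "[int primroot ^ k = x] (mod int p)" unfolding a by simp
  have "(\<Sum>chi\<in>chars. chz chi x) = (\<Sum>chi\<in>chars. chi primroot ^ k)"
  proof (rule sum.cong[OF refl])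
    fix chi assume c: "chi \<in> chars"
    have "chz chi x = chz chi (int primroot ^ k)" using kx per_chz by (simp add: per_def)
    then show "chz chi x = chi primroot ^ k" using chz_power[OF c] chz_int[OF c] by simp
  qed
  also have "\<dots> = (\<Sum>z | z ^ (p - 1) = 1. z ^ k)" by (rule sum.reindex_bij_betw[OF bij_betw_chars])
  also have "\<dots> = (if (p - 1) dvd k then of_nat (p - 1) else 0)" using p_gt_2 by (intro sum_roots_of_unity_power) simp
  also have "(p - 1) dvd k \<longleftrightarrow> [x = 1] (mod int p)"
  proof -
    have "(p - 1) dvd k \<longleftrightarrow> [k = 0] (mod (p - 1))" by (simp add: cong_0_iff)
    also have "\<dots> \<longleftrightarrow> [primroot ^ k = primroot ^ 0] (mod p)" by (simp only: power_primroot_cong)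
    also have "\<dots> \<longleftrightarrow> [int primroot ^ k = 1] (mod int p)" by (metis cong_int_iff of_nat_1 of_nat_power power_0)
    also have "\<dots> \<longleftrightarrow> [x = 1] (mod int p)" using kx by (meson cong_sym cong_trans)
    finally show ?thesis .
  qed
  finally show ?thesis .
qed

lemma sum_chars_orthogonal:
  assumes "\<not> int p dvd x" "\<not> int p dvd y"
  shows "(\<Sum>chi\<in>chars. chz chi x * cnj (chz chi y)) = (if [x = y] (mod int p) then of_nat (p - 1) else 0)"
proof -
  have n: "\<not> int p dvd x * minv y" using assms by (simp add: dvd_mult_p inv_dvd_iff)
  have "(\<Sum>chi\<in>chars. chz chi x * cnj (chz chi y)) = (\<Sum>chi\<in>chars. chz chi (x * minv y))"
    by (intro sum.cong refl) (simp add: chz_mult chz_minv)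
  also have "\<dots> = (if [x * minv y = 1] (mod int p) then of_nat (p - 1) else 0)" by (rule sum_chars[OF n])
  also have "[x * minv y = 1] (mod int p) \<longleftrightarrow> [x = y] (mod int p)"
  proof
    assume "[x * minv y = 1] (mod int p)"
    then have "[x * minv y * y = 1 * y] (mod int p)" by (intro cong_mult cong_refl)
    moreover have "[x * (y * minv y) = x * 1] (mod int p)" using inv_cong[OF assms(2)] by (intro cong_mult cong_refl)
    ultimately show "[x = y] (mod int p)" by (metis cong_sym cong_trans mult.assoc mult.commute mult_1 mult_1_right)
  next
    assume "[x = y] (mod int p)"
    then have "[x * minv y = y * minv y] (mod int p)" by (intro cong_mult cong_refl)
    then show "[x * minv y = 1] (mod int p)" using inv_cong[OF assms(2)] by (rule cong_trans)
  qed
  finally show ?thesis .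
qed

lemma principal_in_chars: "principal_char p \<in> chars"
  by (auto simp: chars_def dirichlet_char_def principal_char_def coprime_p_iff prime_dvd_mult_iff[OF prime_p])

abbreviation chi0 :: "nat \<Rightarrow> complex" where "chi0 \<equiv> principal_char p"

lemma sum_chz:
  assumes "chi \<in> chars" "chi \<noteq> chi0"
  shows "(\<Sum>x\<in>Zp. chz chi x) = 0"
proof -
  obtain a where a: "chi a \<noteq> chi0 a" using assms(2) by blast
  have na: "\<not> p dvd a" using a assms(1) by (auto simp: principal_char_def coprime_p_iff chars_def dirichlet_char_def)
  then have "chz chi (int a) \<noteq> 1" using a chz_int[OF assms(1)] by (simp add: principal_char_def coprime_p_iff)
  moreover have "(\<Sum>x\<in>Zp. chz chi (int a * x + 0)) = (\<Sum>x\<in>Zp. chz chi x)" using na by (intro sum_affine[OF per_chz]) simp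
  then have "chz chi (int a) * (\<Sum>x\<in>Zp. chz chi x) = (\<Sum>x\<in>Zp. chz chi x)" by (simp add: chz_mult[OF assms(1)] sum_distrib_left)
  ultimately show ?thesis by simp
qed

end

section \<open>Gauss sums\<close>

lemma e_eq_cis: "e y = cis (2 * pi * y)"
  by (simp add: e_def cis_conv_exp mult_ac)

context prime_1_mod_4 begin

definition E :: "int \<Rightarrow> complex" where "E k = e (of_int k / of_nat p)"

lemma E_add: "E (a + b) = E a * E b"
  by (simp add: E_def e_eq_cis add_divide_distrib distrib_left flip: cis_mult)

lemma E_0: "E 0 = 1"
  by (simp add: E_def e_eq_cis)

lemma cnj_E: "cnj (E k) = E (- k)"
  by (simp add: E_def e_eq_cis cis_cnj)

lemma E_eq_1_iff: "E k = 1 \<longleftrightarrow> int p dvd k"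
proof
  assume "E k = 1"
  then have "cos (2 * pi * (of_int k / real p)) = 1"
    unfolding E_def e_eq_cis by (metis cis.simps(1) of_nat_eq_of_nat_power_cancel_iff of_real_of_nat_eq one_complex.simps(1))
  then obtain i :: int where "2 * pi * (of_int k / real p) = of_int i * 2 * pi" using cos_one_2pi_int by blast
  then have "real_of_int k = of_int i * real p" using p_pos by (simp add: field_simps)
  then have "k = i * int p" by (metis of_int_eq_iff of_int_mult of_int_of_nat_eq)
  then show "int p dvd k" by simp
next
  assume "int p dvd k"
  then obtain i where "k = int p * i" by blast
  then have "2 * pi * (of_int k / real p) = 2 * pi * of_int i" using p_pos by simp
  then show "E k = 1" unfolding E_def e_eq_cis by simp
qed

lemma per_E: "per E" unfolding per_def
proof (intro allI impI)
  fix x y assume "[x = y] (mod int p)"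
  then have "E (x - y) = 1" by (simp add: E_eq_1_iff cong_iff_dvd_diff)
  then show "E x = E y" using E_add[of "x - y" y] by simp
qed

lemma sum_E: "(\<Sum>x\<in>Zp. E (k * x)) = (if int p dvd k then of_nat p else 0)"
proof (cases "int p dvd k")
  case True
  then have "E (k * x) = 1" for x by (simp add: E_eq_1_iff)
  then show ?thesis using True by simp
next
  case False
  have "(\<Sum>x\<in>Zp. E (k * x)) = (\<Sum>x\<in>Zp. E (k * (x + 1)))"
    using sum_shift[OF per_comp[OF per_E], of "\<lambda>x. k * x" 1] by (simp add: cong_map_intros)
  also have "\<dots> = E k * (\<Sum>x\<in>Zp. E (k * x))" by (simp add: distrib_left E_add sum_distrib_left mult.commute)
  finally have "(1 - E k) * (\<Sum>x\<in>Zp. E (k * x)) = 0" by (simp add: algebra_simps)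
  then show ?thesis using False E_eq_1_iff by simp
qed

definition gs :: complex where "gs = (\<Sum>d\<in>Zp. of_int (lam d) * E d)"

lemma sum_E_square:
  "(\<Sum>y\<in>Zp. E (k * y^2)) = (if int p dvd k then of_nat p else of_int (lam k) * gs)"
proof (cases "int p dvd k")
  case True
  then have "E (k * y^2) = 1" for y by (simp add: E_eq_1_iff)
  then show ?thesis using True by simp
next
  case False
  have "(\<Sum>y\<in>Zp. E (k * y^2)) = (\<Sum>d\<in>Zp. of_int (1 + lam d) * E (k * d))"
    by (rule sum_square_of_int) (rule per_comp[OF per_E], intro cong_map_intros)
  also have "\<dots> = (\<Sum>d\<in>Zp. E (k * d)) + (\<Sum>d\<in>Zp. of_int (lam d) * E (k * d))" by (simp add: distrib_right sum.distrib)
  also have "(\<Sum>d\<in>Zp. of_int (lam d) * E (k * d)) = of_int (lam k) * (\<Sum>d\<in>Zp. of_int (lam (k * d + 0)) * E (k * d + 0))"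
    unfolding sum_distrib_left
  proof (rule sum.cong[OF refl])
    fix d
    have "lam d = lam k * lam (k * d + 0)" by (simp add: lam_mult mult.assoc[symmetric] lam_square[OF False])
    then show "of_int (lam d) * E (k * d) = of_int (lam k) * (of_int (lam (k * d + 0)) * E (k * d + 0))" by simp
  qed
  also have "(\<Sum>d\<in>Zp. of_int (lam (k * d + 0)) * E (k * d + 0)) = gs"
    unfolding gs_def using per_lam per_E by (intro sum_affine[OF _ False]) (auto simp: per_def)
  finally show ?thesis using False sum_E[of k] by simp
qed

text \<open>For a unit \<open>y\<close> the substitution x = y c turns F(x) times the conjugate of
  F(y) into F(c), so the square is again a character sum over \<open>c\<close>. It serves the
  Legendre symbol with H x = x and a character with H x = n x^2.\<close>

lemma abs_square_sum:
  assumes F: "per F" "\<And>x. int p dvd x \<Longrightarrow> F x = 0"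
    "\<And>x y. F (x * y) = F x * F y" "\<And>x. \<not> int p dvd x \<Longrightarrow> F x * cnj (F x) = 1" and H: "cong_map H"
  shows "(\<Sum>x\<in>Zp. F x * E (H x)) * cnj (\<Sum>x\<in>Zp. F x * E (H x)) = (\<Sum>c\<in>Zp. F c * (\<Sum>y\<in>Zp - {0}. E (H (y * c) - H y)))"
  (is "?L = ?R")
proof -
  let ?l = "\<lambda>y x. F x * cnj (F y) * E (H x - H y)" and ?r = "\<lambda>y c. F c * E (H (y * c) - H y)"
  have "?L = (\<Sum>y\<in>Zp. \<Sum>x\<in>Zp. ?l y x)" unfolding cnj_sum sum_product
    by (subst sum.swap) (simp add: cnj_E E_add[symmetric] mult_ac flip: diff_conv_add_uminus)
  also have "\<dots> = (\<Sum>y\<in>Zp - {0}. \<Sum>x\<in>Zp. ?l y x)" by (rule sum.mono_neutral_right) (auto simp: F(2))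
  also have "\<dots> = (\<Sum>y\<in>Zp - {0}. \<Sum>c\<in>Zp. ?r y c)"
  proof (rule sum.cong[OF refl])
    fix y assume "y \<in> Zp - {0}"
    then have ny: "\<not> int p dvd y" using Zp_dvd_iff by blast
    have "(\<Sum>x\<in>Zp. ?l y x) = (\<Sum>c\<in>Zp. ?l y (y * c + 0))"
    proof (rule sum_affine[OF _ ny, symmetric])
      show "per (?l y)" using F(1) per_comp[OF per_E, of "\<lambda>x. H x - H y"] H by (auto simp: per_def cong_map_intros)
    qed
    also have "\<dots> = (\<Sum>c\<in>Zp. ?r y c)"
    proof (rule sum.cong[OF refl])
      fix c
      have "F y * F c * cnj (F y) = F c * (F y * cnj (F y))" by (simp add: mult_ac)
      then show "?l y (y * c + 0) = ?r y c" using F(4)[OF ny] by (simp add: F(3))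
    qed
    finally show "(\<Sum>x\<in>Zp. ?l y x) = (\<Sum>c\<in>Zp. ?r y c)" .
  qed
  also have "\<dots> = ?R" by (subst sum.swap) (simp add: sum_distrib_left)
  finally show ?thesis .
qed

lemma sum_Zp_nonzero: "(\<Sum>y\<in>Zp - {0}. f y) = (\<Sum>y\<in>Zp. f y) - (f 0 :: complex)" using zero_Zp by (simp add: sum_diff1)

text \<open>Conjugation replaces d by -d in the exponential, and the Legendre symbol is even for p =
  1 mod 4.\<close>

lemma gs_real: "cnj gs = gs"
proof -
  have "cnj gs = (\<Sum>d\<in>Zp. of_int (lam (-1 * d + 0)) * E (-1 * d + 0))" by (simp add: gs_def cnj_E lam_minus)
  also have "\<dots> = gs" unfolding gs_def using per_lam per_E p_gt_2 by (intro sum_affine) (auto simp: per_def)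
  finally show ?thesis .
qed

lemma gs_square: "gs * gs = of_nat p"
proof -
  have "gs * cnj gs = (\<Sum>c\<in>Zp. of_int (lam c) * (\<Sum>y\<in>Zp - {0}. E (y * c - y)))" unfolding gs_def
  proof (rule abs_square_sum)
    show "per (\<lambda>x. complex_of_int (lam x))" using per_lam by (simp add: per_def)
    fix x assume "\<not> int p dvd x"
    from lam_square[OF this] show "complex_of_int (lam x) * cnj (complex_of_int (lam x)) = 1"
      by (metis complex_cnj_of_int of_int_1 of_int_mult)
  qed (simp_all add: lam_mult lam_eq_0_iff cong_map_intros)
  also have "\<dots> = (\<Sum>c\<in>Zp. of_int (lam c) * ((if c = 1 then of_nat p else 0) - 1))"
  proof (rule sum.cong[OF refl])
    fix c assume c: "c \<in> Zp"
    have "(\<Sum>y\<in>Zp - {0}. E (y * c - y)) = (\<Sum>y\<in>Zp. E ((c - 1) * y)) - 1"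
      unfolding sum_Zp_nonzero by (simp add: algebra_simps E_0)
    also have "int p dvd c - 1 \<longleftrightarrow> c = 1" using Zp_cong_eq[OF c zero_Zp(2)] by (simp add: cong_iff_dvd_diff)
    then have "(\<Sum>y\<in>Zp. E ((c - 1) * y)) = (if c = 1 then of_nat p else 0)" by (simp add: sum_E)
    finally show "of_int (lam c) * (\<Sum>y\<in>Zp - {0}. E (y * c - y)) = of_int (lam c) * ((if c = 1 then of_nat p else 0) - 1)"
      by simp
  qed
  also have "\<dots> = (\<Sum>c\<in>Zp. if c = 1 then of_int (lam c) * of_nat p else 0) - of_int (\<Sum>c\<in>Zp. lam c)"
    unfolding of_int_sum sum_subtractf[symmetric] by (intro sum.cong refl) (simp add: algebra_simps)
  also have "\<dots> = of_nat p" using zero_Zp lam_1 by (simp add: sum_lam)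
  finally show ?thesis using gs_real by simp
qed

abbreviation P :: real where "P \<equiv> real p"

definition dl :: "int \<Rightarrow> real" where "dl c = (if int p dvd c^2 - 1 then 1 else 0)"

abbreviation rf :: "int \<Rightarrow> real" where "rf c \<equiv> of_int (f2 c)"

text \<open>All dependence on \<open>n\<close> is confined to this sign: for \<open>n\<close> prime
  to \<open>p\<close>, \<open>tg n\<close> is g or -g and has square \<open>p\<close>.\<close>

definition tg :: "int \<Rightarrow> real" where "tg n = of_int (lam n) * Re gs"

definition vfun :: "int \<Rightarrow> int \<Rightarrow> real" where "vfun n c = P * dl c + tg n * rf c"

lemma gs_of_real: "gs = of_real (Re gs)" using gs_real by (metis Reals_cnj_iff of_real_Re)

lemma Re_gs_square: "Re gs * Re gs = P"
  using gs_square gs_of_real by (metis Re_complex_of_real of_real_mult of_real_of_nat_eq)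

text \<open>The coefficient of chi(c) is a quadratic Gauss sum with factor n (c^2 - 1): it is
  \<open>p\<close> if c^2 = 1, and otherwise g times the symbols of n and c^2 - 1. The excluded y =
  0 costs 1 for every \<open>c\<close>, which cancels on summation against a non-principal
  character.\<close>

lemma gauss_sum_square:
  assumes "chi \<in> chars" "chi \<noteq> chi0" "\<not> int p dvd n"
  shows "of_real ((cmod (gauss_sum2 n chi p))^2) = (\<Sum>c\<in>Zp. chz chi c * of_real (vfun n c))"
proof -
  have "gauss_sum2 n chi p = (\<Sum>x\<in>Zp. chz chi x * E (n * x^2))"
  proof -
    have chi_p: "chi p = 0" using chz_eq_0_iff[OF assms(1), of "int p"] chz_int[OF assms(1), of p] by simp
    have chi_0: "chi 0 = 0" using chz_eq_0_iff[OF assms(1), of "int 0"] chz_int[OF assms(1), of 0] by simp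
    have "gauss_sum2 n chi p = (\<Sum>a=1..p. chz chi (int a) * E (n * (int a)^2))"
      unfolding gauss_sum2_def E_def using chz_int[OF assms(1)] by simp
    also have "\<dots> = (\<Sum>a\<in>{0..<p}. chz chi (int a) * E (n * (int a)^2))"
      by (rule sum.mono_neutral_cong) (use chi_p chi_0 chz_int[OF assms(1)] in \<open>auto simp: not_le\<close>)
    also have "\<dots> = (\<Sum>x\<in>int ` {0..<p}. chz chi x * E (n * x^2))" by (subst sum.reindex) (simp_all add: inj_on_def)
    also have "int ` {0..<p} = Zp" by (simp add: image_int_atLeastLessThan)
    finally show ?thesis .
  qed
  then have "of_real ((cmod (gauss_sum2 n chi p))^2) =
      (\<Sum>x\<in>Zp. chz chi x * E (n * x^2)) * cnj (\<Sum>x\<in>Zp. chz chi x * E (n * x^2))" by (simp only: complex_norm_square)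
  also have "\<dots> = (\<Sum>c\<in>Zp. chz chi c * (\<Sum>y\<in>Zp - {0}. E (n * (y * c)^2 - n * y^2)))"
  proof (rule abs_square_sum)
    show "chz chi x * cnj (chz chi x) = 1" if "\<not> int p dvd x" for x
      using norm_chz[OF assms(1) that] by (simp add: complex_norm_square[symmetric])
  qed (simp_all add: per_chz chz_mult[OF assms(1)] chz_eq_0_iff[OF assms(1)] cong_map_intros)
  also have "\<dots> = (\<Sum>c\<in>Zp. chz chi c * of_real (vfun n c) - chz chi c)"
  proof (rule sum.cong[OF refl])
    fix c assume "c \<in> Zp"
    show "chz chi c * (\<Sum>y\<in>Zp - {0}. E (n * (y * c)^2 - n * y^2)) = chz chi c * of_real (vfun n c) - chz chi c"
    proof (cases "int p dvd c")
      case True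
      then have "chz chi c = 0" using chz_eq_0_iff[OF assms(1), of c] by blast
      then show ?thesis by (simp only: mult_zero_left diff_zero)
    next
      case False
      have "(\<Sum>y\<in>Zp - {0}. E (n * (y * c)^2 - n * y^2)) = (\<Sum>y\<in>Zp. E ((n * (c^2 - 1)) * y^2)) - 1"
        unfolding sum_Zp_nonzero by (simp add: algebra_simps power_mult_distrib E_0)
      also have "(\<Sum>y\<in>Zp. E ((n * (c^2 - 1)) * y^2)) = of_real (vfun n c)"
        unfolding sum_E_square vfun_def dl_def tg_def dvd_mult_p
        using assms(3) f2_eq[OF False] gs_of_real lam_eq_0_iff[of "c^2 - 1"] by (simp add: lam_mult)
      finally have eq: "(\<Sum>y\<in>Zp - {0}. E (n * (y * c)^2 - n * y^2)) = of_real (vfun n c) - 1" .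
      show ?thesis unfolding eq by (simp add: right_diff_distrib)
    qed
  qed
  also have "\<dots> = (\<Sum>c\<in>Zp. chz chi c * of_real (vfun n c))" using sum_chz[OF assms(1,2)] by (simp add: sum_subtractf)
  finally show ?thesis .
qed

lemma char_sum_mult:
  assumes "chi \<in> chars" "\<And>a. int p dvd a \<Longrightarrow> F a = 0" "per G"
  shows "(\<Sum>a\<in>Zp. chz chi a * of_int (F a)) * (\<Sum>a\<in>Zp. chz chi a * of_int (G a)) = (\<Sum>d\<in>Zp. chz chi d * of_int (zconv F G d))"
  (is "?L = ?R")
proof -
  let ?l = "\<lambda>a b. chz chi (a * b) * complex_of_int (F a * G b)"
    and ?r = "\<lambda>a d. chz chi d * complex_of_int (F a * G (d * minv a))"
  have "?L = (\<Sum>a\<in>Zp. \<Sum>b\<in>Zp. ?l a b)" unfolding sum_product by (simp add: chz_mult[OF assms(1)] mult_ac)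
  also have "\<dots> = (\<Sum>a\<in>Zp. \<Sum>d\<in>Zp. ?r a d)"
  proof (rule sum.cong[OF refl])
    fix a
    show "(\<Sum>b\<in>Zp. ?l a b) = (\<Sum>d\<in>Zp. ?r a d)"
    proof (cases "int p dvd a")
      case True
      then show ?thesis using assms(2) by simp
    next
      case False
      then have n: "\<not> int p dvd minv a" by (simp add: inv_dvd_iff)
      have "(\<Sum>b\<in>Zp. ?l a b) = (\<Sum>d\<in>Zp. ?l a (minv a * d + 0))"
      proof (rule sum_affine[OF _ n, symmetric])
        show "per (?l a)" using per_comp[OF per_chz, of "\<lambda>b. a * b" chi] assms(3) by (simp add: per_def cong_map_intros)
      qed
      also have "\<dots> = (\<Sum>d\<in>Zp. ?r a d)"
      proof (rule sum.cong[OF refl])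
        fix d
        have "[a * (minv a * d + 0) = 1 * d] (mod int p)"
          using cong_mult[OF inv_cong[OF False] cong_refl[of d]] by (simp add: mult.assoc)
        then show "?l a (minv a * d + 0) = ?r a d" using per_chz by (simp add: per_def mult.commute)
      qed
      finally show ?thesis .
    qed
  qed
  also have "\<dots> = ?R" by (subst sum.swap) (simp add: zconv_def sum_distrib_left)
  finally show ?thesis .
qed

section \<open>The third convolution power\<close>


lemma per_dl: "per dl"
proof -
  have "per (\<lambda>c. if int p dvd c then 1 else (0::real))" using cong_dvd_iff by (auto simp: per_def)
  then show ?thesis unfolding dl_def by (rule per_comp) (intro cong_map_intros)
qed

lemma per_rf: "per rf" using per_f2 by (simp add: per_def)

lemma rf_minus: "rf (- x) = rf x" "dl (- x) = dl x"
  by (simp_all add: f2_def dl_def)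

lemma sum_dl:
  assumes "chi \<in> chars"
  shows "(\<Sum>a\<in>Zp. chz chi a * of_real (dl a)) = 1 + chz chi (- 1)"
proof -
  have "(\<Sum>a\<in>Zp. chz chi a * of_real (dl a)) = (\<Sum>a\<in>{1, int p - 1}. chz chi a * of_real (dl a))"
  proof (rule sum.mono_neutral_right)
    show "\<forall>a\<in>Zp - {1, int p - 1}. chz chi a * of_real (dl a) = 0"
    proof
      fix a assume a: "a \<in> Zp - {1, int p - 1}"
      then have "\<not> int p dvd a^2 - 1" using square_eq_1_Zp[of a] by simp
      then show "chz chi a * of_real (dl a) = 0" by (simp add: dl_def)
    qed
  qed (use p_gt_2 in auto)
  also have "\<dots> = chz chi 1 * of_real (dl 1) + chz chi (int p - 1) * of_real (dl (int p - 1))" using p_gt_2 by simp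
  also have "dl 1 = 1" by (simp add: dl_def)
  also have "dl (int p - 1) = 1" using square_eq_1_Zp[of "int p - 1"] p_gt_2 by (simp add: dl_def)
  also have "chz chi (int p - 1) = chz chi (- 1)" using per_chz by (simp add: per_def cong_iff_dvd_diff)
  finally show ?thesis by (simp add: chz_1[OF assms])
qed

text \<open>\<open>dl\<close> sums to 1 + chi(-1), and multiplication by chi(-1) fixes the character
  sum of an even function. For odd characters both sides are 0, so no case distinction by parity
  arises.\<close>

lemma sum_dl_mult:
  assumes "chi \<in> chars" "per G" "\<And>x. G (- x) = G x"
  shows "(\<Sum>a\<in>Zp. chz chi a * of_real (dl a)) * (\<Sum>a\<in>Zp. chz chi a * of_real (G a)) = 2 * (\<Sum>a\<in>Zp. chz chi a * of_real (G a))"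
proof -
  have "chz chi (- 1) * (\<Sum>a\<in>Zp. chz chi a * of_real (G a)) = (\<Sum>a\<in>Zp. chz chi (-1 * a + 0) * of_real (G (-1 * a + 0)))"
    unfolding sum_distrib_left
  proof (rule sum.cong[OF refl])
    fix a
    have "chz chi (-1 * a + 0) = chz chi (- 1) * chz chi a" using chz_mult[OF assms(1), of "-1" a] by simp
    moreover have "G (-1 * a + 0) = G a" by (simp add: assms(3))
    ultimately show "chz chi (- 1) * (chz chi a * of_real (G a)) = chz chi (-1 * a + 0) * of_real (G (-1 * a + 0))"
      by (simp only: mult.assoc)
  qed
  also have "\<dots> = (\<Sum>a\<in>Zp. chz chi a * of_real (G a))"
    using per_chz[of chi] assms(2) p_gt_2 by (intro sum_affine) (auto simp: per_def)
  finally show ?thesis unfolding sum_dl[OF assms(1)] by (simp add: distrib_right)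
qed

lemma tg_square:
  assumes "\<not> int p dvd n"
  shows "tg n * tg n = P"
proof -
  have "tg n * tg n = of_int (lam n * lam n) * (Re gs * Re gs)" by (simp add: tg_def)
  then show ?thesis using Re_gs_square lam_square[OF assms] by simp
qed

definition Vfun :: "int \<Rightarrow> int \<Rightarrow> real" where
  "Vfun n d = 4 * P^3 * dl d + 12 * P^2 * tg n * rf d
    + 6 * P^2 * of_int (zconv f2 f2 d) + P * tg n * of_int (zconv f2 (zconv f2 f2) d)"

lemma per_zconv:
  assumes "per G"
  shows "per (zconv F G)"
proof -
  have "G (x * minv a) = G (y * minv a)" if "[x = y] (mod int p)" for x y a
    using assms cong_mult[OF that cong_refl[of "minv a"]] by (simp add: per_def)
  then show ?thesis by (simp add: per_def zconv_def)
qed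

lemma per_Vfun: "per (Vfun n)" using per_dl per_f2 per_zconv[OF per_f2, of f2] per_zconv[OF per_zconv[OF per_f2], of f2 f2]
  by (simp add: per_def Vfun_def)

definition Wsum :: "int \<Rightarrow> (nat \<Rightarrow> complex) \<Rightarrow> complex" where
  "Wsum n chi = (\<Sum>d\<in>Zp. chz chi d * of_real (Vfun n d))"

lemma gauss_sum_sixth_power:
  assumes "chi \<in> chars" "chi \<noteq> chi0" "\<not> int p dvd n"
  shows "of_real ((cmod (gauss_sum2 n chi p))^6) = Wsum n chi"
proof -
  define S where "S = (\<lambda>G. \<Sum>d\<in>Zp. chz chi d * complex_of_real (G d))"
  define g where "g = complex_of_real (tg n)"
  let ?P = "complex_of_real P" and ?D = "S dl" and ?R = "S rf"
  have gg: "g * g = ?P" unfolding g_def of_real_mult[symmetric] tg_square[OF assms(3)] ..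
  have DD: "?D * ?D = 2 * ?D" and DR: "?D * ?R = 2 * ?R"
    unfolding S_def using sum_dl_mult[OF assms(1) per_dl] sum_dl_mult[OF assms(1) per_rf] by (simp_all add: rf_minus)
  have RR: "?R * S (\<lambda>d. of_int (G d)) = S (\<lambda>d. of_int (zconv f2 G d))" if "per G" for G
    unfolding S_def of_real_of_int_eq by (rule char_sum_mult[OF assms(1) f2_0 that])
  have "complex_of_real ((cmod (gauss_sum2 n chi p))^6) = (of_real ((cmod (gauss_sum2 n chi p))^2))^3"
    by (simp flip: power_mult)
  also have "of_real ((cmod (gauss_sum2 n chi p))^2) = ?P * ?D + g * ?R"
    unfolding gauss_sum_square[OF assms] vfun_def S_def g_def sum_distrib_left sum.distrib[symmetric]
    by (intro sum.cong refl) (simp add: algebra_simps)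
  also have "(?P * ?D + g * ?R)^3 = ?P^3 * (?D * ?D * ?D) + 3 * ?P^2 * g * (?D * ?D * ?R)
      + 3 * ?P * (g * g) * (?D * ?R * ?R) + g * (g * g) * (?R * (?R * ?R))"
    by (simp add: power2_eq_square power3_eq_cube algebra_simps)
  \<comment> \<open>The relations D D = 2 D, D R = 2 R and g g = P give the coefficients 4 = 2 * 2,
    12 = 3 * 2 * 2 and 6 = 3 * 2.\<close>
  also have "\<dots> = 4 * ?P^3 * ?D + 12 * ?P^2 * g * ?R + 6 * ?P^2 * (?R * ?R) + ?P * g * (?R * (?R * ?R))"
    by (simp add: DD DR gg mult.assoc power2_eq_square)
  also have "\<dots> = Wsum n chi" unfolding RR[OF per_f2] RR[OF per_zconv[OF per_f2]]
    unfolding S_def g_def Wsum_def Vfun_def sum_distrib_left sum.distrib[symmetric]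
    by (intro sum.cong refl) (simp add: algebra_simps)
  finally show ?thesis .
qed

text \<open>If d^2 = 1, then \<open>dl\<close> contributes 4 p^3, \<open>zconv f2 f2\<close>
  contributes 6 p^2 * p, and \<open>f2 d = 0\<close>: this is the origin of the 10. Elsewhere the
  terms are bounded by p^2 sqrt p with factors 12, 6 * 16 and 211, in total 319.\<close>

lemma Vfun_bound:
  assumes "\<not> int p dvd n" "\<not> int p dvd d"
  shows "\<bar>Vfun n d - 10 * P^3 * dl d\<bar> \<le> 400 * P^2 * sqrt p"
proof -
  let ?g = "tg n"
  have g: "\<bar>?g\<bar> = sqrt p" using tg_square[OF assms(1)] by (metis real_sqrt_abs2)
  have p1: "1 \<le> sqrt p" using p_gt_2 by simp
  have h3: "\<bar>P * ?g * of_int (zconv f2 (zconv f2 f2) d)\<bar> \<le> 211 * (P^2 * sqrt p)"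
  proof -
    have "real_of_int \<bar>zconv f2 (zconv f2 f2) d\<bar> \<le> real_of_int (211 * int p)"
      using zconv_f2_f2_f2[OF assms(2)] by (simp only: of_int_le_iff)
    then have "P * sqrt p * real_of_int \<bar>zconv f2 (zconv f2 f2) d\<bar> \<le> P * sqrt p * (211 * P)" by (intro mult_left_mono) auto
    then show ?thesis by (simp add: abs_mult g power2_eq_square mult_ac)
  qed
  have pp: "P^2 \<le> P^2 * sqrt p" using p1 mult_left_mono[of 1 "sqrt p" "P^2"] by simp
  show ?thesis
  proof (cases "int p dvd d^2 - 1")
    case True
    then have "f2 d = 0" "dl d = 1" by (simp_all add: f2_def lam_eq_0_iff dl_def)
    have "\<bar>real_of_int (zconv f2 f2 d) - P\<bar> \<le> 3" using zconv_f2_diagonal[OF True] by linarith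
    then have "6 * P^2 * \<bar>real_of_int (zconv f2 f2 d) - P\<bar> \<le> 6 * P^2 * 3" by (intro mult_left_mono) auto
    then have "\<bar>6 * P^2 * (real_of_int (zconv f2 f2 d) - P)\<bar> \<le> 18 * P^2" by (simp add: abs_mult)
    moreover have "Vfun n d - 10 * P^3 * dl d = 6 * P^2 * (real_of_int (zconv f2 f2 d) - P)
       + P * ?g * of_int (zconv f2 (zconv f2 f2) d)"
      unfolding Vfun_def \<open>f2 d = 0\<close> \<open>dl d = 1\<close> by (simp add: power2_eq_square power3_eq_cube algebra_simps)
    ultimately show ?thesis using h3 pp by linarith
  next
    case False
    then have dl: "dl d = 0" by (simp add: dl_def)
    have "P^2 * \<bar>real_of_int (zconv f2 f2 d)\<bar> \<le> P^2 * (16 * sqrt p)"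
      using zconv_f2_off_diagonal[OF assms(2) False] by (intro mult_left_mono) auto
    then have h2: "\<bar>6 * P^2 * of_int (zconv f2 f2 d)\<bar> \<le> 96 * (P^2 * sqrt p)" by (simp add: abs_mult mult_ac)
    have "\<bar>rf d\<bar> \<le> 1" unfolding f2_def using lam_values[of "d^2 * (d^2 - 1)"] by auto
    then have "(P^2 * sqrt p) * \<bar>rf d\<bar> \<le> (P^2 * sqrt p) * 1" by (intro mult_left_mono) auto
    then have h1: "\<bar>12 * P^2 * ?g * rf d\<bar> \<le> 12 * (P^2 * sqrt p)" by (simp add: abs_mult g mult_ac)
    have "0 \<le> P^2 * sqrt p" by simp
    then show ?thesis using h1 h2 h3 unfolding Vfun_def dl by linarith
  qed
qed

end

section \<open>Dirichlet coefficients of the square root of an Euler product\<close>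

text \<open>The power series coefficients of (1 - x)^(-1/2), whose squares appear in the Euler
  factors of \<open>C_const\<close>.\<close>

definition cbin :: "nat \<Rightarrow> real" where "cbin m = real ((2 * m) choose m) / 4 ^ m"

lemma cbin_gbinomial: "cbin m = (- 1) ^ m * ((- 1 / 2) gchoose m)"
proof -
  have "real ((2 * m) choose m) = fact (2 * m) / (fact m * fact (2 * m - m))" by (rule binomial_fact) simp
  also have "\<dots> = 4 ^ m * pochhammer (1 / 2) m / fact m" by (simp add: fact_double power_mult)
  finally show ?thesis by (simp add: cbin_def gbinomial_pochhammer flip: power_mult_distrib)
qed

text \<open>The square of (1 - x)^(-1/2) is the geometric series; on coefficients this is
  Vandermonde's identity with -1/2 + -1/2 = -1.\<close>

lemma cbin_convolution: "(\<Sum>k\<le>m. cbin k * cbin (m - k)) = 1"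
proof -
  have "(\<Sum>k\<le>m. cbin k * cbin (m - k)) = (\<Sum>k\<in>{0..m}. (- 1) ^ m * (((- 1 / 2) gchoose k) * ((- 1 / 2) gchoose (m - k))))"
  proof (intro sum.cong)
    fix k assume "k \<in> {0..m}"
    then have "(- 1 :: real) ^ m = (- 1) ^ k * (- 1) ^ (m - k)" by (simp flip: power_add)
    then show "cbin k * cbin (m - k) = (- 1) ^ m * (((- 1 / 2) gchoose k) * ((- 1 / 2) gchoose (m - k)))"
      by (simp add: cbin_gbinomial)
  qed auto
  also have "\<dots> = (- 1) ^ m * ((- 1 / 2 + - 1 / 2) gchoose m)"
    by (simp only: sum_distrib_left[symmetric] gbinomial_Vandermonde)
  also have "\<dots> = 1" by (simp add: gbinomial_pochhammer pochhammer_fact[symmetric] flip: power_mult_distrib)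
  finally show ?thesis .
qed

lemma cbin_0: "cbin 0 = 1"
  by (simp add: cbin_def)

lemma cbin_nonneg: "0 \<le> cbin m"
  by (simp add: cbin_def)

lemma cbin_le_1: "cbin m \<le> 1"
proof -
  have "cbin 0 * cbin (m - 0) \<le> (\<Sum>k\<le>m. cbin k * cbin (m - k))"
    by (rule member_le_sum) (auto intro: mult_nonneg_nonneg cbin_nonneg)
  then show ?thesis by (simp add: cbin_convolution cbin_0)
qed

text \<open>The Dirichlet coefficients of $\zeta(s)^{1/2}$ (with the irrelevant value \<open>rr 0 = 1\<close>).\<close>
definition rr :: "nat \<Rightarrow> real" where
  "rr n = (\<Prod>q\<in>prime_factors n. cbin (multiplicity q n))"

lemma rr_1: "rr (Suc 0) = 1"
  by (simp add: rr_def)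

lemma rr_nonneg: "0 \<le> rr n" unfolding rr_def by (intro prod_nonneg cbin_nonneg)

lemma rr_le_1: "rr n \<le> 1" unfolding rr_def by (intro prod_le_1 conjI cbin_nonneg cbin_le_1)

lemma multiplicity_prime_power_mult:
  fixes q d :: nat
  assumes "prime q" "\<not> q dvd d"
  shows "multiplicity q (q ^ k * d) = k"
proof -
  have "d \<noteq> 0" using assms(2) by (metis dvd_0_right)
  then have "multiplicity q (q ^ k * d) = multiplicity q (q ^ k) + multiplicity q d"
    using assms(1) by (intro prime_elem_multiplicity_mult_distrib) auto
  then show ?thesis using assms prime_gt_1_nat[of q] by (simp add: not_dvd_imp_multiplicity_0 multiplicity_same_power)
qed

lemma rr_prime_power_mult:
  assumes "prime q" "\<not> q dvd d"
  shows "rr (q ^ k * d) = cbin k * rr d"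
proof (cases "k = 0")
  case True
  then show ?thesis by (simp add: cbin_0)
next
  case False
  have d0: "d \<noteq> 0" using assms(2) by (metis dvd_0_right)
  have q0: "q ^ k \<noteq> 0" using assms(1) by (simp add: prime_gt_0_nat)
  have pf: "prime_factors (q ^ k * d) = insert q (prime_factors d)"
    using d0 q0 assms(1) False by (simp add: prime_factorization_mult prime_factorization_prime_power)
  have nq: "q \<notin> prime_factors d" using assms(2) by auto
  have other: "multiplicity q' (q ^ k * d) = multiplicity q' d" if "q' \<in> prime_factors d" for q'
  proof -
    have "prime q'" "q' \<noteq> q" using that nq by auto
    then have "multiplicity q' (q ^ k) = 0"
      using assms(1) by (simp add: prime_elem_multiplicity_power_distrib prime_multiplicity_other)
    then show ?thesis using \<open>prime q'\<close> d0 q0 by (subst prime_elem_multiplicity_mult_distrib) auto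
  qed
  have "rr (q ^ k * d) = cbin (multiplicity q (q ^ k * d)) * (\<Prod>q'\<in>prime_factors d. cbin (multiplicity q' (q ^ k * d)))"
    unfolding rr_def pf using nq by simp
  then show ?thesis using multiplicity_prime_power_mult[OF assms] other by (simp add: rr_def)
qed

lemma prime_power_mult_eq_iff:
  fixes q a b :: nat
  assumes "prime q" "\<not> q dvd a" "\<not> q dvd b"
  shows "q ^ i * a = q ^ j * b \<longleftrightarrow> i = j \<and> a = b"
  using multiplicity_prime_power_mult[OF assms(1,2), of i] multiplicity_prime_power_mult[OF assms(1,3), of j]
    prime_gt_0_nat[OF assms(1)] by auto

lemma prime_power_decompose:
  fixes q n :: nat
  assumes "prime q" "n > 0"
  obtains k d where "n = q ^ k * d" "\<not> q dvd d"
  using multiplicity_decompose'[of n q] assms by (metis not_prime_unit neq0_conv)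

text \<open>One prime q is removed at a time: a factorization of q^m n' is a splitting k + (m - k)
  of the exponent together with a factorization of n'. The sum is then a \<open>cbin\<close>
  convolution times the sum for n'.\<close>

lemma rr_dirichlet_square:
  assumes "n > 0"
  shows "(\<Sum>(a, b)\<in>{(a, b). a * b = n}. rr a * rr b) = 1" using assms
proof (induction n rule: less_induct)
  case (less n)
  show ?case
  proof (cases "n = 1")
    case True
    then have "{(a, b). a * b = n} = {(1, 1)}" by auto
    then show ?thesis by (simp add: rr_1)
  next
    case False
    then obtain q where q: "prime q" "q dvd n" using prime_factor_nat by blast
    obtain m n' where n: "n = q ^ m * n'" "\<not> q dvd n'" using prime_power_decompose q less.prems by blast
    have m0: "m > 0" using n q by (cases m) auto
    have n'0: "n' > 0" using n by (cases n') auto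
    have "1 < q ^ m" using m0 prime_gt_1_nat[OF q(1)] by (intro one_less_power)
    then have "n' < n" unfolding n using n'0 by simp
    then have IH: "(\<Sum>(a, b)\<in>{(a, b). a * b = n'}. rr a * rr b) = 1" using n'0 by (rule less.IH)
    let ?D = "{(a, b). a * b = n'}" and ?t = "\<lambda>(a, b). rr a * rr b"
      and ?c = "\<lambda>k. cbin k * cbin (m - k)"
    let ?g = "\<lambda>(k, a, b). (q ^ k * a, q ^ (m - k) * b)"
    have nd: "\<not> q dvd a" "\<not> q dvd b" if "a * b = n'" for a b using that n(2) by auto
    have "bij_betw ?g ({..m} \<times> ?D) {(a, b). a * b = n}" unfolding bij_betw_def
    proof
      show "inj_on ?g ({..m} \<times> ?D)" using nd by (auto simp: inj_on_def prime_power_mult_eq_iff[OF q(1)])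
      show "?g ` ({..m} \<times> ?D) = {(a, b). a * b = n}"
      proof (intro equalityI subsetI)
        fix x assume "x \<in> ?g ` ({..m} \<times> ?D)"
        then obtain k a b where x: "x = (q ^ k * a, q ^ (m - k) * b)" "k \<le> m" "a * b = n'" by auto
        have "q ^ k * a * (q ^ (m - k) * b) = (q ^ k * q ^ (m - k)) * (a * b)" by simp
        also have "\<dots> = n" using x n by (simp flip: power_add)
        finally show "x \<in> {(a, b). a * b = n}" using x by simp
      next
        fix x assume "x \<in> {(a, b). a * b = n}"
        then obtain a b where x: "x = (a, b)" "a * b = n" by auto
        then have "a > 0" "b > 0" using less.prems by auto
        then obtain i a' j b' where ab: "a = q ^ i * a'" "\<not> q dvd a'" "b = q ^ j * b'" "\<not> q dvd b'"
          using prime_power_decompose[OF q(1)] by metis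
        have "q ^ (i + j) * (a' * b') = q ^ m * n'" using x(2) ab n by (simp add: power_add mult_ac)
        moreover have "\<not> q dvd a' * b'" using ab q(1) by (simp add: prime_dvd_mult_iff)
        ultimately have "i + j = m" "a' * b' = n'" using prime_power_mult_eq_iff[OF q(1)] n(2) by blast+
        then show "x \<in> ?g ` ({..m} \<times> ?D)" using x ab by (intro image_eqI[of _ _ "(i, a', b')"]) auto
      qed
    qed
    then have "(\<Sum>(a, b)\<in>{(a, b). a * b = n}. rr a * rr b) = (\<Sum>x\<in>{..m} \<times> ?D. ?t (?g x))"
      by (rule sum.reindex_bij_betw[symmetric])
    also have "\<dots> = (\<Sum>(k, x)\<in>{..m} \<times> ?D. ?c k * ?t x)"
    proof (rule sum.cong[OF refl])
      fix x assume "x \<in> {..m} \<times> ?D"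
      then obtain k a b where x: "x = (k, a, b)" "a * b = n'" by auto
      show "?t (?g x) = (\<lambda>(k, x). ?c k * ?t x) x"
        using rr_prime_power_mult[OF q(1) nd(1)[OF x(2)]] rr_prime_power_mult[OF q(1) nd(2)[OF x(2)]] by (simp add: x(1))
    qed
    also have "\<dots> = (\<Sum>k\<le>m. \<Sum>x\<in>?D. ?c k * ?t x)" by (simp add: sum.cartesian_product split_def)
    also have "\<dots> = (\<Sum>k\<le>m. ?c k * (\<Sum>x\<in>?D. ?t x))" by (simp add: sum_distrib_left split_def)
    also have "\<dots> = 1" unfolding IH by (simp add: cbin_convolution)
    finally show ?thesis .
  qed
qed

text \<open>The Dirichlet coefficients of the square of the truncation of zeta(s)^(1/2) to indices
  below \<open>N\<close>. They equal the coefficients 1 of zeta(s) below \<open>N\<close> and stay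
  in [0,1] beyond.\<close>

definition r2 :: "nat \<Rightarrow> nat \<Rightarrow> real" where
  "r2 N k = (\<Sum>(a, b)\<in>{(a, b). a \<in> {0<..<N} \<and> b \<in> {0<..<N} \<and> a * b = k}. rr a * rr b)"

lemma finite_factorizations: "k > 0 \<Longrightarrow> finite {(a, b). a * b = (k::nat)}"
  by (rule finite_subset[of _ "{..k} \<times> {..k}"]) auto

lemma r2_nonneg: "0 \<le> r2 N k" unfolding r2_def by (intro sum_nonneg) (auto intro: mult_nonneg_nonneg rr_nonneg)

lemma r2_le_1: assumes "k > 0" shows "r2 N k \<le> 1"
proof -
  have "r2 N k \<le> (\<Sum>(a, b)\<in>{(a, b). a * b = k}. rr a * rr b)" unfolding r2_def using finite_factorizations[OF assms]
    by (intro sum_mono2) (auto intro: mult_nonneg_nonneg rr_nonneg)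
  then show ?thesis using rr_dirichlet_square[OF assms] by simp
qed

lemma r2_eq_1: assumes "0 < k" "k < N" shows "r2 N k = 1"
proof -
  have "a \<in> {0<..<N} \<and> b \<in> {0<..<N}" if "a * b = k" for a b
  proof -
    have "a > 0" "b > 0" using that assms(1) by auto
    then have "a \<le> k" "b \<le> k" using that by auto
    then show ?thesis using \<open>a > 0\<close> \<open>b > 0\<close> assms(2) by auto
  qed
  then have "{(a, b). a \<in> {0<..<N} \<and> b \<in> {0<..<N} \<and> a * b = k} = {(a, b). a * b = k}" by auto
  then show ?thesis using rr_dirichlet_square[OF assms(1)] by (simp add: r2_def)
qed

lemma square_of_truncation:
  fixes f :: "nat \<Rightarrow> 'a :: {comm_ring_1, real_algebra_1}"
  assumes "\<And>a b. f (a * b) = f a * f b"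
  shows "(\<Sum>a\<in>{0<..<N}. of_real (rr a) * f a)^2 = (\<Sum>k\<in>{0<..<N^2}. of_real (r2 N k) * f k)"
proof -
  let ?I = "{0<..<N}" and ?m = "\<lambda>(a, b). a * b :: nat" and ?t = "\<lambda>(a, b). of_real (rr a * rr b) * f (a * b)"
  have sub: "?m ` (?I \<times> ?I) \<subseteq> {0<..<N^2}" by (auto simp: power2_eq_square intro!: mult_strict_mono)
  have "(\<Sum>a\<in>?I. of_real (rr a) * f a)^2 = (\<Sum>x\<in>?I \<times> ?I. ?t x)" unfolding power2_eq_square sum_product sum.cartesian_product
    by (intro sum.cong refl) (auto simp: assms mult_ac)
  also have "\<dots> = (\<Sum>k\<in>{0<..<N^2}. \<Sum>x\<in>{x \<in> ?I \<times> ?I. ?m x = k}. ?t x)" using sub by (intro sum.group[symmetric]) auto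
  also have "\<dots> = (\<Sum>k\<in>{0<..<N^2}. of_real (r2 N k) * f k)"
  proof (rule sum.cong[OF refl])
    fix k
    let ?A = "{(a, b). a \<in> ?I \<and> b \<in> ?I \<and> a * b = k}"
    have eq: "{x \<in> ?I \<times> ?I. ?m x = k} = ?A" by auto
    have "(\<Sum>x\<in>?A. ?t x) = (\<Sum>x\<in>?A. of_real (case x of (a, b) \<Rightarrow> rr a * rr b) * f k)"
    proof (rule sum.cong[OF refl])
      fix x assume "x \<in> ?A"
      then obtain a b where "x = (a, b)" "a * b = k" by blast
      then show "?t x = of_real (case x of (a, b) \<Rightarrow> rr a * rr b) * f k" by simp
    qed
    then show "(\<Sum>x\<in>{x \<in> ?I \<times> ?I. ?m x = k}. ?t x) = of_real (r2 N k) * f k"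
      unfolding eq r2_def of_real_sum sum_distrib_right .
  qed
  finally show ?thesis .
qed

lemma harmonic_le: assumes "n > 0" shows "(\<Sum>k\<in>{0<..n}. 1 / real k) \<le> 1 + ln n" using assms
proof (induction n rule: nat_induct_non_zero)
  case 1
  have "{0<..(1::nat)} = {1}" by auto
  then show ?case by simp
next
  case (Suc n)
  have "{0<..Suc n} = insert (Suc n) {0<..n}" by auto
  then have "(\<Sum>k\<in>{0<..Suc n}. 1 / real k) = 1 / real (Suc n) + (\<Sum>k\<in>{0<..n}. 1 / real k)" by simp
  also have "\<dots> \<le> 1 / real (Suc n) + (1 + ln n)" using Suc.IH by simp
  also have "1 / real (Suc n) \<le> ln (real (Suc n)) - ln (real n)"
  proof -
    have "ln (real n / real (Suc n)) \<le> real n / real (Suc n) - 1" using Suc.hyps by (intro ln_le_minus_one) simp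
    also have "\<dots> = - (1 / real (Suc n))" by (simp add: field_simps)
    finally show ?thesis using Suc.hyps by (simp add: ln_div)
  qed
  finally show ?case by simp
qed

text \<open>Bounding \<open>rr\<close> by 1 would give a squared logarithm. The square of the
  truncation has coefficients at most 1 instead, so a harmonic sum up to N^2 and a single logarithm
  appear; the final error term depends on this.\<close>

lemma sum_rr_square_le:
  assumes "N \<ge> 2"
  shows "(\<Sum>a\<in>{0<..<N}. rr a / real a)^2 \<le> 1 + 2 * ln N"
proof -
  have "(\<Sum>a\<in>{0<..<N}. rr a / real a)^2 = (\<Sum>k\<in>{0<..<N^2}. r2 N k * (1 / real k))"
    using square_of_truncation[of "\<lambda>k. 1 / real k" N] by simp
  also have "\<dots> \<le> (\<Sum>k\<in>{0<..<N^2}. 1 / real k)" using r2_le_1 by (intro sum_mono) (simp add: divide_right_mono)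
  also have "\<dots> \<le> (\<Sum>k\<in>{0<..N^2}. 1 / real k)" by (intro sum_mono2) auto
  also have "\<dots> \<le> 1 + ln (real (N^2))" using assms by (intro harmonic_le) simp
  also have "\<dots> = 1 + 2 * ln N" using assms by (simp add: ln_realpow)
  finally show ?thesis .
qed

text \<open>Division by zero makes \<open>rs 0 = 0\<close>, so sums over all \<open>n\<close> are sums over positive \<open>n\<close>.\<close>
definition rs :: "nat \<Rightarrow> real" where "rs n = (rr n)^2 / (real n)^2"

lemma rs_nonneg: "0 \<le> rs n"
  by (simp add: rs_def)

lemma rs_le: "rs n \<le> 1 / (real n)^2" unfolding rs_def using rr_nonneg rr_le_1 by (intro divide_right_mono power_le_one) auto

lemma sum_rs_le:
  assumes "2 \<le> p" "p \<le> M"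
  shows "(\<Sum>n<M. rs n) \<le> (\<Sum>n<p. rs n) + 1 / (real p - 1) - 1 / (real M - 1)" using assms(2)
proof (induction M rule: dec_induct)
  case (step M)
  have "rs M \<le> 1 / (real M)^2" by (rule rs_le)
  also have "\<dots> \<le> 1 / (real M - 1) - 1 / (real (Suc M) - 1)" using step assms(1) by (simp add: field_simps power2_eq_square)
  finally show ?case using step by simp
qed simp

lemma summable_rs: "summable rs"
proof (rule summable_comparison_test')
  show "summable (\<lambda>n. 1 / (real n)^2)" using inverse_power_summable[of 2, where 'a = real] by (simp add: inverse_eq_divide)
  show "norm (rs n) \<le> 1 / (real n)^2" for n using rs_le rs_nonneg by simp
qed

lemma suminf_rs_bounds:
  assumes "2 \<le> p"
  shows "(\<Sum>n<p. rs n) \<le> suminf rs" "suminf rs \<le> (\<Sum>n<p. rs n) + 1 / (real p - 1)"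
proof -
  show "(\<Sum>n<p. rs n) \<le> suminf rs" by (intro sum_le_suminf summable_rs) (auto simp: rs_nonneg)
  have "(\<Sum>n<M. rs n) \<le> (\<Sum>n<p. rs n) + 1 / (real p - 1)" for M
  proof (cases "p \<le> M")
    case True
    have "0 \<le> 1 / (real M - 1)" using assms True by simp
    then show ?thesis using sum_rs_le[OF assms True] by linarith
  next
    case False
    then have "(\<Sum>n<M. rs n) \<le> (\<Sum>n<p. rs n)" by (intro sum_mono2) (auto simp: rs_nonneg)
    then show ?thesis using assms by (smt (verit) divide_nonneg_nonneg of_nat_1 of_nat_mono one_le_numeral order.trans)
  qed
  then show "suminf rs \<le> (\<Sum>n<p. rs n) + 1 / (real p - 1)" by (intro suminf_le_const summable_rs)
qed

section \<open>The Euler product of \<open>rs\<close>, by sums over smooth numbers\<close>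

definition smooth :: "nat \<Rightarrow> nat set" where
  "smooth N = {n. n > 0 \<and> (\<forall>q. prime q \<longrightarrow> q dvd n \<longrightarrow> q \<le> N)}"

lemma smooth_0: "smooth 0 = {1}"
proof -
  have "n = 1" if "n \<in> smooth 0" for n using that prime_factor_nat[of n] by (auto simp: smooth_def dest: prime_gt_0_nat)
  then show ?thesis by (auto simp: smooth_def)
qed

lemma smooth_Suc_not_prime: "\<not> prime (Suc N) \<Longrightarrow> smooth (Suc N) = smooth N" unfolding smooth_def by (metis le_Suc_eq)

lemma smooth_not_dvd: "prime (Suc N) \<Longrightarrow> d \<in> smooth N \<Longrightarrow> \<not> Suc N dvd d" unfolding smooth_def using Suc_n_not_le_n by blast

lemma smooth_Suc_prime:
  assumes "prime (Suc N)"
  shows "bij_betw (\<lambda>(k, d). Suc N ^ k * d) (UNIV \<times> smooth N) (smooth (Suc N))" unfolding bij_betw_def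
proof
  let ?q = "Suc N"
  show "inj_on (\<lambda>(k, d). ?q ^ k * d) (UNIV \<times> smooth N)"
  proof (rule inj_onI)
    fix x y assume xy: "x \<in> UNIV \<times> smooth N" "y \<in> UNIV \<times> smooth N"
      "(\<lambda>(k, d). ?q ^ k * d) x = (\<lambda>(k, d). ?q ^ k * d) y"
    obtain i a j b where "x = (i, a)" "y = (j, b)" by (metis surj_pair)
    then show "x = y" using xy prime_power_mult_eq_iff[OF assms smooth_not_dvd[OF assms] smooth_not_dvd[OF assms]] by simp
  qed
  show "(\<lambda>(k, d). ?q ^ k * d) ` (UNIV \<times> smooth N) = smooth ?q"
  proof (intro equalityI subsetI)
    fix x assume "x \<in> (\<lambda>(k, d). ?q ^ k * d) ` (UNIV \<times> smooth N)"
    then obtain k d where x: "x = ?q ^ k * d" "d \<in> smooth N" by auto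
    have "r \<le> ?q" if r: "prime r" "r dvd x" for r
    proof -
      have "r dvd ?q ^ k \<or> r dvd d" using r x by (simp add: prime_dvd_mult_iff)
      then show ?thesis
      proof
        assume "r dvd ?q ^ k"
        then have "r dvd ?q" using r(1) prime_dvd_power by blast
        then show ?thesis by (simp add: dvd_imp_le)
      next
        assume "r dvd d"
        then have "r \<le> N" using x(2) r(1) unfolding smooth_def by blast
        then show ?thesis by simp
      qed
    qed
    moreover have "x > 0" using x by (simp add: smooth_def)
    ultimately show "x \<in> smooth ?q" by (simp add: smooth_def)
  next
    fix x assume x: "x \<in> smooth ?q"
    then have "x > 0" by (simp add: smooth_def)
    then obtain k d where d: "x = ?q ^ k * d" "\<not> ?q dvd d" using prime_power_decompose assms by blast
    have "d \<in> smooth N"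
    proof -
      have "r \<le> N" if r: "prime r" "r dvd d" for r
      proof -
        have "r dvd x" using r(2) d(1) by simp
        then have "r \<le> Suc N" using x r(1) unfolding smooth_def by blast
        moreover have "r \<noteq> Suc N" using r(2) d(2) by auto
        ultimately show ?thesis by simp
      qed
      moreover have "d > 0" using d(2) by (metis dvd_0_right neq0_conv)
      ultimately show ?thesis by (simp add: smooth_def)
    qed
    then show "x \<in> (\<lambda>(k, d). ?q ^ k * d) ` (UNIV \<times> smooth N)" using d(1) by (intro image_eqI[of _ _ "(k, d)"]) auto
  qed
qed

definition euler_factor :: "nat \<Rightarrow> real" where
  "euler_factor q = (\<Sum>m. (real ((2 * m) choose m))^2 / (4 ^ (2 * m) * real q ^ (2 * m)))"

lemma euler_factor_has_sum:
  assumes "prime q"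
  shows "((\<lambda>k. (cbin k)^2 / real q ^ (2 * k)) has_sum euler_factor q) UNIV"
proof -
  have "(\<lambda>k. (cbin k)^2 / real q ^ (2 * k)) = (\<lambda>m. (real ((2 * m) choose m))^2 / (4 ^ (2 * m) * real q ^ (2 * m)))"
    by (rule ext) (simp add: cbin_def power_divide mult.commute flip: power_mult)
  then have ef: "euler_factor q = (\<Sum>k. (cbin k)^2 / real q ^ (2 * k))" by (simp add: euler_factor_def)
  have "summable (\<lambda>k. (cbin k)^2 / real q ^ (2 * k))"
  proof (rule summable_comparison_test')
    have "1 < (real q)^2" using prime_gt_1_nat[OF assms] by (simp add: one_less_power)
    then show "summable (\<lambda>k. (1 / (real q)^2) ^ k)" by (intro summable_geometric) (simp add: divide_simps)
    fix k
    have "(cbin k)^2 \<le> 1" using cbin_nonneg cbin_le_1 by (intro power_le_one) auto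
    then show "norm ((cbin k)^2 / real q ^ (2 * k)) \<le> (1 / (real q)^2) ^ k"
      by (simp add: power_mult power_divide divide_right_mono)
  qed
  then have "(\<lambda>k. (cbin k)^2 / real q ^ (2 * k)) sums euler_factor q" unfolding ef by (rule summable_sums)
  then show ?thesis by (rule sums_nonneg_imp_has_sum) simp
qed

text \<open>For a new prime q the smooth numbers become the products q^k d with d free of q, each
  represented once; \<open>rs\<close> factors accordingly, and nonnegativity justifies the double
  summation.\<close>

lemma euler_product_has_sum: "(rs has_sum (\<Prod>q\<in>{q. prime q \<and> q \<le> N}. euler_factor q)) (smooth N)"
proof (induction N)
  case 0
  have "{q::nat. prime q \<and> q \<le> 0} = {}" by auto
  then have 1: "(\<Prod>q\<in>{q::nat. prime q \<and> q \<le> 0}. euler_factor q) = 1" by (simp only: prod.empty)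
  have "sum rs {1} = 1" by (simp add: rs_def rr_1)
  moreover have "(rs has_sum sum rs {1}) {1}" by (rule has_sum_finite) simp
  ultimately show ?case unfolding 1 smooth_0 by simp
next
  case (Suc N)
  let ?P = "\<Prod>q\<in>{q. prime q \<and> q \<le> N}. euler_factor q"
  show ?case
  proof (cases "prime (Suc N)")
    case False
    then have "{q. prime q \<and> q \<le> Suc N} = {q. prime q \<and> q \<le> N}" by (auto simp: le_Suc_eq)
    then show ?thesis using Suc smooth_Suc_not_prime[OF False] by simp
  next
    case True
    let ?q = "Suc N"
    let ?g = "\<lambda>(k, d). ?q ^ k * d"
    define c where "c = (\<lambda>k. (cbin k)^2 / real ?q ^ (2 * k))"
    have set: "{q. prime q \<and> q \<le> ?q} = insert ?q {q. prime q \<and> q \<le> N}" using True by (auto simp: le_Suc_eq)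
    have fin: "finite {q. prime q \<and> q \<le> N}" by (rule finite_subset[of _ "{..N}"]) auto
    have prod: "(\<Prod>q\<in>{q. prime q \<and> q \<le> ?q}. euler_factor q) = euler_factor ?q * ?P" unfolding set using fin by simp
    have c: "(c has_sum euler_factor ?q) UNIV" unfolding c_def using euler_factor_has_sum[OF True] .
    have outer: "((\<lambda>k. c k * ?P) has_sum euler_factor ?q * ?P) UNIV" using c by (rule has_sum_cmult_left)
    have inner: "((\<lambda>d. (\<lambda>(k, d). c k * rs d) (k, d)) has_sum c k * ?P) (smooth N)" for k
      using has_sum_cmult_right[OF Suc, of "c k"] by simp
    have "((\<lambda>(k, d). c k * rs d) has_sum euler_factor ?q * ?P) (UNIV \<times> smooth N)"
    proof (rule has_sum_SigmaI[OF inner outer])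
      show "(\<lambda>(k, d). c k * rs d) summable_on UNIV \<times> smooth N"
        by (rule summable_on_SigmaI[OF inner has_sum_imp_summable[OF outer]])
           (auto simp: c_def rs_nonneg intro!: divide_nonneg_nonneg mult_nonneg_nonneg)
    qed
    also have "?this \<longleftrightarrow> ((\<lambda>x. rs (?g x)) has_sum euler_factor ?q * ?P) (UNIV \<times> smooth N)"
    proof (intro has_sum_cong)
      fix x :: "nat \<times> nat" assume "x \<in> UNIV \<times> smooth N"
      then obtain k d where x: "x = (k, d)" "d \<in> smooth N" by auto
      have rrq: "rr (?q ^ k * d) = cbin k * rr d" by (rule rr_prime_power_mult[OF True smooth_not_dvd[OF True x(2)]])
      have pw: "real ?q ^ (2 * k) = (real ?q ^ k)^2" by (simp only: power_mult[symmetric] mult.commute)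
      show "(\<lambda>(k, d). c k * rs d) x = rs (?g x)" unfolding x rs_def c_def prod.case rrq pw by (simp add: power_mult_distrib)
    qed
    also have "\<dots> \<longleftrightarrow> (rs has_sum euler_factor ?q * ?P) (smooth ?q)"
      by (rule has_sum_reindex_bij_betw[OF smooth_Suc_prime[OF True]])
    finally show ?thesis unfolding prod .
  qed
qed

text \<open>Every positive n < N is \<open>N\<close>-smooth, so the partial products are squeezed
  between the partial sums of \<open>rs\<close> and its total. This settles convergence and the
  value of the limit at once.\<close>

lemma C_const_eq: "C_const = suminf rs"
proof -
  let ?P = "\<lambda>N. \<Prod>q\<in>{q. prime q \<and> q \<le> N}. euler_factor q"
  have S: "(rs has_sum suminf rs) UNIV" using summable_sums[OF summable_rs] rs_nonneg by (intro sums_nonneg_imp_has_sum)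
  have "?P \<longlonglongrightarrow> suminf rs"
  proof (rule tendsto_sandwich)
    show "eventually (\<lambda>N. (\<Sum>n<N. rs n) \<le> ?P N) sequentially"
    proof (intro always_eventually allI)
      fix N
      have "(\<Sum>n<N. rs n) = (\<Sum>n\<in>{0<..<N}. rs n)" by (rule sum.mono_neutral_right) (auto simp: rs_def)
      also have "\<dots> \<le> ?P N"
      proof (rule finite_sum_le_has_sum[OF euler_product_has_sum])
        show "{0<..<N} \<subseteq> smooth N" by (auto simp: smooth_def dest: dvd_imp_le)
      qed (auto simp: rs_nonneg)
      finally show "(\<Sum>n<N. rs n) \<le> ?P N" .
    qed
    show "eventually (\<lambda>N. ?P N \<le> suminf rs) sequentially"
      by (intro always_eventually allI, rule has_sum_mono_neutral[OF euler_product_has_sum S])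
         (auto simp: rs_nonneg)
    show "(\<lambda>N. \<Sum>n<N. rs n) \<longlonglongrightarrow> suminf rs" by (rule summable_LIMSEQ[OF summable_rs])
  qed auto
  then show ?thesis unfolding C_const_def euler_factor_def[symmetric] by (rule limI)
qed

section \<open>Approximating $L(1,\chi)$ by squares\<close>

context prime_1_mod_4 begin

lemma char_mult: "chi \<in> chars \<Longrightarrow> chi (a * b) = chi a * chi b"
  by (simp add: chars_def dirichlet_char_def)

lemma norm_char_le: "chi \<in> chars \<Longrightarrow> cmod (chi k) \<le> 1" using norm_chz_le[of chi "int k"] by (simp add: chz_int)

lemma sum_Zp_nat: "(\<Sum>k<p. g (int k)) = (\<Sum>x\<in>Zp. g x)"
proof -
  have "(\<Sum>x\<in>int ` {0..<p}. g x) = (\<Sum>k\<in>{0..<p}. g (int k))" by (subst sum.reindex) (simp_all add: inj_on_def)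
  then show ?thesis unfolding image_int_atLeastLessThan of_nat_0 unfolding atLeast0LessThan by (rule sym)
qed

text \<open>Any \<open>p\<close> consecutive values sum to 0, so \<open>n\<close> can be lowered
  below \<open>p\<close>, where the trivial bound applies.\<close>

lemma char_partial_sum_bound:
  assumes "chi \<in> chars" "chi \<noteq> chi0"
  shows "cmod (\<Sum>k<n. chi k) \<le> p"
proof (induction n rule: less_induct)
  case (less n)
  show ?case
  proof (cases "n < p")
    case True
    have "cmod (\<Sum>k<n. chi k) \<le> (\<Sum>k<n. 1)" by (rule sum_norm_le) (rule norm_char_le[OF assms(1)])
    then show ?thesis using True by simp
  next
    case False
    then obtain m where n: "n = m + p" by (metis add.commute le_add_diff_inverse not_le)
    have "(\<Sum>k\<in>{m..<m + p}. chi k) = (\<Sum>k<p. chi (m + k))"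
      using sum.shift_bounds_nat_ivl[of chi 0 m p] by (simp add: add.commute atLeast0LessThan)
    also have "\<dots> = (\<Sum>k<p. chz chi (int k + int m))" using chz_int[OF assms(1)] by (simp add: add.commute flip: of_nat_add)
    also have "\<dots> = (\<Sum>x\<in>Zp. chz chi (x + int m))" by (rule sum_Zp_nat)
    also have "\<dots> = 0" using sum_shift[OF per_chz] sum_chz[OF assms] by simp
    finally have "(\<Sum>k\<in>{m..<m + p}. chi k) = 0" .
    moreover have "(\<Sum>k<n. chi k) = (\<Sum>k<m. chi k) + (\<Sum>k\<in>{m..<m + p}. chi k)"
      unfolding n by (metis atLeast0LessThan le_add1 le0 sum.atLeastLessThan_concat)
    moreover have "m < n" using n p_gt_2 by simp
    ultimately show ?thesis using less.IH[of m] by simp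
  qed
qed

lemma summation_by_parts:
  fixes c :: "nat \<Rightarrow> complex"
  assumes "0 < M" "M \<le> N"
  shows "(\<Sum>k\<in>{M..<N}. c k / of_nat k) = (\<Sum>k<N. c k) / of_nat N - (\<Sum>k<M. c k) / of_nat M
    + (\<Sum>k\<in>{M..<N}. (\<Sum>j<Suc k. c j) * of_real (1 / real k - 1 / real (Suc k)))" using assms(2)
proof (induction N rule: dec_induct)
  case (step N)
  have N: "of_nat N \<noteq> (0::complex)" "of_nat (Suc N) \<noteq> (0::complex)" using assms(1) step by (auto simp del: of_nat_Suc)
  let ?S = "\<Sum>k<N. c k"
  have "c N / of_nat N = (?S + c N) / of_nat (Suc N) - ?S / of_nat N + (?S + c N) * (1 / of_nat N - 1 / of_nat (Suc N))"
    using N by (simp add: field_simps del: of_nat_Suc)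
  then show ?case using step by (simp add: algebra_simps del: of_nat_Suc)
qed simp

lemma char_tail_bound:
  assumes "chi \<in> chars" "chi \<noteq> chi0" "0 < M" "M \<le> N"
  shows "cmod (\<Sum>k\<in>{M..<N}. chi k / of_nat k) \<le> 2 * p / M"
proof -
  let ?d = "\<lambda>k. 1 / real k - 1 / real (Suc k)"
  have b: "cmod (\<Sum>k<n. chi k) \<le> p" for n by (rule char_partial_sum_bound[OF assms(1,2)])
  have tele: "(\<Sum>k\<in>{M..<N}. ?d k) = 1 / real M - 1 / real N" using assms(4)
  proof (induction N rule: dec_induct)
    case (step N)
    then show ?case by simp
  qed simp
  have "cmod (\<Sum>k\<in>{M..<N}. (\<Sum>j<Suc k. chi j) * of_real (?d k)) \<le> (\<Sum>k\<in>{M..<N}. p * ?d k)"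
  proof (rule sum_norm_le)
    fix k assume "k \<in> {M..<N}"
    then have k: "0 < k" using assms(3) by simp
    have d: "0 \<le> ?d k" using k by (simp add: field_simps)
    then have "cmod (of_real (?d k)) = ?d k" by (simp only: norm_of_real abs_of_nonneg)
    then show "cmod ((\<Sum>j<Suc k. chi j) * of_real (?d k)) \<le> p * ?d k"
      unfolding norm_mult using b[of "Suc k"] d by (simp only: mult_right_mono)
  qed
  also have "\<dots> = p * (1 / real M - 1 / real N)" unfolding sum_distrib_left[symmetric] tele ..
  finally have 1: "cmod (\<Sum>k\<in>{M..<N}. (\<Sum>j<Suc k. chi j) * of_real (?d k)) \<le> p / M - p / N" by (simp add: right_diff_distrib)
  have 2: "cmod ((\<Sum>k<n. chi k) / of_nat n) \<le> p / n" for n using b[of n] by (simp add: norm_divide divide_right_mono)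
  have "cmod (\<Sum>k\<in>{M..<N}. chi k / of_nat k) \<le> p / N + p / M + (p / M - p / N)" unfolding summation_by_parts[OF assms(3,4)]
    by (rule order.trans[OF norm_triangle_ineq], rule add_mono[OF _ 1],
        rule order.trans[OF norm_triangle_ineq4], rule add_mono[OF 2 2])
  then show ?thesis by simp
qed

text \<open>\<open>L1\<close> is a bare \<open>lim\<close>, so convergence must be established too:
  the tail bound first shows that the partial sums are Cauchy, and then passes to the limit.\<close>

lemma L1_approx:
  assumes "chi \<in> chars" "chi \<noteq> chi0" "0 < M"
  shows "cmod (L1 chi - (\<Sum>k\<in>{0<..<M}. chi k / of_nat k)) \<le> 2 * p / M"
proof -
  let ?s = "\<lambda>N. \<Sum>k=1..N. chi k / of_nat k" and ?h = "\<lambda>m. \<Sum>k\<in>{0<..<m}. chi k / of_nat k"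
  have diff: "?s N - ?h m = (\<Sum>k\<in>{m..<Suc N}. chi k / of_nat k)"
    if "0 < m" "m \<le> Suc N" for m N
  proof -
    have "{1..N} = {0<..<m} \<union> {m..<Suc N}" using that by auto
    then show ?thesis by (simp add: sum.union_disjoint ivl_disj_int)
  qed
  have "Cauchy ?s"
  proof (rule CauchyI)
    fix e :: real assume e: "e > 0"
    obtain m0 :: nat where m0: "4 * p / e < m0" using reals_Archimedean2 by blast
    define m where "m = Suc m0"
    have m: "0 < m" "4 * p / m < e" using m0 e by (auto simp: m_def field_simps intro: less_trans)
    show "\<exists>M. \<forall>i\<ge>M. \<forall>j\<ge>M. cmod (?s i - ?s j) < e"
    proof (intro exI[of _ m] allI impI)
      fix i j assume ij: "m \<le> i" "m \<le> j"
      have b: "cmod (?s l - ?h m) \<le> 2 * p / m" if "m \<le> l" for l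
        using diff[of m l] char_tail_bound[OF assms(1,2) m(1), of "Suc l"] that m(1) by simp
      have "cmod (?s i - ?s j) = cmod ((?s i - ?h m) - (?s j - ?h m))" by simp
      also have "\<dots> \<le> 2 * p / m + 2 * p / m"
        by (rule order.trans[OF norm_triangle_ineq4], rule add_mono[OF b[OF ij(1)] b[OF ij(2)]])
      also have "\<dots> < e" using m(2) by simp
      finally show "cmod (?s i - ?s j) < e" .
    qed
  qed
  then have "?s \<longlonglongrightarrow> L1 chi" unfolding L1_def by (simp add: Cauchy_convergent_iff convergent_LIMSEQ_iff)
  then have "(\<lambda>N. cmod (?s N - ?h M)) \<longlonglongrightarrow> cmod (L1 chi - ?h M)" by (intro tendsto_norm tendsto_diff tendsto_const)
  then show ?thesis
  proof (rule LIMSEQ_le_const2)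
    show "\<exists>N. \<forall>n\<ge>N. cmod (?s n - ?h M) \<le> 2 * p / M"
    proof (intro exI[of _ M] allI impI)
      fix n assume "M \<le> n"
      then show "cmod (?s n - ?h M) \<le> 2 * p / M"
        using diff[of M n] char_tail_bound[OF assms(1,2,3), of "Suc n"] assms(3) by simp
    qed
  qed
qed

definition Asum :: "(nat \<Rightarrow> complex) \<Rightarrow> complex" where
  "Asum chi = (\<Sum>n\<in>{0<..<p}. of_real (rr n) * (chi n / of_nat n))"

text \<open>The square of \<open>Asum\<close> only involves k < p^2, so the series for L(1,chi) is
  cut there, at a cost of 2p / p^2. Below \<open>p\<close> the coefficients coincide by
  \<open>r2_eq_1\<close>.\<close>

lemma L1_minus_Asum_square:
  assumes "chi \<in> chars" "chi \<noteq> chi0"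
  shows "cmod (L1 chi - (Asum chi)^2) \<le> cmod (\<Sum>k\<in>{p..<p^2}. of_real ((1 - r2 p k) / k) * chi k) + 2 / p"
proof -
  have "(Asum chi)^2 = (\<Sum>k\<in>{0<..<p^2}. of_real (r2 p k) * (chi k / of_nat k))"
    unfolding Asum_def by (rule square_of_truncation) (simp add: char_mult[OF assms(1)])
  then have "(\<Sum>k\<in>{0<..<p^2}. chi k / of_nat k) - (Asum chi)^2 = (\<Sum>k\<in>{0<..<p^2}. of_real ((1 - r2 p k) / k) * chi k)"
    by (simp add: sum_subtractf[symmetric]) (intro sum.cong refl, simp add: left_diff_distrib diff_divide_distrib)
  also have "\<dots> = (\<Sum>k\<in>{p..<p^2}. of_real ((1 - r2 p k) / k) * chi k)"
    by (rule sum.mono_neutral_right) (use p_gt_2 in \<open>auto simp: r2_eq_1\<close>)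
  finally have eq: "L1 chi - (Asum chi)^2 = (\<Sum>k\<in>{p..<p^2}. of_real ((1 - r2 p k) / k) * chi k)
      + (L1 chi - (\<Sum>k\<in>{0<..<p^2}. chi k / of_nat k))" by (simp add: algebra_simps)
  have "cmod (L1 chi - (\<Sum>k\<in>{0<..<p^2}. chi k / of_nat k)) \<le> 2 * p / real (p^2)"
    using p_gt_2 by (intro L1_approx[OF assms]) simp
  also have "2 * p / real (p^2) = 2 / p" using p_gt_2 by (simp add: power2_eq_square)
  finally show ?thesis unfolding eq by (intro order.trans[OF norm_triangle_ineq]) simp
qed

lemma cong_int_nat: "[int k = int l] (mod int p) \<longleftrightarrow> k mod p = l mod p" unfolding cong_def by (metis of_nat_eq_iff zmod_int)

lemma char_mean_square:
  assumes "finite K"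
  shows "(\<Sum>chi\<in>chars. (cmod (\<Sum>k\<in>K. of_real (a k) * chi k))^2)
    = (P - 1) * (\<Sum>k\<in>K. \<Sum>l\<in>K. if k mod p = l mod p \<and> \<not> p dvd k then a k * a l else 0)"
proof -
  let ?c = "\<lambda>k l. k mod p = l mod p \<and> \<not> p dvd k" and ?t = "\<lambda>k l. if k mod p = l mod p \<and> \<not> p dvd k then a k * a l else 0"
  have inner: "(\<Sum>chi\<in>chars. chi k * cnj (chi l)) = (if ?c k l then of_nat (p - 1) else 0)" for k l
  proof (cases "p dvd k \<or> p dvd l")
    case True
    then have "chi k * cnj (chi l) = 0" if "chi \<in> chars" for chi
      using chz_eq_0_iff[OF that, of "int k"] chz_eq_0_iff[OF that, of "int l"] chz_int[OF that] by auto
    then have "(\<Sum>chi\<in>chars. chi k * cnj (chi l)) = 0" by (intro sum.neutral ballI)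
    moreover have "\<not> ?c k l" using True by (auto simp: dvd_eq_mod_eq_0)
    ultimately show ?thesis by (simp only: if_False)
  next
    case False
    then have "(\<Sum>chi\<in>chars. chz chi (int k) * cnj (chz chi (int l))) = (if [int k = int l] (mod int p) then of_nat (p - 1) else 0)"
      by (intro sum_chars_orthogonal) auto
    moreover have "(\<Sum>chi\<in>chars. chz chi (int k) * cnj (chz chi (int l))) = (\<Sum>chi\<in>chars. chi k * cnj (chi l))"
      by (intro sum.cong refl) (simp add: chz_int)
    ultimately show ?thesis using False by (simp add: cong_int_nat)
  qed
  have "complex_of_real (\<Sum>chi\<in>chars. (cmod (\<Sum>k\<in>K. of_real (a k) * chi k))^2)
    = (\<Sum>chi\<in>chars. \<Sum>k\<in>K. \<Sum>l\<in>K. of_real (a k * a l) * (chi k * cnj (chi l)))"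
    unfolding of_real_sum complex_norm_square cnj_sum sum_product by (intro sum.cong refl) simp
  also have "\<dots> = (\<Sum>k\<in>K. \<Sum>l\<in>K. \<Sum>chi\<in>chars. of_real (a k * a l) * (chi k * cnj (chi l)))"
    by (subst sum.swap, rule sum.cong[OF refl], rule sum.swap)
  also have "\<dots> = (\<Sum>k\<in>K. \<Sum>l\<in>K. of_real ((P - 1) * ?t k l))" unfolding sum_distrib_left[symmetric] inner using p_gt_2
    by (intro sum.cong refl) (simp add: of_nat_diff mult.commute)
  also have "\<dots> = of_real ((P - 1) * (\<Sum>k\<in>K. \<Sum>l\<in>K. ?t k l))" by (simp add: sum_distrib_left)
  finally show ?thesis by (simp only: of_real_eq_iff)
qed

text \<open>Within a residue class the numbers in [p, p^2) are told apart by j = l div p, and l >= p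
  j; what results is a harmonic sum divided by \<open>p\<close>. This 1/p compensates the factor p -
  1 from orthogonality.\<close>

lemma residue_class_sum:
  "(\<Sum>l\<in>{p..<p^2}. if k mod p = l mod p then 1 / real l else 0) \<le> (1 + ln p) / p" (is "?S \<le> _")
proof -
  let ?L = "{l \<in> {p..<p^2}. k mod p = l mod p}"
  have p0: "0 < p" using p_gt_2 by simp
  have inj: "inj_on (\<lambda>l. l div p) ?L" by (rule inj_onI) (metis (mono_tags, lifting) div_mult_mod_eq mem_Collect_eq)
  have img: "(\<lambda>l. l div p) ` ?L \<subseteq> {0<..p}"
  proof
    fix j assume "j \<in> (\<lambda>l. l div p) ` ?L"
    then obtain l where l: "j = l div p" "p \<le> l" "l < p * p" by (auto simp: power2_eq_square)
    then have "0 < j" "j < p" using p0 by (auto simp: div_greater_zero_iff less_mult_imp_div_less)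
    then show "j \<in> {0<..p}" by simp
  qed
  have "?S = (\<Sum>l\<in>?L. 1 / real l)" by (rule sum.inter_filter[symmetric]) simp
  also have "\<dots> \<le> (\<Sum>l\<in>?L. 1 / (P * real (l div p)))"
  proof (rule sum_mono)
    fix l assume "l \<in> ?L"
    then have l: "p \<le> l" by simp
    have "p * (l div p) \<le> l" by simp
    then have "P * real (l div p) \<le> real l" by (metis of_nat_mono of_nat_mult)
    moreover have "0 < l div p" using l p0 by (simp add: div_greater_zero_iff)
    ultimately show "1 / real l \<le> 1 / (P * real (l div p))" using p0 l by (intro divide_left_mono) auto
  qed
  also have "\<dots> = (\<Sum>j\<in>(\<lambda>l. l div p) ` ?L. 1 / (P * real j))" by (subst sum.reindex[OF inj]) simp
  also have "\<dots> \<le> (\<Sum>j\<in>{0<..p}. 1 / (P * real j))" using img by (intro sum_mono2) auto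
  also have "\<dots> = (\<Sum>j\<in>{0<..p}. 1 / real j) / p" by (simp add: sum_divide_distrib mult.commute)
  also have "\<dots> \<le> (1 + ln p) / p" using harmonic_le[OF p0] by (intro divide_right_mono) auto
  finally show ?thesis .
qed

lemma ln_p_ge_1: "1 \<le> ln (P)"
proof -
  have "p \<ge> 3" using p_gt_2 by simp
  then have "exp 1 \<le> P" using exp_le by linarith
  then show ?thesis using p_gt_2 by (simp add: ln_ge_iff)
qed

lemma tail_mean_square:
  "(\<Sum>chi\<in>chars. (cmod (\<Sum>k\<in>{p..<p^2}. of_real ((1 - r2 p k) / k) * chi k))^2) \<le> 6 * (ln p)^2"
proof -
  define a where "a = (\<lambda>k. (1 - r2 p k) / real k)"
  let ?K = "{p..<p^2}" and ?t = "\<lambda>k l. if k mod p = l mod p \<and> \<not> p dvd k then a k * a l else 0"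
    and ?u = "\<lambda>k l. 1 / real k * (if k mod p = l mod p then 1 / real l else 0)"
  have a: "0 \<le> a k" "a k \<le> 1 / real k" if "k \<in> ?K" for k
  proof -
    have "k > 0" using that p_gt_2 by simp
    then show "0 \<le> a k" "a k \<le> 1 / real k"
      using r2_le_1[of k p] r2_nonneg[of p k] unfolding a_def by (auto intro: divide_right_mono)
  qed
  have L: "1 \<le> ln (P)" by (rule ln_p_ge_1)
  have p2: "0 < p^2" using p_gt_2 by simp
  have "(\<Sum>k\<in>?K. \<Sum>l\<in>?K. ?t k l) \<le> (\<Sum>k\<in>?K. \<Sum>l\<in>?K. ?u k l)"
  proof (intro sum_mono)
    fix k l assume kl: "k \<in> ?K" "l \<in> ?K"
    have "a k * a l \<le> 1 / real k * (1 / real l)" using a[OF kl(1)] a[OF kl(2)] by (intro mult_mono) auto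
    then show "?t k l \<le> ?u k l" by (auto simp: mult.commute)
  qed
  also have "\<dots> \<le> (\<Sum>k\<in>?K. 1 / real k * ((1 + ln p) / p))"
    unfolding sum_distrib_left[symmetric] by (intro sum_mono mult_left_mono residue_class_sum) auto
  also have "\<dots> = (\<Sum>k\<in>?K. 1 / real k) * ((1 + ln p) / p)" by (simp only: sum_distrib_right)
  also have "\<dots> \<le> (1 + ln (real (p^2))) * ((1 + ln p) / p)"
  proof (rule mult_right_mono)
    have "(\<Sum>k\<in>?K. 1 / real k) \<le> (\<Sum>k\<in>{0<..p^2}. 1 / real k)" using p_gt_2 by (intro sum_mono2) auto
    also have "\<dots> \<le> 1 + ln (real (p^2))" by (rule harmonic_le[OF p2])
    finally show "(\<Sum>k\<in>?K. 1 / real k) \<le> 1 + ln (real (p^2))" .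
  qed (use L in simp)
  also have "\<dots> = (1 + 2 * ln p) * (1 + ln p) / p" using p_gt_2 by (simp add: ln_realpow)
  finally have *: "(\<Sum>k\<in>?K. \<Sum>l\<in>?K. ?t k l) \<le> (1 + 2 * ln p) * (1 + ln p) / p" .
  have "(\<Sum>chi\<in>chars. (cmod (\<Sum>k\<in>?K. of_real (a k) * chi k))^2) \<le> (P - 1) * ((1 + 2 * ln p) * (1 + ln p) / p)"
    unfolding char_mean_square[OF finite_atLeastLessThan] using p_gt_2 by (intro mult_left_mono *) auto
  also have "\<dots> \<le> P * ((1 + 2 * ln p) * (1 + ln p) / p)" using L by (intro mult_right_mono) auto
  also have "\<dots> = (1 + 2 * ln p) * (1 + ln p)" using p_gt_2 by simp
  also have "\<dots> \<le> (3 * ln p) * (2 * ln p)" using L by (intro mult_mono) auto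
  also have "\<dots> = 6 * (ln p)^2" by (simp add: power2_eq_square)
  finally show ?thesis unfolding a_def .
qed

lemma approximation_mean_square:
  "(\<Sum>chi\<in>chars - {chi0}. (cmod (L1 chi - (Asum chi)^2))^2) \<le> 16 * (ln p)^2"
proof -
  let ?t = "\<lambda>chi. cmod (\<Sum>k\<in>{p..<p^2}. of_real ((1 - r2 p k) / k) * chi k)"
  have "(\<Sum>chi\<in>chars - {chi0}. (cmod (L1 chi - (Asum chi)^2))^2) \<le> (\<Sum>chi\<in>chars - {chi0}. 2 * (?t chi)^2 + 2 * (2 / p)^2)"
  proof (rule sum_mono)
    fix chi assume "chi \<in> chars - {chi0}"
    then have "cmod (L1 chi - (Asum chi)^2) \<le> ?t chi + 2 / p" by (intro L1_minus_Asum_square) auto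
    then have "(cmod (L1 chi - (Asum chi)^2))^2 \<le> (?t chi + 2 / p)^2" by (rule power_mono) simp
    also have "\<dots> \<le> 2 * (?t chi)^2 + 2 * (2 / p)^2" using sum_squares_bound[of "?t chi" "2 / p"] by (simp add: power2_sum)
    finally show "(cmod (L1 chi - (Asum chi)^2))^2 \<le> 2 * (?t chi)^2 + 2 * (2 / p)^2" .
  qed
  also have "\<dots> \<le> (\<Sum>chi\<in>chars. 2 * (?t chi)^2 + 2 * (2 / p)^2)" using finite_chars by (intro sum_mono2) auto
  also have "\<dots> = 2 * (\<Sum>chi\<in>chars. (?t chi)^2) + (P - 1) * (2 * (2 / p)^2)"
    using p_gt_2 by (simp add: sum.distrib sum_distrib_left[symmetric] card_chars of_nat_diff)
  also have "\<dots> \<le> 2 * (6 * (ln p)^2) + 4"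
  proof (intro add_mono mult_left_mono tail_mean_square)
    have "2 * P \<le> P * P" using p_gt_2 by (intro mult_right_mono) auto
    then have "(P - 1) * 8 \<le> 4 * P^2" by (simp add: power2_eq_square algebra_simps)
    then show "(P - 1) * (2 * (2 / p)^2) \<le> 4" using p_gt_2 by (simp add: power_divide field_simps)
  qed simp
  also have "4 \<le> 4 * (ln p)^2" using ln_p_ge_1 by (simp add: one_le_power)
  finally show ?thesis by simp
qed

section \<open>The sixth moment\<close>


lemma dl_nat:
  assumes "0 < k" "k < p"
  shows "dl (int k) = (if k = 1 \<or> k = p - 1 then 1 else 0)" using square_eq_1_Zp[of "int k"] assms by (auto simp: dl_def)

lemma Vfun_square_sum:
  assumes "\<not> int p dvd n"
  shows "(\<Sum>k\<in>{0<..<p}. (Vfun n (int k))^2) \<le> 360000 * P^6"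
proof -
  have "(Vfun n (int k))^2 \<le> 200 * P^6 * dl (int k) + 320000 * P^5" if "k \<in> {0<..<p}" for k
  proof -
    have nk: "\<not> int p dvd int k" using that by (auto dest: dvd_imp_le)
    let ?a = "10 * P^3 * dl (int k)" and ?b = "Vfun n (int k) - 10 * P^3 * dl (int k)"
    have a2: "?a^2 = 100 * P^6 * dl (int k)"
      by (cases "int p dvd (int k)^2 - 1") (simp_all add: dl_def power_mult_distrib flip: power_mult)
    have "\<bar>?b\<bar> \<le> 400 * P^2 * sqrt p" using Vfun_bound[OF assms nk] .
    then have "\<bar>?b\<bar>^2 \<le> (400 * P^2 * sqrt p)^2" by (rule power_mono) simp
    also have "\<dots> = 160000 * P^5" by (simp add: power_mult_distrib power_numeral_reduce)
    finally have b2: "?b^2 \<le> 160000 * P^5" by simp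
    have "(Vfun n (int k))^2 = (?a + ?b)^2" by simp
    also have "\<dots> \<le> 2 * ?a^2 + 2 * ?b^2" using sum_squares_bound[of ?a ?b] by (simp only: power2_sum)
    finally show ?thesis unfolding a2 using b2 by linarith
  qed
  then have "(\<Sum>k\<in>{0<..<p}. (Vfun n (int k))^2) \<le> (\<Sum>k\<in>{0<..<p}. 200 * P^6 * dl (int k) + 320000 * P^5)" by (rule sum_mono)
  also have "\<dots> = 200 * P^6 * (\<Sum>k\<in>{0<..<p}. dl (int k)) + (P - 1) * (320000 * P^5)"
    using p_gt_2 by (simp add: sum.distrib sum_distrib_left of_nat_diff)
  also have "\<dots> \<le> 200 * P^6 * 2 + P * (320000 * P^5)"
  proof (intro add_mono mult_left_mono mult_right_mono)
    have "(\<Sum>k\<in>{0<..<p}. dl (int k)) = (\<Sum>k\<in>{0<..<p}. if k \<in> {1, p - 1} then 1 else 0)"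
      by (intro sum.cong refl) (simp add: dl_nat)
    also have "\<dots> = (\<Sum>k\<in>{0<..<p} \<inter> {1, p - 1}. 1)" by (rule sum.inter_restrict[symmetric]) simp
    also have "\<dots> = real (card ({0<..<p} \<inter> {1, p - 1}))" by (simp only: sum_constant mult_1_right)
    also have "card ({0<..<p} \<inter> {1, p - 1}) \<le> card {1, p - 1}" by (intro card_mono) auto
    also have "card {1, p - 1} \<le> 2" by (simp add: card_insert_if)
    finally show "(\<Sum>k\<in>{0<..<p}. dl (int k)) \<le> 2" by simp
  qed auto
  also have "\<dots> = 320400 * P^6" by (simp add: power_numeral_reduce)
  \<comment> \<open>The constant is rounded up to 600^2 so that the square root in
    \<open>sqrt_p_7\<close> is exact.\<close>
  also have "\<dots> \<le> 360000 * P^6" by (intro mult_right_mono) auto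
  finally show ?thesis .
qed

text \<open>Parseval: two indices in [0,p) are congruent only when equal, so the mean square reduces
  to \<open>Vfun_square_sum\<close>.\<close>

lemma Wsum_mean_square:
  assumes "\<not> int p dvd n"
  shows "(\<Sum>chi\<in>chars. (cmod (Wsum n chi))^2) \<le> 360000 * P^7"
proof -
  let ?V = "\<lambda>k. Vfun n (int k)"
  let ?t = "\<lambda>k l. if k mod p = l mod p \<and> \<not> p dvd k then ?V k * ?V l else 0"
  have "(\<Sum>chi\<in>chars. (cmod (Wsum n chi))^2) = (\<Sum>chi\<in>chars. (cmod (\<Sum>k\<in>{..<p}. of_real (?V k) * chi k))^2)"
  proof (rule sum.cong[OF refl])
    fix chi assume c: "chi \<in> chars"
    have "Wsum n chi = (\<Sum>k<p. chz chi (int k) * of_real (Vfun n (int k)))" unfolding Wsum_def by (rule sum_Zp_nat[symmetric])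
    then show "(cmod (Wsum n chi))^2 = (cmod (\<Sum>k\<in>{..<p}. of_real (Vfun n (int k)) * chi k))^2"
      by (simp add: chz_int[OF c] mult.commute)
  qed
  also have "\<dots> = (P - 1) * (\<Sum>k<p. \<Sum>l<p. ?t k l)" by (rule char_mean_square) simp
  also have "(\<Sum>k<p. \<Sum>l<p. ?t k l) = (\<Sum>k\<in>{0<..<p}. (Vfun n (int k))^2)"
  proof (rule sum.mono_neutral_cong_right)
    fix k assume k: "k \<in> {0<..<p}"
    then have "\<not> p dvd k" by (auto dest: dvd_imp_le)
    then have "(\<Sum>l<p. ?t k l) = (\<Sum>l<p. if k = l then ?V k * ?V l else 0)" using k by (intro sum.cong refl) auto
    then show "(\<Sum>l<p. ?t k l) = (Vfun n (int k))^2" using k by (simp add: power2_eq_square)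
  qed auto
  also have "(P - 1) * \<dots> \<le> P * (360000 * P^6)"
    using p_gt_2 by (intro mult_mono Vfun_square_sum[OF assms]) (auto intro: sum_nonneg)
  also have "\<dots> = 360000 * P^7" by (simp add: power_numeral_reduce)
  finally show ?thesis .
qed

lemma sqrt_p_7: "sqrt (360000 * P^7) = 600 * (P^3 * sqrt p)"
proof -
  have "360000 * P^7 = (600 * (P^3 * sqrt p))^2" by (simp add: power_mult_distrib power_numeral_reduce)
  then show ?thesis by (metis abs_of_nonneg mult_nonneg_nonneg of_nat_0_le_iff real_sqrt_abs real_sqrt_ge_zero zero_le_numeral zero_le_power)
qed

section \<open>The bilinear form produced by orthogonality, and its diagonal\<close>

abbreviation I :: "nat set" where "I \<equiv> {0<..<p}"

abbreviation b :: "nat \<Rightarrow> real" where "b m \<equiv> rr m / real m"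

lemma b_nonneg: "0 \<le> b m" using rr_nonneg by simp

lemma Asum_eq: "Asum chi = (\<Sum>m\<in>I. of_real (b m) * chi m)" unfolding Asum_def by (intro sum.cong refl) simp

text \<open>Serves for the principal character, whose term orthogonality includes and which has to
  be taken out again.\<close>

lemma norm_Asum_le:
  assumes "chi \<in> chars"
  shows "(cmod (Asum chi))^2 \<le> 1 + 2 * ln p"
proof -
  have "cmod (Asum chi) \<le> (\<Sum>m\<in>I. b m)" unfolding Asum_eq
  proof (rule sum_norm_le)
    fix m
    show "cmod (of_real (b m) * chi m) \<le> b m" unfolding norm_mult norm_of_real abs_of_nonneg[OF b_nonneg]
      by (rule mult_left_le[OF norm_char_le[OF assms] b_nonneg])
  qed
  then have "(cmod (Asum chi))^2 \<le> (\<Sum>m\<in>I. b m)^2" by (rule power_mono) simp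
  also have "\<dots> \<le> 1 + 2 * ln p" using p_gt_2 by (intro sum_rr_square_le) simp
  finally show ?thesis .
qed

definition bilin :: "int \<Rightarrow> real" where
  "bilin n = (\<Sum>m\<in>I. \<Sum>l\<in>I. b m * b l * Vfun n (int l * minv (int m)))"

definition diag :: real where
  "diag = (\<Sum>m<p. rs m) + (\<Sum>m\<in>I. b m * b (p - m))"

text \<open>With t = m d, \<open>Wsum n chi * chi m\<close> becomes the character sum of t -> V(t /
  m), from which orthogonality against chi(l) selects t = l.\<close>

lemma Wsum_twist:
  assumes "m \<in> I" "l \<in> I"
  shows "(\<Sum>chi\<in>chars. Wsum n chi * (chi m * cnj (chi l))) = of_real ((P - 1) * Vfun n (int l * minv (int m)))"
proof -
  let ?v = "\<lambda>t. complex_of_real (Vfun n (t * minv (int m)))"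
    and ?z = "complex_of_real ((P - 1) * Vfun n (int l * minv (int m)))"
  have nm: "\<not> int p dvd int m" "\<not> int p dvd int l" using assms by (auto dest: dvd_imp_le)
  have lZ: "int l \<in> Zp" using assms by simp
  have W: "Wsum n chi * chi m = (\<Sum>t\<in>Zp. ?v t * chz chi t)" if c: "chi \<in> chars" for chi
  proof -
    let ?F = "\<lambda>t. ?v t * chz chi t"
    have perF: "per ?F" using per_comp[OF per_Vfun, of "\<lambda>t. t * minv (int m)" n] per_chz[of chi]
      by (simp add: per_def cong_map_intros)
    have "Wsum n chi * chi m = (\<Sum>d\<in>Zp. ?F (int m * d + 0))" unfolding Wsum_def sum_distrib_right
    proof (rule sum.cong[OF refl])
      fix d
      have "[int m * minv (int m) * d = 1 * d] (mod int p)" by (intro cong_mult cong_refl inv_cong[OF nm(1)])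
      then have "Vfun n (int m * minv (int m) * d) = Vfun n (1 * d)" using per_Vfun unfolding per_def by blast
      then have "Vfun n ((int m * d + 0) * minv (int m)) = Vfun n d" by (simp add: mult_ac)
      then show "chz chi d * of_real (Vfun n d) * chi m = ?F (int m * d + 0)"
        by (simp add: chz_mult[OF c] chz_int[OF c] mult_ac)
    qed
    also have "\<dots> = (\<Sum>t\<in>Zp. ?F t)" by (rule sum_affine[OF perF nm(1)])
    finally show ?thesis .
  qed
  have "(\<Sum>chi\<in>chars. Wsum n chi * (chi m * cnj (chi l))) = (\<Sum>chi\<in>chars. \<Sum>t\<in>Zp. ?v t * (chz chi t * cnj (chz chi (int l))))"
    by (intro sum.cong refl) (simp add: W mult.assoc[symmetric] sum_distrib_right chz_int)
  also have "\<dots> = (\<Sum>t\<in>Zp. ?v t * (\<Sum>chi\<in>chars. chz chi t * cnj (chz chi (int l))))"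
    by (subst sum.swap) (simp add: sum_distrib_left)
  also have "\<dots> = (\<Sum>t\<in>Zp. if t = int l then ?z else 0)"
  proof (rule sum.cong[OF refl])
    fix t assume t: "t \<in> Zp"
    show "?v t * (\<Sum>chi\<in>chars. chz chi t * cnj (chz chi (int l))) = (if t = int l then ?z else 0)"
    proof (cases "int p dvd t")
      case True
      then have "chz chi t = 0" if "chi \<in> chars" for chi using chz_eq_0_iff[OF that] by blast
      then have "(\<Sum>chi\<in>chars. chz chi t * cnj (chz chi (int l))) = 0" by (intro sum.neutral) simp
      moreover have "t \<noteq> int l" using True nm(2) by blast
      ultimately show ?thesis by simp
    next
      case False
      show ?thesis unfolding sum_chars_orthogonal[OF False nm(2)] Zp_cong_eq[OF t lZ] using p_gt_2
        by (auto simp: of_nat_diff)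
    qed
  qed
  also have "\<dots> = ?z" using lZ by simp
  finally show ?thesis .
qed

lemma Wsum_Asum:
  "(\<Sum>chi\<in>chars. Wsum n chi * of_real ((cmod (Asum chi))^2)) = of_real ((P - 1) * bilin n)"
proof -
  have "(\<Sum>chi\<in>chars. Wsum n chi * of_real ((cmod (Asum chi))^2))
     = (\<Sum>chi\<in>chars. \<Sum>m\<in>I. \<Sum>l\<in>I. of_real (b m * b l) * (Wsum n chi * (chi m * cnj (chi l))))"
    unfolding complex_norm_square Asum_eq cnj_sum sum_product unfolding sum_distrib_left by (intro sum.cong refl) simp
  also have "\<dots> = (\<Sum>m\<in>I. \<Sum>l\<in>I. of_real (b m * b l) * (\<Sum>chi\<in>chars. Wsum n chi * (chi m * cnj (chi l))))"
    unfolding sum_distrib_left by (subst sum.swap, rule sum.cong[OF refl], rule sum.swap)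
  also have "\<dots> = (\<Sum>m\<in>I. \<Sum>l\<in>I. of_real (b m * b l) * of_real ((P - 1) * Vfun n (int l * minv (int m))))"
    by (intro sum.cong refl) (simp only: Wsum_twist)
  also have "\<dots> = of_real ((P - 1) * bilin n)"
    unfolding bilin_def sum_distrib_left of_real_sum of_real_mult[symmetric] by (intro sum.cong refl arg_cong[of _ _ of_real]) simp
  finally show ?thesis .
qed

text \<open>The condition (l / m)^2 = 1 says that \<open>p\<close> divides (l - m) (l + m), that is
  l = m or l = p - m for indices in (0,p). These differ because \<open>p\<close> is odd, so the two
  indicators may be added.\<close>

lemma dl_quotient:
  assumes "m \<in> I" "l \<in> I"
  shows "dl (int l * minv (int m)) = (if l = m then 1 else 0) + (if l = p - m then 1 else 0)"
proof -
  have nm: "\<not> int p dvd int m" using assms by (auto dest: dvd_imp_le)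
  let ?c = "int l * minv (int m)"
  have "int p dvd ?c^2 - 1 \<longleftrightarrow> int p dvd (int m)^2 * (?c^2 - 1)" using nm by (simp add: dvd_mult_p power2_eq_square)
  also have "(int m)^2 * (?c^2 - 1) = (int l * (int m * minv (int m)))^2 - (int m)^2"
    by (simp add: power2_eq_square algebra_simps)
  also have "int p dvd \<dots> \<longleftrightarrow> int p dvd (int l * 1)^2 - (int m)^2"
    by (intro cong_dvd_iff cong_diff cong_pow cong_mult cong_refl inv_cong[OF nm])
  also have "(int l * 1)^2 - (int m)^2 = (int l - int m) * (int l + int m)" by (simp add: power2_eq_square algebra_simps)
  also have "int p dvd \<dots> \<longleftrightarrow> int p dvd int l - int m \<or> int p dvd int (l + m)" by (simp add: dvd_mult_p)
  also have "int p dvd int l - int m \<longleftrightarrow> l = m" using assms Zp_cong_eq[of "int l" "int m"] by (simp add: cong_iff_dvd_diff)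
  also have "int p dvd int (l + m) \<longleftrightarrow> l = p - m"
  proof
    assume "int p dvd int (l + m)"
    then have "p dvd l + m" by (simp only: int_dvd_int_iff)
    then obtain j where j: "l + m = p * j" ..
    have "j = 1"
    proof -
      have "l + m < p * 2" "l + m \<noteq> 0" using assms by auto
      then have "p * j < p * 2" "p * j \<noteq> 0" unfolding j by auto
      then have "j < 2" "j \<noteq> 0" by auto
      then show ?thesis by simp
    qed
    then show "l = p - m" using j by simp
  next
    assume "l = p - m"
    then have "l + m = p" using assms by simp
    then show "int p dvd int (l + m)" by simp
  qed
  finally have "int p dvd ?c^2 - 1 \<longleftrightarrow> l = m \<or> l = p - m" .
  moreover have "m \<noteq> p - m"
  proof
    assume "m = p - m"
    then have "p = 2 * m" using assms by simp
    then show False using p_mod_4 by presburger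
  qed
  ultimately show ?thesis by (auto simp: dl_def)
qed

text \<open>Partial fractions: 1 / (m (p - m)) = (1/m + 1/(p - m)) / p. So the solutions l = p - m
  contribute only O(ln p / p) to \<open>diag\<close>.\<close>

lemma reflected_sum_le: "(\<Sum>m\<in>I. b m * b (p - m)) \<le> 4 * ln p / p"
proof -
  have "(\<Sum>m\<in>I. b m * b (p - m)) \<le> (\<Sum>m\<in>I. (1 / real m + 1 / real (p - m)) / p)"
  proof (rule sum_mono)
    fix m assume m: "m \<in> I"
    have "b m * b (p - m) \<le> 1 / real m * (1 / real (p - m))"
      using rr_le_1 rr_nonneg by (intro mult_mono divide_right_mono divide_nonneg_nonneg) auto
    also have "\<dots> = (1 / real m + 1 / real (p - m)) / p"
    proof -
      have "real (p - m) = P - real m" "P - real m \<noteq> 0" using m by (auto simp: of_nat_diff)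
      then show ?thesis using m by (simp add: field_simps)
    qed
    finally show "b m * b (p - m) \<le> (1 / real m + 1 / real (p - m)) / p" .
  qed
  also have "\<dots> = ((\<Sum>m\<in>I. 1 / real m) + (\<Sum>m\<in>I. 1 / real (p - m))) / p"
    by (simp add: sum_divide_distrib[symmetric] sum.distrib)
  also have "(\<Sum>m\<in>I. 1 / real (p - m)) = (\<Sum>m\<in>I. 1 / real m)"
    by (rule sum.reindex_bij_witness[of _ "\<lambda>m. p - m" "\<lambda>m. p - m"]) auto
  also have "(\<Sum>m\<in>I. 1 / real m) \<le> 2 * ln p"
  proof -
    have "(\<Sum>m\<in>I. 1 / real m) \<le> (\<Sum>m\<in>{0<..p}. 1 / real m)" by (intro sum_mono2) auto
    also have "\<dots> \<le> 1 + ln p" using p_gt_2 by (intro harmonic_le) simp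
    finally show ?thesis using ln_p_ge_1 by simp
  qed
  finally show ?thesis using p_gt_2 by (simp add: divide_right_mono)
qed

lemma diagonal_sum:
  "(\<Sum>m\<in>I. \<Sum>l\<in>I. b m * b l * dl (int l * minv (int m))) = diag" (is "(\<Sum>m\<in>I. \<Sum>l\<in>I. ?t m l) = _")
proof -
  have "(\<Sum>l\<in>I. ?t m l) = rs m + b m * b (p - m)" if m: "m \<in> I" for m
  proof -
    have "(\<Sum>l\<in>I. ?t m l) = (\<Sum>l\<in>I. (if l = m then b m * b l else 0) + (if l = p - m then b m * b l else 0))"
      by (intro sum.cong refl) (simp add: dl_quotient[OF m])
    also have "\<dots> = b m * b m + b m * b (p - m)" using m by (simp add: sum.distrib)
    finally show ?thesis by (simp add: rs_def power2_eq_square)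
  qed
  then have "(\<Sum>m\<in>I. \<Sum>l\<in>I. ?t m l) = (\<Sum>m\<in>I. rs m) + (\<Sum>m\<in>I. b m * b (p - m))" by (simp add: sum.distrib)
  moreover have "(\<Sum>m<p. rs m) = (\<Sum>m\<in>I. rs m)" by (rule sum.mono_neutral_right) (auto simp: rs_def)
  ultimately show ?thesis by (simp add: diag_def)
qed

lemma bilinear_main_term:
  assumes "\<not> int p dvd n"
  shows "\<bar>(P - 1) * bilin n - 10 * P^3 * (P - 1) * diag\<bar> \<le> 1200 * (P^3 * sqrt p * ln p)"
proof -
  let ?D = "\<lambda>m l. Vfun n (int l * minv (int m)) - 10 * P^3 * dl (int l * minv (int m))"
    and ?c = "400 * P^2 * sqrt p"
  have eq: "bilin n - 10 * P^3 * diag = (\<Sum>m\<in>I. \<Sum>l\<in>I. b m * b l * ?D m l)"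
    unfolding bilin_def diagonal_sum[symmetric] sum_distrib_left sum_subtractf[symmetric]
    by (intro sum.cong refl) (simp add: algebra_simps)
  have "\<bar>bilin n - 10 * P^3 * diag\<bar> \<le> (\<Sum>m\<in>I. \<Sum>l\<in>I. b m * b l * ?c)" unfolding eq
  proof (rule order.trans[OF sum_abs], rule sum_mono, rule order.trans[OF sum_abs], rule sum_mono)
    fix m l assume ml: "m \<in> I" "l \<in> I"
    then have "\<not> int p dvd int l * minv (int m)" by (auto simp: dvd_mult_p inv_dvd_iff dest: dvd_imp_le)
    then have "b m * b l * \<bar>?D m l\<bar> \<le> b m * b l * ?c"
      by (intro mult_left_mono Vfun_bound[OF assms] mult_nonneg_nonneg b_nonneg)
    then show "\<bar>b m * b l * ?D m l\<bar> \<le> b m * b l * ?c"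
      using mult_nonneg_nonneg[OF b_nonneg[of m] b_nonneg[of l]] by (simp only: abs_mult[of "b m * b l"] abs_of_nonneg)
  qed
  also have "\<dots> = (\<Sum>m\<in>I. b m) * (\<Sum>m\<in>I. b m) * ?c" by (subst sum_product) (simp only: sum_distrib_right)
  also have "\<dots> = (\<Sum>m\<in>I. b m)^2 * ?c" by (simp only: power2_eq_square)
  also have "\<dots> \<le> (1 + 2 * ln p) * ?c" using p_gt_2 by (intro mult_right_mono sum_rr_square_le) auto
  also have "\<dots> \<le> (3 * ln p) * ?c" using ln_p_ge_1 by (intro mult_right_mono) auto
  finally have *: "\<bar>bilin n - 10 * P^3 * diag\<bar> \<le> (3 * ln p) * ?c" .
  have eq2: "(P - 1) * bilin n - 10 * P^3 * (P - 1) * diag = (P - 1) * (bilin n - 10 * P^3 * diag)"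
    by (simp add: algebra_simps)
  have "\<bar>(P - 1) * bilin n - 10 * P^3 * (P - 1) * diag\<bar> = (P - 1) * \<bar>bilin n - 10 * P^3 * diag\<bar>"
    unfolding eq2 abs_mult[of "P - 1"] using p_gt_2 by simp
  also have "\<dots> \<le> P * ((3 * ln p) * ?c)" using * by (intro mult_mono) auto
  also have "\<dots> = 1200 * (P^3 * sqrt p * ln p)" by (simp add: power2_eq_square power3_eq_cube)
  finally show ?thesis .
qed

text \<open>Three replacements are paid for: p - 1 by \<open>p\<close> costs the bounded sum
  \<open>R\<close>, \<open>R\<close> by \<open>C_const\<close> costs a tail of at most 1 / (p - 1),
  and dropping the reflected sum costs O(ln p / p). After multiplication by 10 p^4 all are O(p^3 ln
  p).\<close>

lemma constant_term:
  "\<bar>10 * P^3 * (P - 1) * diag - 10 * C_const * P^4\<bar> \<le> 80 * (P^3 * sqrt p * ln p)"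
proof -
  define R where "R = (\<Sum>m<p. rs m)"
  define D where "D = (\<Sum>m\<in>I. b m * b (p - m))"
  have R: "0 \<le> R" "R \<le> C_const" "C_const \<le> R + 1 / (P - 1)"
    unfolding R_def C_const_eq using suminf_rs_bounds[of p] p_gt_2 by (auto intro: sum_nonneg rs_nonneg)
  have "C_const \<le> (\<Sum>n<2. rs n) + 1" unfolding C_const_eq using suminf_rs_bounds(2)[of 2] by simp
  then have C2: "C_const \<le> 2" by (simp add: rs_def rr_1 numeral_2_eq_2)
  have D: "0 \<le> D" "D \<le> 4 * ln p / p"
    unfolding D_def by (intro sum_nonneg mult_nonneg_nonneg b_nonneg) (rule reflected_sum_le)
  have p1: "1 < P" using p_gt_2 by simp
  have "(P - 1) * D \<le> P * (4 * ln p / p)" using D p1 by (intro mult_mono) auto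
  then have D4: "(P - 1) * D \<le> 4 * ln p" using p1 by simp
  have "P * (C_const - R) \<le> P * (1 / (P - 1))" using R p1 by (intro mult_left_mono) auto
  also have "\<dots> \<le> 2" using p_gt_2 by (simp add: field_simps)
  finally have "P * (C_const - R) \<le> 2" .
  moreover have "0 \<le> P * (C_const - R)" "0 \<le> (P - 1) * D" using R D p1 by auto
  moreover have eq: "(P - 1) * (R + D) - C_const * p = (P - 1) * D - R - P * (C_const - R)" by (simp add: algebra_simps)
  ultimately have "\<bar>(P - 1) * (R + D) - C_const * p\<bar> \<le> 8 * ln p" using D4 R C2 ln_p_ge_1 unfolding eq by linarith
  then have "10 * P^3 * \<bar>(P - 1) * (R + D) - C_const * p\<bar> \<le> 10 * P^3 * (8 * ln p)" by (intro mult_left_mono) auto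
  also have "\<dots> = 80 * (P^3 * ln p) * 1" by simp
  also have "\<dots> \<le> 80 * (P^3 * ln p) * sqrt p" using p1 ln_p_ge_1 by (intro mult_left_mono) auto
  also have "\<dots> = 80 * (P^3 * sqrt p * ln p)" by simp
  finally have "10 * P^3 * \<bar>(P - 1) * (R + D) - C_const * p\<bar> \<le> 80 * (P^3 * sqrt p * ln p)" .
  moreover have "10 * P^3 * (P - 1) * (R + D) - 10 * C_const * P^4 = 10 * P^3 * ((P - 1) * (R + D) - C_const * p)"
    by (simp add: power_numeral_reduce algebra_simps)
  then have "\<bar>10 * P^3 * (P - 1) * (R + D) - 10 * C_const * P^4\<bar> = 10 * P^3 * \<bar>(P - 1) * (R + D) - C_const * p\<bar>"
    by (simp only: abs_mult) simp
  ultimately show ?thesis unfolding R_def D_def diag_def by simp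
qed

lemma sixth_moment:
  assumes "\<not> int p dvd n"
  shows "\<bar>(\<Sum>chi\<in>chars - {chi0}. (cmod (gauss_sum2 n chi p))^6 * cmod (L1 chi)) - 10 * C_const * P^4\<bar>
    \<le> 6000 * (P^3 * sqrt p * ln p)"
proof -
  let ?X = "chars - {chi0}" and ?Q = "P^3 * sqrt p"
  let ?G = "\<lambda>chi. (cmod (gauss_sum2 n chi p))^6"
  have L: "1 \<le> ln (P)" by (rule ln_p_ge_1)
  have G: "?G chi = cmod (Wsum n chi)" if "chi \<in> ?X" for chi
    using gauss_sum_sixth_power[of chi n] that assms by (metis DiffD1 DiffD2 abs_of_nonneg insertI1 norm_ge_zero norm_of_real zero_le_power)
  define T where "T = (\<Sum>chi\<in>?X. ?G chi * cmod (L1 chi))"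
  define M where "M = (\<Sum>chi\<in>?X. ?G chi * (cmod (Asum chi))^2)"
  let ?B = "(P - 1) * bilin n"
  have TM: "\<bar>T - M\<bar> \<le> 2400 * (?Q * ln p)"
  proof -
    have eq: "T - M = (\<Sum>chi\<in>?X. ?G chi * (cmod (L1 chi) - cmod ((Asum chi)^2)))"
      unfolding T_def M_def by (simp add: sum_subtractf right_diff_distrib norm_power)
    have "\<bar>T - M\<bar> \<le> (\<Sum>chi\<in>?X. \<bar>cmod (Wsum n chi)\<bar> * \<bar>cmod (L1 chi - (Asum chi)^2)\<bar>)" unfolding eq
    proof (rule order.trans[OF sum_abs], rule sum_mono)
      fix chi assume c: "chi \<in> ?X"
      show "\<bar>?G chi * (cmod (L1 chi) - cmod ((Asum chi)^2))\<bar> \<le> \<bar>cmod (Wsum n chi)\<bar> * \<bar>cmod (L1 chi - (Asum chi)^2)\<bar>"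
        unfolding abs_mult G[OF c] by (intro mult_left_mono) (use norm_triangle_ineq3 in auto)
    qed
    \<comment> \<open>Cauchy-Schwarz, since the sixth powers and the approximation error are both
      estimated in mean square over the characters.\<close>
    also have "\<dots> \<le> L2_set (\<lambda>chi. cmod (Wsum n chi)) ?X * L2_set (\<lambda>chi. cmod (L1 chi - (Asum chi)^2)) ?X"
      by (rule L2_set_mult_ineq)
    also have "\<dots> \<le> sqrt (360000 * P^7) * sqrt (16 * (ln p)^2)" unfolding L2_set_def
    proof (intro mult_mono real_sqrt_le_mono approximation_mean_square)
      have "(\<Sum>chi\<in>?X. (cmod (Wsum n chi))^2) \<le> (\<Sum>chi\<in>chars. (cmod (Wsum n chi))^2)"
        using finite_chars by (intro sum_mono2) auto
      also have "\<dots> \<le> 360000 * P^7" by (rule Wsum_mean_square[OF assms])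
      finally show "(\<Sum>chi\<in>?X. (cmod (Wsum n chi))^2) \<le> 360000 * P^7" .
    qed (auto intro: sum_nonneg)
    also have "sqrt (16 * (ln p)^2) = 4 * ln p" using L by (simp add: real_sqrt_mult)
    finally show ?thesis unfolding sqrt_p_7 by simp
  qed
  have MB: "\<bar>M - ?B\<bar> \<le> 1800 * (?Q * ln p)"
  proof -
    have "complex_of_real M = (\<Sum>chi\<in>?X. Wsum n chi * of_real ((cmod (Asum chi))^2))"
      unfolding M_def of_real_sum of_real_mult using gauss_sum_sixth_power[OF _ _ assms] by (intro sum.cong refl) simp
    \<comment> \<open>Orthogonality requires all characters. The term of the principal character, to
      which \<open>gauss_sum_sixth_power\<close> does not apply, is inserted and later bounded as a
      single term of the mean square of \<open>Wsum\<close>.\<close>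
    also have "\<dots> = (\<Sum>chi\<in>chars. Wsum n chi * of_real ((cmod (Asum chi))^2)) - Wsum n chi0 * of_real ((cmod (Asum chi0))^2)"
      using finite_chars principal_in_chars by (simp add: sum_diff1)
    also have "(\<Sum>chi\<in>chars. Wsum n chi * of_real ((cmod (Asum chi))^2)) = of_real ?B" by (rule Wsum_Asum)
    finally have "complex_of_real (M - ?B) = - (Wsum n chi0 * of_real ((cmod (Asum chi0))^2))" by simp
    then have "\<bar>M - ?B\<bar> = cmod (Wsum n chi0) * (cmod (Asum chi0))^2"
      by (metis abs_of_nonneg norm_minus_cancel norm_mult norm_of_real zero_le_power2)
    also have "\<dots> \<le> 600 * ?Q * (3 * ln p)"
    proof (rule mult_mono)
      have "(cmod (Wsum n chi0))^2 \<le> (\<Sum>chi\<in>chars. (cmod (Wsum n chi))^2)"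
        using finite_chars principal_in_chars by (intro member_le_sum) auto
      also have "\<dots> \<le> 360000 * P^7" by (rule Wsum_mean_square[OF assms])
      finally show "cmod (Wsum n chi0) \<le> 600 * ?Q" unfolding sqrt_p_7[symmetric] by (rule real_le_rsqrt)
      show "(cmod (Asum chi0))^2 \<le> 3 * ln p" using norm_Asum_le[OF principal_in_chars] L by linarith
    qed auto
    finally show ?thesis by simp
  qed
  have "0 \<le> ?Q * ln p" using L by simp
  \<comment> \<open>The four errors add up to 2400 + 1800 + 1200 + 80 = 5480 <= 6000.\<close>
  then show ?thesis using TM MB bilinear_main_term[OF assms] constant_term unfolding T_def[symmetric] by linarith
qed

end

theorem theorem4:
  shows "\<exists>K::real. \<forall>(p::nat) (n::int).
     prime p \<and> p mod 4 = 1 \<and> coprime n (int p) \<longrightarrow>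
     \<bar>(\<Sum>chi\<in>{chi.  dirichlet_char p chi \<and> chi \<noteq> principal_char p}.
          (cmod (gauss_sum2 n chi p))^6 * cmod (L1 chi))
        - 10 * C_const * (real p)^4\<bar>
     \<le> K * (real p) powr (7/2) * ln (real p)"
proof (intro exI[of _ 6000] allI impI)
  fix p :: nat and n :: int
  assume *: "prime p \<and> p mod 4 = 1 \<and> coprime n (int p)"
  let ?S = "\<lambda>p n. \<bar>(\<Sum>chi\<in>{chi. dirichlet_char p chi \<and> chi \<noteq> principal_char p}.
    (cmod (gauss_sum2 n chi p))^6 * cmod (L1 chi)) - 10 * C_const * (real p)^4\<bar>"
  interpret prime_1_mod_4 p using * by unfold_locales auto
  have n: "\<not> int p dvd n" using * coprime_iff by blast
  have "{chi. dirichlet_char p chi \<and> chi \<noteq> principal_char p} = chars - {principal_char p}" by (auto simp: chars_def)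
  moreover have "real p powr (7/2) = (real p)^3 * sqrt p"
  proof -
    have "real p powr (7/2) = real p powr (3 + 1/2)" by simp
    also have "\<dots> = real p powr 3 * real p powr (1/2)" by (rule powr_add)
    also have "\<dots> = (real p)^3 * sqrt p" using p_gt_2 by (simp add: powr_half_sqrt)
    finally show ?thesis .
  qed
  ultimately show "?S p n \<le> 6000 * (real p) powr (7/2) * ln (real p)" using sixth_moment[OF n] by (simp add: mult.assoc)
qed

end
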